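(* Let $\mathcal{T}_\Gamma$ be the tiling of $\overline{\mathbb{H}}^4$ generated by the simply truncated Coxeter orthoscheme $\widehat{\mathcal S}$ with Schläfli symbol $\{4,4,3,4,\infty\}$, whose ideal vertices are $A_0$ and $A_3$ and whose volume is $\frac{\pi^2}{144}$. Then the optimal horoball packing density of $\mathcal{T}_\Gamma$ is $$\delta_{opt}(\mathcal{T}_\Gamma)=\frac{\mathrm{vol}(\mathcal{B}_0^{opt}\cap\widehat{\mathcal S})+\mathrm{vol}(\mathcal{B}_3^{opt}\cap\widehat{\mathcal S})}{\frac{\pi^2}{144}}\approx 0.71645,$$ where $\mathcal{B}_0^{opt}$ and $\mathcal{B}_3^{opt}$ are the maximal horoballs centered at $A_0$ and $A_3$.
   Context: Simply truncated Coxeter orthoschemes with parallel faces. Let $\mathbb{R}^{n+1}$ carry the Lorentzian form $\langle x,y\rangle=-x^0y^0+x^1y^1+\dots+x^ny^n$, and use the projective (Beltrami–Cayley–Klein) model of $\mathbb{H}^n$ (curvature $-1$), with ideal points $\partial\mathbb{H}^n$ (null vectors), $\overline{\mathbb{H}}^n=\mathbb{H}^n\cup\partial\mathbb{H}^n$, and outer points (vectors of positive norm). For a symbol $\{m_1,\dots,m_n,\infty\}$ let $H^0,\dots,H^{n+1}$ be hyperplanes with outward unit normals $b^0,\dots,b^{n+1}$ satisfying $\langle b^i,b^i\rangle=1$, $\langle b^{i-1},b^i\rangle=-\cos(\pi/m_i)$ for $1\le i\le n$, $\langle b^n,b^{n+1}\rangle=-1$ (i.e. $H^n,H^{n+1}$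 are parallel), and $\langle b^i,b^j\rangle=0$ for $|i-j|\ge 2$. The fundamental domain $\widehat{\mathcal S}=\mathcal F$ is the polytope bounded by $H^0,\dots,H^{n+1}$. For $0\le i\le n$, $A_i$ denotes the common point of the $H^j$ with $0\le j\le n$, $j\ne i$; $A_n$ is an outer point, $H^{n+1}$ is its polar hyperplane (the truncating hyperplane), and $A_{n-1}$ is ideal. $\Gamma$ is the discrete group generated by the reflections in $H^0,\dots,H^{n+1}$; the images of $\mathcal F$ under $\Gamma$ form the tiling $\mathcal{T}_\Gamma$ of $\overline{\mathbb{H}}^n$. Here $n=4$. Horoball packings. A horoball packing of $\mathcal{T}_\Gamma$ consists of the $\Gamma$-images of a nonempty family of horoballs $B_i$ centered at ideal vertices of $\mathcal F$ (at most one per ideal vertex, their sizes being independent of one another), such that no two horoballs have a common interior point (tangency is allowed) and no $B_i$ extends beyond a bounding hyperplane of $\mathcal F$ that does not contain its center. Its density is $\sum_i \mathrm{vol}(B_i\cap\mathcal F)/\mathrm{vol}(\mathcal F)$, and $\delta_{opt}(\mathcal{T}_\Gamma)$ is the supremum of the densities of all such packings. The maximal horoball $\mathcal{B}_i^{opt}$ at an ideal vertex $A_i$ is the largest horoball centered at $A_i$ that does not extend beyond a bounding hyperplane of $\mathcal F$ not containing $A_i$. The sign $\approx$ indicates a decimal approximation accurate to within one unit of the last displayed digit. *)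

theory Defs
  imports "HOL-Analysis.Analysis"
begin

text \<open>
  The Lorentzian space is modelled by \<^typ>\<open>real \<times> (real^'n)\<close>, where the first component is
  $x^0$ and the hyperbolic dimension is $n$ = \<^term>\<open>CARD('n)\<close>. Hyperbolic space is the open
  unit ball of \<^typ>\<open>real^'n\<close> (projective model in the affine chart $x^0 = 1$), and its ideal
  points are the points of norm 1.
\<close>

definition lorentz :: "real \<times> (real^'n) \<Rightarrow> real \<times> (real^'n) \<Rightarrow> real" where
  "lorentz u v = - (fst u * fst v) + snd u \<bullet> snd v"

definition lift :: "real^'n \<Rightarrow> real \<times> (real^'n)" where
  "lift x = (1, x)"

definition proj :: "real \<times> (real^'n) \<Rightarrow> real^'n" where
  "proj v = snd v /\<^sub>R fst v"

definition hyp_space :: "(real^'n) set" where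
  "hyp_space = {x. norm x < 1}"

text \<open>
  The volume element of the projective model of curvature $-1$ is
  $(1 - |x|^2)^{-(n+1)/2}\,dx$.
\<close>

definition hyp_measure :: "(real^'n) measure" where
  "hyp_measure = density lborel
     (\<lambda>x. if x \<in> hyp_space then ennreal (1 / sqrt (1 - (norm x)\<^sup>2) ^ (CARD('n) + 1)) else 0)"

definition hyp_vol :: "(real^'n) set \<Rightarrow> real" where
  "hyp_vol S = measure hyp_measure S"

text \<open>
  \<open>orthoscheme_normals [m1, ..., mn] b\<close>: the vectors \<open>b 0, ..., b (n+1)\<close> are outward unit
  normals for the symbol $\{m_1,\dots,m_n,\infty\}$. The products only determine the normals up to
  a common sign; the last conjunct says that they point outwards, i.e. that the intersection of
  the half-spaces on their negative sides is the polytope in hyperbolic space (for the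
  opposite sign that intersection has no point in hyperbolic space).
\<close>

definition orthoscheme_normals :: "nat list \<Rightarrow> (nat \<Rightarrow> real \<times> (real^'n)) \<Rightarrow> bool" where
  "orthoscheme_normals ms b \<longleftrightarrow>
     length ms = CARD('n) \<and>
     (\<forall>i \<le> CARD('n) + 1. lorentz (b i) (b i) = 1) \<and>
     (\<forall>i \<in> {1..CARD('n)}. lorentz (b (i - 1)) (b i) = - cos (pi / real (ms ! (i - 1)))) \<and>
     lorentz (b CARD('n)) (b (CARD('n) + 1)) = - 1 \<and>
     (\<forall>i j. i + 2 \<le> j \<and> j \<le> CARD('n) + 1 \<longrightarrow> lorentz (b i) (b j) = 0) \<and>
     (\<exists>x \<in> hyp_space. \<forall>i \<le> CARD('n) + 1. lorentz (lift x) (b i) < 0)"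

definition hyperplane :: "real \<times> (real^'n) \<Rightarrow> (real^'n) set" where
  "hyperplane c = {x. lorentz (lift x) c = 0}"

definition halfspace :: "real \<times> (real^'n) \<Rightarrow> (real^'n) set" where
  "halfspace c = {x. lorentz (lift x) c \<le> 0}"

text \<open>
  The polytope is not cut with the ball: for a polytope with vertices in the closed hyperbolic
  space this makes no difference, and the extreme points of norm 1 are exactly the ideal vertices.
\<close>

definition fund_domain :: "(nat \<Rightarrow> real \<times> (real^'n)) \<Rightarrow> (real^'n) set" where
  "fund_domain b = (\<Inter>i \<in> {..CARD('n) + 1}. halfspace (b i))"

text \<open>
  The point $A_i$, for $i \le n$, as a point of the affine chart (in which all points of the closed
  hyperbolic space lie). The outer point $A_n$ may lie outside the chart and is not used.
\<close>

definition vertex :: "(nat \<Rightarrow> real \<times> (real^'n)) \<Rightarrow> nat \<Rightarrow> real^'n" where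
  "vertex b i = (THE p. \<forall>j \<in> {..CARD('n)} - {i}. p \<in> hyperplane (b j))"

definition ideal_vertices :: "(nat \<Rightarrow> real \<times> (real^'n)) \<Rightarrow> (real^'n) set" where
  "ideal_vertices b = {p. norm p = 1 \<and> p extreme_point_of fund_domain b}"

definition reflection :: "real \<times> (real^'n) \<Rightarrow> real \<times> (real^'n) \<Rightarrow> real \<times> (real^'n)" where
  "reflection c v = v - (2 * lorentz v c) *\<^sub>R c"

text \<open>
  The group generated by the reflections in $H^0,\dots,H^{n+1}$, as a group of linear maps. Since
  the generators are involutions, closing under composition with generators suffices.
\<close>

inductive_set refl_group ::
    "(nat \<Rightarrow> real \<times> (real^'n)) \<Rightarrow> (real \<times> (real^'n) \<Rightarrow> real \<times> (real^'n)) set"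
  for b :: "nat \<Rightarrow> real \<times> (real^'n)" where
  one: "id \<in> refl_group b"
| refl: "g \<in> refl_group b \<Longrightarrow> i \<le> CARD('n) + 1 \<Longrightarrow> reflection (b i) \<circ> g \<in> refl_group b"

definition act :: "(real \<times> (real^'n) \<Rightarrow> real \<times> (real^'n)) \<Rightarrow> real^'n \<Rightarrow> real^'n" where
  "act g x = proj (g (lift x))"

text \<open>
  The horoball of size \<open>s > 0\<close> centered at the ideal point \<open>p\<close>: a sublevel set
  $\{-\langle x, p\rangle \le s\}$ on the hyperboloid $\langle x,x\rangle = -1$, i.e. of the Busemann
  function of \<open>p\<close>, written for the unnormalized representative \<^term>\<open>lift x\<close>.
\<close>

definition horoball :: "real^'n \<Rightarrow> real \<Rightarrow> (real^'n) set" where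
  "horoball p s = {x \<in> hyp_space.
     - lorentz (lift x) (lift p) \<le> s * sqrt (- lorentz (lift x) (lift x))}"

definition confined :: "(nat \<Rightarrow> real \<times> (real^'n)) \<Rightarrow> real^'n \<Rightarrow> (real^'n) set \<Rightarrow> bool" where
  "confined b p B \<longleftrightarrow>
     (\<forall>i \<le> CARD('n) + 1. p \<notin> hyperplane (b i) \<longrightarrow> B \<subseteq> halfspace (b i))"

text \<open>The largest horoball, with respect to inclusion, centered at \<open>p\<close> and confined.\<close>

definition max_horoball :: "(nat \<Rightarrow> real \<times> (real^'n)) \<Rightarrow> real^'n \<Rightarrow> (real^'n) set" where
  "max_horoball b p = (GREATEST B. (\<exists>s > 0. B = horoball p s) \<and> confined b p B)"

text \<open>
  A packing is given by the set \<open>V\<close> of ideal vertices that carry a horoball and by the size of the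
  horoball at each of them.
\<close>

definition horoball_packing ::
    "(nat \<Rightarrow> real \<times> (real^'n)) \<Rightarrow> (real^'n) set \<Rightarrow> (real^'n \<Rightarrow> real) \<Rightarrow> bool" where
  "horoball_packing b V s \<longleftrightarrow>
     V \<subseteq> ideal_vertices b \<and> V \<noteq> {} \<and>
     (\<forall>p \<in> V. s p > 0 \<and> confined b p (horoball p (s p))) \<and>
     pairwise (\<lambda>B B'. interior B \<inter> interior B' = {})
       {act g ` horoball p (s p) | g p. g \<in> refl_group b \<and> p \<in> V}"

definition packing_density ::
    "(nat \<Rightarrow> real \<times> (real^'n)) \<Rightarrow> (real^'n) set \<Rightarrow> (real^'n \<Rightarrow> real) \<Rightarrow> real" where
  "packing_density b V s =
     (\<Sum>p\<in>V. hyp_vol (horoball p (s p) \<inter> fund_domain b)) / hyp_vol (fund_domain b)"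

definition opt_density :: "(nat \<Rightarrow> real \<times> (real^'n)) \<Rightarrow> real" where
  "opt_density b = Sup {packing_density b V s | V s. horoball_packing b V s}"

end

theory Submission
  imports Defs
begin

text \<open>
  Volume. Hyperbolic volume is, up to a factor, the Lebesgue measure of the part of the cone over a
  set on which $-\langle X, X \rangle \le 1$; hence it can be computed in any linear coordinates.
  With the ideal vertex $A_3$ at infinity of the upper half space, the polytope is the part above
  the unit hemisphere of a prism over a right isosceles triangle. Integrating over the height,
  along the prism and radially in the triangle leaves
  $\frac13 \int_0^1 (\frac\pi4 - \arctan\sqrt{(1-t^2)/2})\,\frac{dt}{1+t^2}$, where the arctangent term is
  an Ahmed integral with value $\pi^2/24$.

  Packing. A horoball is $\{-\langle X, v\rangle \le 1\}$ for a null vector \<open>v\<close>, and by the reverse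
  Cauchy-Schwarz inequality two of them have disjoint interiors as soon as
  $\langle u, v \rangle \le -2$. The group preserves a lattice on which $2\langle u, v\rangle$ is integral
  and in which the null vectors \<open>p\<close>, \<open>a\<close> over $A_3$, $A_0$ are primitive. So distinct vectors
  \<open>u\<close>, \<open>v\<close> in the orbits of \<open>p\<close> and \<open>a\<close> satisfy $\langle 2u, 2v \rangle \le -2$, and \<open>2p\<close>, \<open>2a\<close> are
  exactly the vectors of the maximal horoballs: both can be used at once, and no packing is denser.
\<close>

section \<open>Lorentzian geometry and horoballs\<close>

text \<open>The hypothesis gives only the Lorentz products of the normals, so every vector is built
  from normals, coordinates are read off as products, and identities between vectors are tested
  against a frame. The null vectors come from the Coxeter diagram: its parabolic pieces
  \<open>b 0, b 1, b 2\<close> (type {4,4}) and \<open>b 1, ..., b 4\<close> (type {4,3,4}) have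
  degenerate Gram matrices, and \<open>p\<close> and \<open>a\<close> span the radicals. The piece
  \<open>b 4, b 5\<close> has the radical line of the first one, as
  \<open>b 4 + b 5 = sqrt 2 *\<^sub>R p\<close>; this makes the link of A_3 a product. Both vectors
  are scaled to have product -1/2 with a wall off the cusp, which becomes the unit hemisphere. In
  the variable w = t^2 + x^2 + y^2 + z^2 at A_3 that hemisphere is the linear bound 1 <= w. A
  horoball with vector v touches the wall of unit normal c when <v, c> = -1, hence the factor 2 in
  2p and 2a. The lattice is read off from the six reflections in the coordinates at A_3, where the
  triangle has legs 1/2 and the prism has height 1 / sqrt 2.\<close>

lemma lorentz_bilinear [simp]:
  "lorentz (u + v) w = lorentz u w + lorentz v w"
  "lorentz w (u + v) = lorentz w u + lorentz w v"
  "lorentz (u - v) w = lorentz u w - lorentz v w"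
  "lorentz w (u - v) = lorentz w u - lorentz w v"
  "lorentz (c *\<^sub>R u) w = c * lorentz u w"
  "lorentz w (c *\<^sub>R u) = c * lorentz w u"
  "lorentz (- u) w = - lorentz u w"
  "lorentz w (- u) = - lorentz w u"
  "lorentz 0 w = 0" "lorentz w 0 = 0"
  by (simp_all add: lorentz_def inner_simps algebra_simps)

lemma lorentz_commute: "lorentz u v = lorentz v u"
  by (simp add: lorentz_def inner_commute)

lemma continuous_on_lorentz [continuous_intros]:
  "continuous_on S f \<Longrightarrow> continuous_on S g \<Longrightarrow> continuous_on S (\<lambda>x. lorentz (f x) (g x))"
  unfolding lorentz_def by (intro continuous_intros)

lemma lift_simps [simp]: "fst (lift x) = 1" "snd (lift x) = x"
  by (simp_all add: lift_def)

lemma lorentz_lift_self: "lorentz (lift x) (lift x) = (norm x)\<^sup>2 - 1"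
  by (simp add: lorentz_def power2_norm_eq_inner)

lemma lift_timelike_iff: "lorentz (lift x) (lift x) < 0 \<longleftrightarrow> x \<in> hyp_space"
  by (simp add: lorentz_lift_self hyp_space_def power_less_one_iff abs_square_less_1)

lemma lift_proj: "fst v \<noteq> 0 \<Longrightarrow> lift (proj v) = (1 / fst v) *\<^sub>R v"
  by (simp add: lift_def proj_def prod_eq_iff inverse_eq_divide)

lemma proj_lift [simp]: "proj (lift x) = x"
  by (simp add: proj_def)

lemma proj_scaleR: "c \<noteq> 0 \<Longrightarrow> proj (c *\<^sub>R v) = proj v"
  by (simp add: proj_def)

lemma lorentz_timelike_fst: "lorentz v v < 0 \<Longrightarrow> norm (snd v) < \<bar>fst v\<bar>"
  using abs_le_square_iff[of "fst v" "norm (snd v)"]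
  by (simp add: lorentz_def power2_norm_eq_inner[symmetric] power2_eq_square[symmetric] not_le[symmetric])

lemma lorentz_causal_fst: "lorentz v v \<le> 0 \<Longrightarrow> norm (snd v) \<le> \<bar>fst v\<bar>"
  using abs_le_square_iff[of "norm (snd v)" "fst v"]
  by (simp add: lorentz_def power2_norm_eq_inner[symmetric] power2_eq_square[symmetric])

text \<open>The spatial product is strictly smaller in size than the product of the time components,
  so \<open>lorentz v w\<close> has the sign of \<open>- fst v * fst w\<close>.\<close>

lemma timelike_future_iff:
  assumes v: "lorentz v v < 0" and w: "lorentz w w \<le> 0" "fst w > 0"
  shows "lorentz v w < 0 \<longleftrightarrow> fst v > 0"
proof -
  have "\<bar>snd v \<bullet> snd w\<bar> \<le> norm (snd v) * norm (snd w)"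
    by (rule Cauchy_Schwarz_ineq2)
  also have "\<dots> \<le> norm (snd v) * fst w"
    using lorentz_causal_fst[OF w(1)] w(2) by (intro mult_left_mono) auto
  also have "\<dots> < \<bar>fst v\<bar> * fst w"
    using lorentz_timelike_fst[OF v] w(2) by simp
  finally have "\<bar>snd v \<bullet> snd w\<bar> < \<bar>fst v * fst w\<bar>"
    using w(2) by (simp add: abs_mult)
  then show ?thesis
    using w(2) zero_less_mult_iff[of "fst v" "fst w"] by (auto simp: lorentz_def abs_if split: if_splits)
qed

lemma timelike_lift_neg:
  assumes "x \<in> hyp_space" "lorentz w w \<le> 0" "fst w > 0"
  shows "lorentz (lift x) w < 0"
  using assms timelike_future_iff[of "lift x" w] by (simp add: lift_timelike_iff)

lemma orthogonal_timelike_spacelike: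
  assumes v: "lorentz v v < 0" and vw: "lorentz v w = 0" and w: "lorentz w w \<le> 0"
  shows "w = 0"
proof (rule ccontr)
  assume "w \<noteq> 0"
  have "fst w \<noteq> 0"
    using lorentz_causal_fst[OF w] \<open>w \<noteq> 0\<close> by (auto simp: prod_eq_iff)
  then show False
    using timelike_future_iff[OF v, of w] timelike_future_iff[OF v, of "- w"]
      timelike_future_iff[of "- v" w] timelike_future_iff[of "- v" "- w"] v w vw
      lorentz_timelike_fst[OF v]
    by (cases "fst w > 0"; cases "fst v > 0") auto
qed

text \<open>\<open>u\<close> is the part of \<open>w\<close> orthogonal to \<open>v\<close>, hence
  spacelike or zero; \<open>lorentz v v * lorentz u u\<close> is exactly the defect in the
  inequality.\<close>

lemma reverse_Cauchy_Schwarz: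
  assumes v: "lorentz v v < 0"
  shows "lorentz v v * lorentz w w \<le> (lorentz v w)\<^sup>2"
    and "lorentz v v * lorentz w w = (lorentz v w)\<^sup>2 \<Longrightarrow> w = (lorentz v w / lorentz v v) *\<^sub>R v"
proof -
  define u where "u = w - (lorentz v w / lorentz v v) *\<^sub>R v"
  have vu: "lorentz v u = 0"
    using v by (simp add: u_def)
  have uu: "lorentz v v * lorentz u u = lorentz v v * lorentz w w - (lorentz v w)\<^sup>2"
    using v by (simp add: u_def lorentz_commute[of w v] field_simps power2_eq_square)
  show "lorentz v v * lorentz w w \<le> (lorentz v w)\<^sup>2"
  proof (cases "u = 0")
    case False
    then have "lorentz u u > 0"
      using orthogonal_timelike_spacelike[OF v vu] by force
    then have "lorentz v v * lorentz u u < 0"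
      using v by (simp add: mult_neg_pos)
    then show ?thesis using uu by simp
  qed (use uu in simp)
  assume "lorentz v v * lorentz w w = (lorentz v w)\<^sup>2"
  then have "lorentz u u = 0"
    using uu v by simp
  then have "u = 0"
    using orthogonal_timelike_spacelike[OF v vu] by simp
  then show "w = (lorentz v w / lorentz v v) *\<^sub>R v"
    by (simp add: u_def)
qed

lemma null_future_product_nonpos:
  assumes "lorentz u u = 0" "lorentz v v = 0" "fst u > 0" "fst v > 0"
  shows "lorentz u v \<le> 0"
proof -
  have "snd u \<bullet> snd v \<le> norm (snd u) * norm (snd v)"
    by (rule norm_cauchy_schwarz)
  also have "\<dots> \<le> fst u * fst v"
    using assms lorentz_causal_fst[of u] lorentz_causal_fst[of v] by (intro mult_mono) auto
  finally show ?thesis by (simp add: lorentz_def)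
qed

text \<open>Subtract the multiple of \<open>u\<close> with the same time component: the difference
  is again null, and without time component the form is Euclidean.\<close>

lemma null_orthogonal_proportional:
  assumes u: "lorentz u u = 0" "fst u > 0" and v: "lorentz v v = 0" "fst v > 0" and uv: "lorentz u v = 0"
  shows "v = (fst v / fst u) *\<^sub>R u"
proof -
  define w where "w = v - (fst v / fst u) *\<^sub>R u"
  have "lorentz w w = 0" using u v uv by (simp add: w_def lorentz_commute[of v u])
  moreover have "fst w = 0" using u by (simp add: w_def)
  ultimately have "w = 0" by (simp add: lorentz_def prod_eq_iff)
  then show ?thesis by (simp add: w_def)
qed

text \<open>\<open>horo v\<close> is the horoball $\{-\langle X,v\rangle \le 1\}$ (on the hyperboloid) of a future null
  vector; the length of \<open>v\<close> encodes the size.\<close>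

definition horo :: "real \<times> (real^'n) \<Rightarrow> (real^'n) set" where
  "horo v = {x \<in> hyp_space. - lorentz (lift x) v \<le> sqrt (- lorentz (lift x) (lift x))}"

lemma horoball_eq_horo: "s > 0 \<Longrightarrow> horoball p s = horo ((1 / s) *\<^sub>R lift p)"
  by (auto simp: horoball_def horo_def field_simps)

lemma horo_eq_horoball:
  assumes "fst v > 0"
  shows "horo v = horoball (proj v) (1 / fst v)"
  using assms by (simp add: horoball_eq_horo lift_proj)

lemma horo_mono:
  assumes "lorentz v v = 0" "fst v > 0" "c \<ge> 1"
  shows "horo (c *\<^sub>R v) \<subseteq> horo v"
proof -
  have "- lorentz (lift x) v \<le> - lorentz (lift x) (c *\<^sub>R v)" if "x \<in> hyp_space" for x
    using timelike_lift_neg[OF that, of v] assms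
    by (simp add: mult_le_cancel_right2)
  then show ?thesis unfolding horo_def by fastforce
qed

text \<open>On the hyperboloid the two conditions add up to - <X, u + v> <= 2, while
  \<open>u + v\<close> has square at most -4. Reverse Cauchy-Schwarz leaves only its equality case,
  so X is a multiple of \<open>u + v\<close>.\<close>

lemma horo_tangent:
  assumes u: "lorentz u u = 0" "fst u > 0" and v: "lorentz v v = 0" "fst v > 0"
    and uv: "lorentz u v \<le> - 2"
    and x: "x \<in> horo u" "x \<in> horo v"
  shows "x = proj (u + v)"
proof -
  let ?X = "lift x" and ?w = "u + v"
  have xh: "x \<in> hyp_space" using x by (simp add: horo_def)
  then have X: "lorentz ?X ?X < 0" by (simp add: lift_timelike_iff)
  define r where "r = sqrt (- lorentz ?X ?X)"
  have r2: "r\<^sup>2 = - lorentz ?X ?X" using X by (simp add: r_def)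
  have r0: "r > 0" using X by (simp add: r_def)
  have ww: "lorentz ?w ?w \<le> - 4"
    using uv by (simp add: u v lorentz_commute[of v u])
  have Xw0: "lorentz ?X ?w < 0"
    using timelike_lift_neg[OF xh, of u] timelike_lift_neg[OF xh, of v] u v by simp
  have Xw: "- lorentz ?X ?w \<le> 2 * r"
    using x by (simp add: horo_def r_def)
  have "(lorentz ?X ?w)\<^sup>2 \<le> (2 * r)\<^sup>2"
    using power_mono[OF Xw, of 2] Xw0 by (metis less_imp_le neg_0_le_iff_le power2_minus)
  also have "\<dots> = lorentz ?X ?X * (- 4)"
    by (simp add: power_mult_distrib r2)
  also have "\<dots> \<le> lorentz ?X ?X * lorentz ?w ?w"
    using ww X by (intro mult_left_mono_neg) auto
  finally have "lorentz ?X ?X * lorentz ?w ?w = (lorentz ?X ?w)\<^sup>2"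
    using reverse_Cauchy_Schwarz(1)[OF X, of ?w] by simp
  from reverse_Cauchy_Schwarz(2)[OF X this]
  have "?w = (lorentz ?X ?w / lorentz ?X ?X) *\<^sub>R ?X" .
  moreover have "lorentz ?X ?w / lorentz ?X ?X \<noteq> 0"
    using X Xw0 by simp
  ultimately show ?thesis
    by (metis proj_scaleR proj_lift)
qed

text \<open>The common points lie in a singleton, and an open subset of a singleton in
  \<open>real^'n\<close> is empty.\<close>

lemma horo_interior_disjoint:
  fixes u v :: "real \<times> (real^'n)"
  assumes "lorentz u u = 0" "fst u > 0" "lorentz v v = 0" "fst v > 0" "lorentz u v \<le> - 2"
  shows "interior (horo u) \<inter> interior (horo v) = {}"
proof -
  have "interior (horo u) \<inter> interior (horo v) \<subseteq> {proj (u + v)}"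
    using horo_tangent[OF assms] interior_subset by fastforce
  moreover have "open (interior (horo u) \<inter> interior (horo v))"
    by (intro open_Int open_interior)
  ultimately show ?thesis
    by (metis not_open_singleton subset_singleton_iff)
qed

text \<open>The vector \<open>w\<close> is the midpoint of \<open>v\<close> and its mirror image \<open>v + 2kc\<close>; the horoballs of these two
  vectors at most touch.\<close>

lemma horo_subset_halfspace:
  assumes v: "lorentz v v = 0" "fst v > 0" and c: "lorentz c c = 1" and vc: "lorentz v c \<le> - 1"
  shows "horo v \<subseteq> halfspace c"
proof
  fix x assume x: "x \<in> horo v"
  let ?X = "lift x"
  define k where "k = - lorentz v c"
  define w where "w = v + k *\<^sub>R c"
  have k: "k \<ge> 1" using vc by (simp add: k_def)
  have xh: "x \<in> hyp_space" using x by (simp add: horo_def)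
  then have X: "lorentz ?X ?X < 0" by (simp add: lift_timelike_iff)
  define r where "r = sqrt (- lorentz ?X ?X)"
  have r2: "r\<^sup>2 = - lorentz ?X ?X" and r0: "r > 0" using X by (simp_all add: r_def)
  show "x \<in> halfspace c"
  proof (rule ccontr)
    assume "x \<notin> halfspace c"
    then have Xc: "lorentz ?X c > 0" by (simp add: halfspace_def)
    have ww: "lorentz w w = - k\<^sup>2"
      using c v by (simp add: w_def k_def lorentz_commute[of c v] power2_eq_square)
    have Xv: "- lorentz ?X v \<le> r" using x by (simp add: horo_def r_def)
    have Xw: "lorentz ?X w = lorentz ?X v + k * lorentz ?X c" by (simp add: w_def)
    \<comment> \<open>\<open>c\<close> is spacelike, so the time direction of \<open>w\<close> has
      to be read off from its product with \<open>v\<close>.\<close>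
    have "fst w > 0"
    proof -
      have "lorentz w v = - (k\<^sup>2)"
        using v by (simp add: w_def k_def lorentz_commute[of c v] power2_eq_square)
      then show ?thesis
        using timelike_future_iff[of w v] ww v k by simp
    qed
    then have Xw0: "lorentz ?X w < 0"
      using timelike_lift_neg[OF xh, of w] ww k by simp
    have "- lorentz ?X w < r"
    proof -
      have "k * lorentz ?X c > 0" using Xc k by simp
      then show ?thesis using Xv Xw by linarith
    qed
    then have "(lorentz ?X w)\<^sup>2 < r\<^sup>2"
      using Xw0 power_strict_mono[of "- lorentz ?X w" r 2] by simp
    also have "\<dots> \<le> r\<^sup>2 * k\<^sup>2"
      using k by (simp add: one_le_power mult_le_cancel_left1)
    also have "\<dots> = lorentz ?X ?X * lorentz w w"
      by (simp add: r2 ww)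
    finally show False
      using reverse_Cauchy_Schwarz(1)[OF X, of w] by simp
  qed
qed

text \<open>The bound -1 is sharp: a factor \<open>k < 1\<close> enlarges the horoball, and
  \<open>X\<close>, on its horosphere because <X, kv> = -1, lies beyond the wall because
  \<open>lorentz X c = (1 / k - k) / 2\<close>.\<close>

lemma horo_not_subset_halfspace:
  assumes v: "lorentz v v = 0" "fst v > 0" and c: "lorentz c c = 1" and vc: "lorentz v c = - 1"
    and k: "0 < k" "k < 1"
  shows "\<not> horo (k *\<^sub>R v) \<subseteq> halfspace c"
proof
  assume sub: "horo (k *\<^sub>R v) \<subseteq> halfspace c"
  let ?v = "v + 2 *\<^sub>R c"
  \<comment> \<open>a point of the geodesic that starts at \<open>proj v\<close> and is perpendicular to the hyperplane\<close>
  define X where "X = (k / 2) *\<^sub>R v + (1 / (2 * k)) *\<^sub>R ?v"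
  have cv: "lorentz c v = - 1" using vc lorentz_commute by metis
  have XX: "lorentz X X = - 1"
    using k by (simp add: X_def v c vc cv field_simps)
  have Xv: "lorentz X v = - 1 / k"
    using k by (simp add: X_def v c vc cv field_simps)
  have Xc: "lorentz X c = (1 / k - k) / 2"
    using k by (simp add: X_def v c vc cv field_simps)
  have f: "fst X > 0"
    using timelike_future_iff[of X v] XX Xv v k by simp
  define x where "x = proj X"
  have lx: "lift x = (1 / fst X) *\<^sub>R X"
    using f by (simp add: x_def lift_proj)
  have "x \<in> hyp_space"
    using f by (simp add: lift_timelike_iff[symmetric] lx XX field_simps)
  moreover have "sqrt (- lorentz (lift x) (lift x)) = 1 / fst X"
    using f by (simp add: lx XX real_sqrt_divide)
  ultimately have "x \<in> horo (k *\<^sub>R v)"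
    using f k by (simp add: horo_def lx Xv field_simps)
  then have "lorentz (lift x) c \<le> 0"
    using sub by (auto simp: halfspace_def)
  moreover have "1 / k > k"
    using k mult_strict_mono[of k 1 k 1] by (simp add: pos_less_divide_eq)
  ultimately show False
    using f by (simp add: lx Xc field_simps zero_less_divide_iff)
qed

section \<open>Future-preserving isometries and their action on horoballs\<close>

lemma causal_future_transfer:
  assumes u: "lorentz u u \<le> 0" "fst u > 0" and v: "lorentz v v \<le> 0" and uv: "lorentz u v < 0"
  shows "fst v > 0"
proof (rule ccontr)
  assume "\<not> fst v > 0"
  then have "norm (snd u) * norm (snd v) \<le> fst u * - fst v"
    using lorentz_causal_fst[OF u(1)] lorentz_causal_fst[OF v] u(2) by (intro mult_mono) auto
  moreover have "- (snd u \<bullet> snd v) \<le> norm (snd u) * norm (snd v)"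
    using Cauchy_Schwarz_ineq2[of "snd u" "snd v"] by simp
  ultimately show False
    using uv by (simp add: lorentz_def)
qed

lemma horo_subset_hyp_space: "horo v \<subseteq> hyp_space"
  by (auto simp: horo_def)

text \<open>The last clause excludes maps such as \<open>uminus\<close> that exchange the two light
  cones. It covers null vectors too, because it is applied to the vectors of horoballs as well as to
  points.\<close>

definition future_isometry :: "(real \<times> (real^'n) \<Rightarrow> real \<times> (real^'n)) \<Rightarrow> bool" where
  "future_isometry g \<longleftrightarrow> linear g \<and> (\<forall>u v. lorentz (g u) (g v) = lorentz u v) \<and>
     (\<forall>v. lorentz v v \<le> 0 \<longrightarrow> fst v > 0 \<longrightarrow> fst (g v) > 0)"

lemma future_isometryD:
  assumes "future_isometry g"
  shows "linear g" "lorentz (g u) (g v) = lorentz u v"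
    "lorentz v v \<le> 0 \<Longrightarrow> fst v > 0 \<Longrightarrow> fst (g v) > 0"
  using assms unfolding future_isometry_def by blast+

lemma future_isometry_id: "future_isometry id"
  by (simp add: future_isometry_def linear_id)

lemma future_isometry_comp: "future_isometry f \<Longrightarrow> future_isometry g \<Longrightarrow> future_isometry (f \<circ> g)"
  by (auto simp: future_isometry_def linear_compose simp del: split_paired_All)

lemma linear_reflection: "linear (reflection c)"
  by (rule linearI) (simp_all add: reflection_def algebra_simps)

lemma reflection_reflection: "lorentz c c = 1 \<Longrightarrow> reflection c (reflection c v) = v"
  by (simp add: reflection_def algebra_simps)

lemma lorentz_reflection:
  "lorentz c c = 1 \<Longrightarrow> lorentz (reflection c u) (reflection c v) = lorentz u v"
  by (simp add: reflection_def lorentz_commute[of c v] algebra_simps)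

text \<open>If \<open>v\<close> is moved, its product with its image is
  \<open>lorentz v v - 2 * (lorentz v c)\<^sup>2 < 0\<close>, and causal vectors with negative
  product lie in the same cone.\<close>

lemma future_isometry_reflection:
  assumes c: "lorentz c c = 1"
  shows "future_isometry (reflection c)"
proof -
  have "fst (reflection c v) > 0" if v: "lorentz v v \<le> 0" "fst v > 0" for v
  proof (cases "lorentz v c = 0")
    case False
    then have "(lorentz v c)\<^sup>2 > 0" by simp
    moreover have "lorentz v (reflection c v) = lorentz v v - 2 * (lorentz v c)\<^sup>2"
      by (simp add: reflection_def power2_eq_square)
    ultimately have "lorentz v (reflection c v) < 0"
      using v(1) by linarith
    then show ?thesis
      using causal_future_transfer[OF v] v lorentz_reflection[OF c, of v v] by simp
  qed (use v in \<open>simp add: reflection_def\<close>)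
  then show ?thesis
    unfolding future_isometry_def using lorentz_reflection[OF c] linear_reflection by blast
qed

lemma act_lift:
  assumes g: "future_isometry g" and x: "x \<in> hyp_space"
  shows "lift (act g x) = (1 / fst (g (lift x))) *\<^sub>R g (lift x)" "fst (g (lift x)) > 0"
proof -
  show *: "fst (g (lift x)) > 0"
    using x lift_timelike_iff[of x] by (intro future_isometryD(3)[OF g]) simp_all
  then show "lift (act g x) = (1 / fst (g (lift x))) *\<^sub>R g (lift x)"
    by (simp add: act_def lift_proj)
qed

lemma act_comp:
  assumes f: "future_isometry f" and g: "future_isometry g" and x: "x \<in> hyp_space"
  shows "act (f \<circ> g) x = act f (act g x)"
  using f act_lift[OF g x]
  by (simp add: act_def[of f] act_def[of "f \<circ> g"] linear_cmul[OF future_isometryD(1)[OF f]] proj_scaleR)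

lemma act_id [simp]: "act id x = x"
  by (simp add: act_def)

lemma act_horo_subset:
  assumes g: "future_isometry g"
  shows "act g ` horo v \<subseteq> horo (g v)"
proof
  fix y assume "y \<in> act g ` horo v"
  then obtain x where y: "y = act g x" and x: "x \<in> hyp_space"
    "- lorentz (lift x) v \<le> sqrt (- lorentz (lift x) (lift x))"
    by (auto simp: horo_def)
  \<comment> \<open>\<open>f\<close> brings the image back to the chart; both sides of the horoball
    inequality are homogeneous of degree one and scale by \<open>1 / f\<close> alike.\<close>
  define f where "f = fst (g (lift x))"
  have f: "f > 0" and ly: "lift y = (1 / f) *\<^sub>R g (lift x)"
    using act_lift[OF g x(1)] by (simp_all add: f_def y)
  have iso: "lorentz (g u) (g w) = lorentz u w" for u w
    by (rule future_isometryD(2)[OF g])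
  have X: "lorentz (lift x) (lift x) < 0" using x(1) by (simp add: lift_timelike_iff)
  have yy: "lorentz (lift y) (lift y) = lorentz (lift x) (lift x) / f\<^sup>2"
    by (simp add: ly iso power2_eq_square)
  have "y \<in> hyp_space"
    using X f by (simp add: lift_timelike_iff[symmetric] yy divide_neg_pos)
  moreover have "- lorentz (lift y) (g v) \<le> sqrt (- lorentz (lift y) (lift y))"
  proof -
    have "- lorentz (lift y) (g v) = (- lorentz (lift x) v) / f"
      by (simp add: ly iso)
    also have "\<dots> \<le> sqrt (- lorentz (lift x) (lift x)) / f"
      using x(2) f by (intro divide_right_mono) auto
    also have "\<dots> = sqrt ((- lorentz (lift x) (lift x)) / f\<^sup>2)"
      using f by (simp only: real_sqrt_divide real_sqrt_abs abs_of_pos)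
    finally show ?thesis by (simp add: yy)
  qed
  ultimately show "y \<in> horo (g v)"
    by (simp add: horo_def)
qed

lemma act_horo:
  assumes g: "future_isometry g" and h: "future_isometry h" and gh: "g \<circ> h = id" "h \<circ> g = id"
  shows "act g ` horo v = horo (g v)"
proof
  show "horo (g v) \<subseteq> act g ` horo v"
  proof
    fix y assume y: "y \<in> horo (g v)"
    have "act h ` horo (g v) \<subseteq> horo (h (g v))"
      by (rule act_horo_subset[OF h])
    also have "h (g v) = v" using gh(2) by (metis comp_apply id_apply)
    finally have "act h y \<in> horo v" using y by blast
    moreover have "y = act g (act h y)"
      using act_comp[OF g h, of y] gh(1) y by (simp add: horo_def)
    ultimately show "y \<in> act g ` horo v" by blast
  qed
qed (rule act_horo_subset[OF g])

text \<open>Characterises the vector of a maximal horoball: product 0 means that the wall passes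
  through the centre, product \<open>- 1\<close> tangency, and a smaller product a gap.\<close>

definition touching :: "(nat \<Rightarrow> real \<times> (real^'n)) \<Rightarrow> real \<times> (real^'n) \<Rightarrow> bool" where
  "touching b v \<longleftrightarrow> lorentz v v = 0 \<and> fst v > 0 \<and> (\<forall>i\<le>CARD('n) + 1. lorentz (b i) (b i) = 1) \<and>
     (\<forall>i\<le>CARD('n) + 1. lorentz v (b i) = 0 \<or> lorentz v (b i) \<le> - 1) \<and>
     (\<exists>j\<le>CARD('n) + 1. lorentz v (b j) = - 1)"

text \<open>Multiplying the vector by \<open>k\<close> shrinks the horoball for \<open>k > 1\<close>
  and pushes it across the touched wall for \<open>k < 1\<close>.\<close>

lemma confined_horo_iff:
  fixes b :: "nat \<Rightarrow> real \<times> (real^'n)"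
  assumes t: "touching b v" and k: "k > 0"
  shows "confined b (proj v) (horo (k *\<^sub>R v)) \<longleftrightarrow> 1 \<le> k"
proof -
  have v: "lorentz v v = 0" "fst v > 0"
    and b: "\<And>i. i \<le> CARD('n) + 1 \<Longrightarrow> lorentz (b i) (b i) = 1"
    and far: "\<And>i. i \<le> CARD('n) + 1 \<Longrightarrow> lorentz v (b i) \<noteq> 0 \<Longrightarrow> lorentz v (b i) \<le> - 1"
    using t by (auto simp: touching_def)
  obtain j where touch: "j \<le> CARD('n) + 1" "lorentz v (b j) = - 1"
    using t by (auto simp: touching_def)
  have hyp: "proj v \<in> hyperplane c \<longleftrightarrow> lorentz v c = 0" for c
    using v by (simp add: hyperplane_def lift_proj)
  show ?thesis
  proof
    assume "confined b (proj v) (horo (k *\<^sub>R v))"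
    then have "horo (k *\<^sub>R v) \<subseteq> halfspace (b j)"
      using touch by (simp add: confined_def hyp)
    then show "1 \<le> k"
      using horo_not_subset_halfspace[OF v b[OF touch(1)] touch(2) k] by force
  next
    assume "1 \<le> k"
    then have "horo (k *\<^sub>R v) \<subseteq> horo v" by (rule horo_mono[OF v])
    then show "confined b (proj v) (horo (k *\<^sub>R v))"
      using horo_subset_halfspace[OF v b] far unfolding confined_def hyp by blast
  qed
qed

lemma horoball_proj:
  assumes "fst v > 0" "s > 0"
  shows "horoball (proj v) s = horo ((1 / (s * fst v)) *\<^sub>R v)"
  using assms by (simp add: horoball_eq_horo lift_proj)

lemma confined_horoball_subset:
  assumes t: "touching b v" and s: "s > 0" "confined b (proj v) (horoball (proj v) s)"
  shows "horoball (proj v) s \<subseteq> horo v"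
proof -
  have v: "lorentz v v = 0" "fst v > 0" using t by (simp_all add: touching_def)
  have "1 \<le> 1 / (s * fst v)"
    using s confined_horo_iff[OF t, of "1 / (s * fst v)"] v
    by (simp add: horoball_proj)
  then show ?thesis
    using horo_mono[OF v] v s by (simp add: horoball_proj)
qed

lemma max_horoball_eq:
  assumes t: "touching b v"
  shows "max_horoball b (proj v) = horo v"
  unfolding max_horoball_def
proof (rule Greatest_equality)
  have v: "fst v > 0" using t by (simp add: touching_def)
  show "(\<exists>s>0. horo v = horoball (proj v) s) \<and> confined b (proj v) (horo v)"
    using confined_horo_iff[OF t, of 1] horo_eq_horoball[OF v] v
    by (auto intro!: exI[of _ "1 / fst v"])
qed (use confined_horoball_subset[OF t] in blast)

text \<open>The tangent hyperplane of the unit ball at \<open>x\<close> supports \<open>S\<close>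
  and meets the ball only in \<open>x\<close>.\<close>

lemma extreme_point_of_subset_cball:
  fixes x :: "'a::euclidean_space"
  assumes S: "S \<subseteq> cball 0 1" and x: "x \<in> S" "norm x = 1"
  shows "x extreme_point_of S"
proof (rule extreme_point_of_Int_supporting_hyperplane_le[of S x 1])
  show "x \<bullet> y \<le> 1" if "y \<in> S" for y
  proof -
    have "x \<bullet> y \<le> norm x * norm y" by (rule norm_cauchy_schwarz)
    then show ?thesis using S that x by force
  qed
  have "y = x" if y: "y \<in> S" "x \<bullet> y = 1" for y
  proof -
    have "norm y \<le> 1" using S y by auto
    then have "(norm y)\<^sup>2 \<le> 1" by (simp add: power_le_one)
    then have "(norm (x - y))\<^sup>2 \<le> 0"
      using x y(2) by (simp add: power2_norm_eq_inner inner_simps inner_commute[of y x])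
        (simp add: norm_eq_1)
    then show ?thesis by simp
  qed
  moreover have "x \<bullet> x = 1" using x by (simp add: norm_eq_1)
  ultimately show "S \<inter> {y. x \<bullet> y = 1} = {x}" using x by blast
qed

section \<open>Hyperbolic volume in linear coordinates\<close>

text \<open>Lebesgue measure is determined by boxes, and indexing the basis vectors preserves boxes.
  This lets matrices and determinants over \<open>real^'n\<close> act on product types such as
  \<open>real \<times> (real^4)\<close>.\<close>

lemma lborel_coordinates:
  fixes \<beta> :: "'n::{finite,wellorder} \<Rightarrow> 'a::euclidean_space"
  assumes \<beta>: "bij_betw \<beta> UNIV Basis"
  shows "distr lborel lborel (\<lambda>x. \<chi> i. x \<bullet> \<beta> i) = lborel"
proof -
  let ?\<iota> = "\<lambda>x. \<chi> i. x \<bullet> \<beta> i"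
  have cont: "continuous_on UNIV ?\<iota>"
    by (intro continuous_intros)
  have meas [measurable]: "?\<iota> \<in> borel_measurable borel"
    by (rule borel_measurable_continuous_onI[OF cont])
  have surj: "\<exists>i. b = \<beta> i" if "b \<in> Basis" for b
    using \<beta> that by (auto simp: bij_betw_def)
  have inB: "\<beta> i \<in> Basis" for i
    using \<beta> by (auto simp: bij_betw_def)
  have "lborel = distr lborel lborel ?\<iota>"
  proof (rule lborel_eqI)
    fix l u :: "real^'n::_"
    assume lu: "\<And>b. b \<in> Basis \<Longrightarrow> l \<bullet> b \<le> u \<bullet> b"
    define L where "L v = (\<Sum>i\<in>UNIV. v $ i *\<^sub>R \<beta> i)" for v :: "real^'n::_"
    have L: "L v \<bullet> \<beta> i = v $ i" for v i
    proof -
      have "L v \<bullet> \<beta> i = (\<Sum>j\<in>UNIV. v $ j * (\<beta> j \<bullet> \<beta> i))"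
        by (simp add: L_def inner_sum_left)
      also have "\<dots> = (\<Sum>j\<in>UNIV. if j = i then v $ j else 0)"
        using \<beta> inB by (intro sum.cong) (auto simp: inner_Basis bij_betw_def inj_on_def)
      finally show ?thesis by simp
    qed
    have B: "Basis = range \<beta>"
      using \<beta> by (simp add: bij_betw_def)
    have "?\<iota> -` box l u = box (L l) (L u)"
      by (auto simp: mem_box_cart mem_box B L)
    then have "emeasure (distr lborel lborel ?\<iota>) (box l u) = emeasure lborel (box (L l) (L u))"
      by (simp add: emeasure_distr)
    also have "\<dots> = (\<Prod>b\<in>Basis. (L u - L l) \<bullet> b)"
    proof (rule emeasure_lborel_box)
      fix b :: 'a assume "b \<in> Basis"
      then obtain i where "b = \<beta> i" using surj by blast
      then show "L l \<bullet> b \<le> L u \<bullet> b"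
        using lu[of "axis i 1"] L by (simp add: inner_axis axis_in_Basis_iff)
    qed
    also have "(\<Prod>b\<in>Basis. (L u - L l) \<bullet> b) = (\<Prod>i\<in>UNIV. (L u - L l) \<bullet> \<beta> i)"
      by (rule prod.reindex_bij_betw[OF \<beta>, symmetric])
    also have "\<dots> = (\<Prod>i\<in>UNIV. (u - l) \<bullet> axis i 1)"
      by (simp add: inner_diff_left L inner_axis)
    also have "\<dots> = (\<Prod>b\<in>Basis. (u - l) \<bullet> b)"
    proof -
      have "bij_betw (\<lambda>i::'n. axis i (1::real)) UNIV Basis"
        by (auto simp: bij_betw_def inj_on_def axis_eq_axis Basis_vec_def)
      from prod.reindex_bij_betw[OF this, of "\<lambda>b. (u - l) \<bullet> b"] show ?thesis by simp
    qed
    finally show "emeasure (distr lborel lborel ?\<iota>) (box l u) = ennreal (\<Prod>b\<in>Basis. (u - l) \<bullet> b)" .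
  qed simp
  then show ?thesis by simp
qed

text \<open>Checked on boxes: the preimage under \<open>M\<close> is the image under the inverse
  \<open>N\<close>, whose volume carries the factor \<open>\<bar>det N\<bar>\<close>.\<close>

lemma emeasure_lborel_matrix_vimage:
  fixes M :: "real^'n::{finite,wellorder}^'n::_"
  assumes det: "det M \<noteq> 0" and A: "A \<in> sets borel"
  shows "emeasure lborel A = \<bar>det M\<bar> * emeasure lborel ((\<lambda>x. M *v x) -` A)"
proof -
  let ?f = "\<lambda>x. M *v x"
  obtain N where N: "M ** N = mat 1" "N ** M = mat 1"
    using det invertible_det_nz[of M] by (auto simp: invertible_def)
  have [measurable]: "?f \<in> borel_measurable borel"
    by (intro borel_measurable_continuous_onI linear_continuous_on matrix_vector_mul_bounded_linear)
  have dN: "\<bar>det M\<bar> * \<bar>det N\<bar> = 1"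
    using N(1) by (metis abs_mult abs_one det_I det_mul)
  have vim: "?f -` S = (\<lambda>x. N *v x) ` S" for S
  proof -
    have "N *v (M *v x) = x" "M *v (N *v x) = x" for x
      using N by (simp_all add: matrix_vector_mul_assoc)
    then show ?thesis
      by (metis bij_vimage_eq_inv_image inv_unique_comp bij_betw_byWitness UNIV_I comp_apply
        fun_eq_iff id_apply o_bij)
  qed
  have "lborel = scale_measure (ennreal \<bar>det M\<bar>) (distr lborel lborel ?f)"
  proof (rule lborel_eqI)
    fix l u :: "real^'n::_"
    assume lu: "\<And>b. b \<in> Basis \<Longrightarrow> l \<bullet> b \<le> u \<bullet> b"
    have "measure lebesgue ((\<lambda>x. N *v x) ` box l u) = \<bar>det N\<bar> * measure lebesgue (box l u)"
      using measure_linear_image[of "\<lambda>x. N *v x" "box l u"] by simp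
    moreover have lm: "(\<lambda>x. N *v x) ` box l u \<in> lmeasurable"
      using measurable_linear_image[of "\<lambda>x. N *v x" "box l u"] by simp
    moreover have "(\<lambda>x. N *v x) ` box l u \<in> sets borel"
      using measurable_sets[of ?f lborel lborel "box l u"] by (simp add: vim)
    ultimately have "emeasure lborel ((\<lambda>x. N *v x) ` box l u) = \<bar>det N\<bar> * measure lborel (box l u)"
      using emeasure_eq_measure2[OF lm] by (simp add: emeasure_completion measure_completion)
    then have "emeasure (scale_measure (ennreal \<bar>det M\<bar>) (distr lborel lborel ?f)) (box l u)
        = ennreal \<bar>det M\<bar> * ennreal (\<bar>det N\<bar> * measure lborel (box l u))"
      by (simp add: emeasure_distr vim)
    also have "\<dots> = ennreal (\<bar>det M\<bar> * \<bar>det N\<bar> * measure lborel (box l u))"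
      by (simp add: ennreal_mult[symmetric] mult.assoc)
    also have "\<dots> = ennreal (\<Prod>b\<in>Basis. (u - l) \<bullet> b)"
      using lu by (simp add: dN)
    finally show "emeasure (scale_measure (ennreal \<bar>det M\<bar>) (distr lborel lborel ?f)) (box l u)
        = ennreal (\<Prod>b\<in>Basis. (u - l) \<bullet> b)" .
  qed simp
  then have "emeasure lborel A = emeasure (scale_measure (ennreal \<bar>det M\<bar>) (distr lborel lborel ?f)) A"
    by simp
  then show ?thesis
    using A by (simp add: emeasure_distr)
qed

text \<open>In the orthonormal bases \<beta> and \<gamma> the map \<open>T\<close> becomes
  multiplication by \<open>M\<close>; source and target may be different product types.\<close>

lemma emeasure_lborel_linear_vimage:
  fixes T :: "'a::euclidean_space \<Rightarrow> 'b::euclidean_space"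
    and \<beta> :: "'n::{finite,wellorder} \<Rightarrow> 'a" and \<gamma> :: "'n \<Rightarrow> 'b" and M :: "real^'n::_^'n::_"
  assumes T: "linear T" and \<beta>: "bij_betw \<beta> UNIV Basis" and \<gamma>: "bij_betw \<gamma> UNIV Basis"
    and M: "M = (\<chi> i j. T (\<beta> j) \<bullet> \<gamma> i)" and det: "det M \<noteq> 0"
    and A: "A \<in> sets borel"
  shows "emeasure lborel A = \<bar>det M\<bar> * emeasure lborel (T -` A)"
proof -
  let ?a = "\<lambda>x. \<chi> i. x \<bullet> \<beta> i" and ?b = "\<lambda>x. \<chi> i. x \<bullet> \<gamma> i"
  define L where "L v = (\<Sum>i\<in>UNIV. v $ i *\<^sub>R \<gamma> i)" for v :: "real^'n::_"
  have L: "L (?b x) = x" for x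
  proof -
    have "L (?b x) = (\<Sum>i\<in>UNIV. (x \<bullet> \<gamma> i) *\<^sub>R \<gamma> i)"
      by (simp add: L_def)
    also have "\<dots> = (\<Sum>b\<in>Basis. (x \<bullet> b) *\<^sub>R b)"
      by (rule sum.reindex_bij_betw[OF \<gamma>])
    finally show ?thesis by (simp add: euclidean_representation)
  qed
  have [measurable]: "?a \<in> borel_measurable borel" "?b \<in> borel_measurable borel"
    by (intro borel_measurable_continuous_onI continuous_intros)+
  have [measurable]: "L \<in> borel_measurable borel"
    unfolding L_def by (intro borel_measurable_continuous_onI continuous_intros)
  have [measurable]: "(\<lambda>x. M *v x) \<in> borel_measurable borel"
    by (intro borel_measurable_continuous_onI linear_continuous_on matrix_vector_mul_bounded_linear)
  note [measurable] = A
  define A' where "A' = L -` A"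
  have A' [measurable]: "A' \<in> sets borel"
    using measurable_sets[of L borel borel A] by (simp add: A'_def)
  have MT: "M *v ?a x = ?b (T x)" for x
  proof -
    have "T x = T (\<Sum>b\<in>Basis. (x \<bullet> b) *\<^sub>R b)"
      by (simp add: euclidean_representation)
    also have "\<dots> = T (\<Sum>j\<in>UNIV. (x \<bullet> \<beta> j) *\<^sub>R \<beta> j)"
      by (simp add: sum.reindex_bij_betw[OF \<beta>, of "\<lambda>b. (x \<bullet> b) *\<^sub>R b"])
    also have "\<dots> = (\<Sum>j\<in>UNIV. (x \<bullet> \<beta> j) *\<^sub>R T (\<beta> j))"
      using T by (simp add: linear_sum linear_cmul)
    finally show ?thesis
      by (simp add: M vec_eq_iff matrix_vector_mult_def inner_sum_left mult.commute)
  qed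
  have "emeasure lborel A = emeasure lborel (?b -` A')"
    by (simp add: A'_def vimage_def L)
  also have "\<dots> = emeasure lborel A'"
    using arg_cong[OF lborel_coordinates[OF \<gamma>], of "\<lambda>M. emeasure M A'"] by (simp add: emeasure_distr)
  also have "\<dots> = \<bar>det M\<bar> * emeasure lborel ((\<lambda>x. M *v x) -` A')"
    by (rule emeasure_lborel_matrix_vimage[OF det A'])
  also have "emeasure lborel ((\<lambda>x. M *v x) -` A') = emeasure lborel (?a -` ((\<lambda>x. M *v x) -` A'))"
    using arg_cong[OF lborel_coordinates[OF \<beta>], of "\<lambda>N. emeasure N ((\<lambda>x. M *v x) -` A')"]
      measurable_sets[of "\<lambda>x. M *v x" borel borel A']
    by (simp add: emeasure_distr)
  also have "?a -` ((\<lambda>x. M *v x) -` A') = T -` A"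
    by (simp add: A'_def vimage_def L MT)
  finally show ?thesis .
qed

text \<open>\<open>s\<^sup>2 * \<tau> (u /\<^sub>R s)\<close> is \<tau> made homogeneous of degree
  two. Dilating the slice at level \<open>s\<close> contributes \<open>s ^ DIM('a)\<close>; after
  exchanging the integrals, \<open>s\<close> runs up to \<open>1 / sqrt (\<tau> u)\<close>.\<close>

lemma emeasure_lborel_cone:
  fixes S :: "'a::euclidean_space set" and \<tau> :: "'a \<Rightarrow> real"
  assumes S [measurable]: "S \<in> sets borel" and \<tau> [measurable]: "\<tau> \<in> borel_measurable borel"
    and pos: "\<And>u. u \<in> S \<Longrightarrow> \<tau> u > 0"
  shows "emeasure lborel {(s, u). s > 0 \<and> u /\<^sub>R s \<in> S \<and> s\<^sup>2 * \<tau> (u /\<^sub>R s) \<le> 1} =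
    (\<integral>\<^sup>+u\<in>S. ennreal ((1 / sqrt (\<tau> u)) ^ (DIM('a) + 1) / (DIM('a) + 1)) \<partial>lborel)"
proof -
  let ?n = "DIM('a)"
  let ?C = "{(s, u). s > 0 \<and> u /\<^sub>R s \<in> S \<and> s\<^sup>2 * \<tau> (u /\<^sub>R s) \<le> 1} :: (real \<times> 'a) set"
  define f :: "real \<Rightarrow> 'a \<Rightarrow> ennreal" where "f s u = indicator S u * indicator {0<..1 / sqrt (\<tau> u)} s" for s u
  have f [measurable]: "case_prod f \<in> borel_measurable (borel \<Otimes>\<^sub>M borel)"
  proof -
    have [measurable]: "Measurable.pred (borel \<Otimes>\<^sub>M borel) (\<lambda>x. fst x \<in> {0<..1 / sqrt (\<tau> (snd x))})"
      unfolding greaterThanAtMost_iff by measurable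
    show ?thesis unfolding f_def split_beta' by measurable
  qed
  have Cm [measurable]: "?C \<in> sets (borel \<Otimes>\<^sub>M borel)"
  proof -
    have "?C = {x \<in> space (borel \<Otimes>\<^sub>M borel). fst x > 0 \<and> snd x /\<^sub>R fst x \<in> S \<and>
        (fst x)\<^sup>2 * \<tau> (snd x /\<^sub>R fst x) \<le> 1}"
      by (auto simp: space_pair_measure)
    then show ?thesis by simp
  qed
  have ind: "indicator ?C (s, u) = indicator {0<..} s * f s (u /\<^sub>R s)" for s u
  proof (cases "s > 0 \<and> u /\<^sub>R s \<in> S")
    case True
    then have t: "\<tau> (u /\<^sub>R s) > 0" using pos by blast
    have "s\<^sup>2 * \<tau> (u /\<^sub>R s) \<le> 1 \<longleftrightarrow> sqrt (s\<^sup>2 * \<tau> (u /\<^sub>R s)) \<le> 1"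
      by (simp add: real_sqrt_le_1_iff)
    also have "\<dots> \<longleftrightarrow> s \<le> 1 / sqrt (\<tau> (u /\<^sub>R s))"
      using True t by (simp add: real_sqrt_mult field_simps)
    finally show ?thesis
      using True by (auto simp: f_def indicator_def)
  qed (auto simp: f_def indicator_def)
  have scale: "(\<integral>\<^sup>+u. f s (u /\<^sub>R s) \<partial>lborel) = ennreal (s ^ ?n) * (\<integral>\<^sup>+u. f s u \<partial>lborel)" if "s > 0" for s
  proof -
    have [measurable]: "f s \<in> borel_measurable borel"
      using f by measurable
    have "(lborel :: 'a measure) = density (distr lborel borel (\<lambda>x. 0 + s *\<^sub>R x)) (\<lambda>_. ennreal (\<bar>s\<bar> ^ ?n))"
      using lborel_affine[of s "0 :: 'a"] that by simp
    then have "(\<integral>\<^sup>+u. f s (u /\<^sub>R s) \<partial>lborel) =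
        (\<integral>\<^sup>+u. f s (u /\<^sub>R s) \<partial>density (distr lborel borel (\<lambda>x. 0 + s *\<^sub>R x)) (\<lambda>_. ennreal (\<bar>s\<bar> ^ ?n)))"
      by (rule arg_cong[of _ _ "\<lambda>M. nn_integral M (\<lambda>u. f s (u /\<^sub>R s))"])
    also have "\<dots> = ennreal (s ^ ?n) * (\<integral>\<^sup>+u. f s u \<partial>lborel)"
      using that by (simp add: nn_integral_density nn_integral_distr nn_integral_cmult)
    finally show ?thesis .
  qed
  have inner: "(\<integral>\<^sup>+s. indicator {0<..} s * (ennreal (s ^ ?n) * f s u) \<partial>lborel) =
      ennreal ((1 / sqrt (\<tau> u)) ^ (?n + 1) / (?n + 1)) * indicator S u" for u
  proof (cases "u \<in> S")
    case True
    let ?r = "1 / sqrt (\<tau> u)"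
    have r: "?r > 0" using pos[OF True] by simp
    have "(\<integral>\<^sup>+s. indicator {0<..} s * (ennreal (s ^ ?n) * f s u) \<partial>lborel) =
        (\<integral>\<^sup>+s. ennreal (s ^ ?n) * indicator {0..?r} s \<partial>lborel)"
      using True by (intro nn_integral_cong) (auto simp: f_def indicator_def)
    also have "\<dots> = ?r ^ Suc ?n / Suc ?n - 0 ^ Suc ?n / Suc ?n"
      using r by (intro nn_integral_FTC_Icc)
        (auto intro!: derivative_eq_intros simp del: power_Suc of_nat_Suc)
    finally show ?thesis using True by simp
  qed (simp add: f_def)
  have "emeasure lborel ?C = emeasure (lborel \<Otimes>\<^sub>M lborel) ?C"
    by (simp add: lborel_prod)
  also have "\<dots> = (\<integral>\<^sup>+s. \<integral>\<^sup>+u. indicator ?C (s, u) \<partial>lborel \<partial>lborel)"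
    using Cm by (intro lborel.emeasure_pair_measure) (simp add: sets_pair_measure_cong[OF sets_lborel sets_lborel])
  also have "\<dots> = (\<integral>\<^sup>+s. indicator {0<..} s * (\<integral>\<^sup>+u. f s (u /\<^sub>R s) \<partial>lborel) \<partial>lborel)"
    unfolding ind by (intro nn_integral_cong nn_integral_cmult) (use f in measurable)
  also have "\<dots> = (\<integral>\<^sup>+s. indicator {0<..} s * (ennreal (s ^ ?n) * (\<integral>\<^sup>+u. f s u \<partial>lborel)) \<partial>lborel)"
    using scale by (intro nn_integral_cong) (auto simp: indicator_def)
  also have "\<dots> = (\<integral>\<^sup>+s. \<integral>\<^sup>+u. indicator {0<..} s * (ennreal (s ^ ?n) * f s u) \<partial>lborel \<partial>lborel)"
    by (intro nn_integral_cong) (subst nn_integral_cmult, use f in measurable)+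
  also have "\<dots> = (\<integral>\<^sup>+u. \<integral>\<^sup>+s. indicator {0<..} s * (ennreal (s ^ ?n) * f s u) \<partial>lborel \<partial>lborel)"
    by (rule lborel_pair.Fubini') (use f in measurable)
  finally show ?thesis
    unfolding inner .
qed

text \<open>Take 1 - |x|^2 for \<tau> in the cone formula: its homogeneous form is
  \<open>- lorentz X X\<close>, and integrating along rays yields the density of
  \<open>hyp_measure\<close> divided by \<open>CARD('n) + 1\<close>.\<close>

lemma hyp_measure_cone:
  fixes S :: "(real^'n) set"
  assumes S [measurable]: "S \<in> sets borel" and sub: "S \<subseteq> hyp_space"
  shows "emeasure hyp_measure S = ennreal (CARD('n) + 1) *
    emeasure lborel {X. fst X > 0 \<and> proj X \<in> S \<and> - lorentz X X \<le> 1}"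
proof -
  let ?n = "CARD('n)"
  have [measurable]: "hyp_space \<in> sets (borel :: (real^'n) measure)"
    by (intro borel_open) (simp add: hyp_space_def open_Collect_less continuous_intros)
  have "emeasure hyp_measure S =
      (\<integral>\<^sup>+x. (if x \<in> hyp_space then ennreal (1 / sqrt (1 - (norm x)\<^sup>2) ^ (?n + 1)) else 0) * indicator S x \<partial>lborel)"
    unfolding hyp_measure_def by (rule emeasure_density) measurable
  also have "\<dots> = (\<integral>\<^sup>+x. ennreal (?n + 1) *
      (ennreal ((1 / sqrt (1 - (norm x)\<^sup>2)) ^ (?n + 1) / (?n + 1)) * indicator S x) \<partial>lborel)"
  proof (intro nn_integral_cong)
    fix x :: "real^'n"
    show "(if x \<in> hyp_space then ennreal (1 / sqrt (1 - (norm x)\<^sup>2) ^ (?n + 1)) else 0) * indicator S x =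
        ennreal (?n + 1) * (ennreal ((1 / sqrt (1 - (norm x)\<^sup>2)) ^ (?n + 1) / (?n + 1)) * indicator S x)"
      using sub by (cases "x \<in> S")
        (auto simp: ennreal_mult'[symmetric] power_one_over simp del: power_Suc of_nat_Suc)
  qed
  also have "\<dots> = ennreal (?n + 1) *
      (\<integral>\<^sup>+x\<in>S. ennreal ((1 / sqrt (1 - (norm x)\<^sup>2)) ^ (?n + 1) / (?n + 1)) \<partial>lborel)"
    by (intro nn_integral_cmult) measurable
  also have "(\<integral>\<^sup>+x\<in>S. ennreal ((1 / sqrt (1 - (norm x)\<^sup>2)) ^ (?n + 1) / (?n + 1)) \<partial>lborel) =
      emeasure lborel {(s, u). s > 0 \<and> u /\<^sub>R s \<in> S \<and> s\<^sup>2 * (1 - (norm (u /\<^sub>R s))\<^sup>2) \<le> 1}"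
  proof -
    have "1 - (norm x)\<^sup>2 > 0" if "x \<in> S" for x
      using sub that by (force simp: hyp_space_def abs_square_less_1)
    then show ?thesis
      using emeasure_lborel_cone[of S "\<lambda>x. 1 - (norm x)\<^sup>2"] S by simp
  qed
  also have "{(s, u). s > 0 \<and> u /\<^sub>R s \<in> S \<and> s\<^sup>2 * (1 - (norm (u /\<^sub>R s))\<^sup>2) \<le> 1} =
      {X. fst X > 0 \<and> proj X \<in> S \<and> - lorentz X X \<le> 1}"
  proof -
    have "s\<^sup>2 * (1 - (norm (u /\<^sub>R s))\<^sup>2) = - lorentz (s, u) (s, u)" if "s > 0" for s and u :: "real^'n"
      using that by (simp add: lorentz_def power_mult_distrib power2_norm_eq_inner[symmetric] field_simps)
        (simp add: power2_eq_square power4_eq_xxxx)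
    then show ?thesis by (auto simp: proj_def)
  qed
  finally show ?thesis .
qed

section \<open>Gram determinants and frames with two null vectors\<close>

lemma lorentz_eq_sum_Basis:
  "lorentz u v = (\<Sum>b\<in>Basis. lorentz b b * (u \<bullet> b) * (v \<bullet> b))"
proof -
  have "(\<Sum>b\<in>Basis. lorentz b b * (u \<bullet> b) * (v \<bullet> b)) =
      (\<Sum>b\<in>(\<lambda>a. (a, 0)) ` Basis. lorentz b b * (u \<bullet> b) * (v \<bullet> b)) +
      (\<Sum>b\<in>(\<lambda>a. (0, a)) ` Basis. lorentz b b * (u \<bullet> b) * (v \<bullet> b))"
    unfolding Basis_prod_def by (intro sum.union_disjoint) auto
  also have "\<dots> = - (fst u * fst v) + (\<Sum>b\<in>Basis. (snd u \<bullet> b) * (snd v \<bullet> b))"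
    by (simp add: sum.reindex inj_on_def lorentz_def inner_prod_def inner_Basis cong: sum.cong)
  finally show ?thesis
    by (simp add: lorentz_def euclidean_inner[of "snd u" "snd v"])
qed

text \<open>The matrix of products is \<open>transpose M ** (D ** M)\<close>, where the diagonal
  matrix \<open>D\<close> of signs has determinant of size 1. So a Jacobian can be found from
  Lorentz products alone.\<close>

lemma abs_det_Gram:
  fixes \<gamma> :: "'m::{finite,wellorder} \<Rightarrow> real \<times> (real^'n)" and v :: "'m \<Rightarrow> real \<times> (real^'n)"
  assumes \<gamma>: "bij_betw \<gamma> UNIV Basis"
  shows "(det (\<chi> i j. v j \<bullet> \<gamma> i))\<^sup>2 = \<bar>det (\<chi> i j. lorentz (v i) (v j))\<bar>"
proof -
  define M :: "real^'m::_^'m::_" where "M = (\<chi> i j. v j \<bullet> \<gamma> i)"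
  define D :: "real^'m::_^'m::_" where "D = (\<chi> i j. if i = j then lorentz (\<gamma> i) (\<gamma> i) else 0)"
  have M: "M $ k $ j = v j \<bullet> \<gamma> k" for k j
    by (simp add: M_def)
  have DM: "(D ** M) $ k $ j = lorentz (\<gamma> k) (\<gamma> k) * (v j \<bullet> \<gamma> k)" for k j
    by (simp add: matrix_matrix_mult_def D_def M_def if_distrib[of "\<lambda>x. x * _"] cong: if_cong)
  have "(transpose M ** (D ** M)) $ i $ j = lorentz (v i) (v j)" for i j
  proof -
    have "(transpose M ** (D ** M)) $ i $ j =
        (\<Sum>k\<in>UNIV. lorentz (\<gamma> k) (\<gamma> k) * (v i \<bullet> \<gamma> k) * (v j \<bullet> \<gamma> k))"
      by (subst matrix_matrix_mult_def) (simp add: DM transpose_def M algebra_simps)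
    also have "\<dots> = lorentz (v i) (v j)"
      by (subst lorentz_eq_sum_Basis) (rule sum.reindex_bij_betw[OF \<gamma>])
    finally show ?thesis .
  qed
  then have G: "(\<chi> i j. lorentz (v i) (v j)) = transpose M ** (D ** M)"
    by (simp add: vec_eq_iff)
  have "\<bar>lorentz (\<gamma> i) (\<gamma> i)\<bar> = 1" for i
  proof -
    have "\<gamma> i \<in> Basis" using \<gamma> by (auto simp: bij_betw_def)
    then show ?thesis
      by (auto simp: Basis_prod_def lorentz_def inner_Basis)
  qed
  then have "\<bar>det D\<bar> = 1"
    by (simp add: det_diagonal D_def abs_prod)
  then show ?thesis
    unfolding G M_def[symmetric] by (simp add: det_mul abs_mult power2_eq_square)
qed

text \<open>The value -1/2 for the null pair makes the square of a vector x^2 + y^2 + z^2 - s w in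
  the coordinates below.\<close>

locale null_frame =
  fixes p q e1 e2 e3 :: "real \<times> (real^4)"
  assumes gram: "lorentz p p = 0" "lorentz q q = 0" "lorentz p q = - 1 / 2"
      "lorentz e1 e1 = 1" "lorentz e2 e2 = 1" "lorentz e3 e3 = 1"
      "lorentz e1 e2 = 0" "lorentz e1 e3 = 0" "lorentz e2 e3 = 0"
      "lorentz p e1 = 0" "lorentz p e2 = 0" "lorentz p e3 = 0"
      "lorentz q e1 = 0" "lorentz q e2 = 0" "lorentz q e3 = 0"
    and future: "fst p > 0" "fst q > 0"
begin

lemma gram':
  "lorentz q p = - 1 / 2" "lorentz e2 e1 = 0" "lorentz e3 e1 = 0" "lorentz e3 e2 = 0"
  "lorentz e1 p = 0" "lorentz e2 p = 0" "lorentz e3 p = 0"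
  "lorentz e1 q = 0" "lorentz e2 q = 0" "lorentz e3 q = 0"
  using gram by (simp_all add: lorentz_commute)

text \<open>For \<open>s = 1\<close> these are the coordinates of the upper half space model with \<open>p\<close> at infinity:
  horizontal position \<open>(x, y, z)\<close> and $w = t^2 + x^2 + y^2 + z^2$ for the height $t$.\<close>

fun pt :: "real \<times> real \<times> real \<times> real \<times> real \<Rightarrow> real \<times> (real^4)" where
  "pt (s, x, y, z, w) = s *\<^sub>R q + x *\<^sub>R e1 + y *\<^sub>R e2 + z *\<^sub>R e3 + w *\<^sub>R p"

lemma pt_lorentz:
  "lorentz (pt (s, x, y, z, w)) p = - s / 2" "lorentz (pt (s, x, y, z, w)) q = - w / 2"
  "lorentz (pt (s, x, y, z, w)) e1 = x" "lorentz (pt (s, x, y, z, w)) e2 = y"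
  "lorentz (pt (s, x, y, z, w)) e3 = z"
  by (simp_all add: gram gram')

lemma pt_self: "lorentz (pt (s, x, y, z, w)) (pt (s, x, y, z, w)) = x\<^sup>2 + y\<^sup>2 + z\<^sup>2 - s * w"
  by (simp add: gram gram' power2_eq_square algebra_simps)

lemma linear_pt: "linear pt"
  by (rule linearI) (auto simp: algebra_simps split: prod.splits)

text \<open>The squared height in the half space model, in its coordinates with
  \<open>s = 1\<close>.\<close>

definition \<tau> :: "real \<times> real \<times> real \<times> real \<Rightarrow> real" where
  "\<tau> = (\<lambda>(x, y, z, w). w - x\<^sup>2 - y\<^sup>2 - z\<^sup>2)"

lemma pt_self_1: "- lorentz (pt (1, u)) (pt (1, u)) = \<tau> u"
  by (cases u) (simp add: pt_self \<tau>_def del: pt.simps)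

lemma surj_pt: "\<exists>s x y z w. v = pt (s, x, y, z, w)"
proof -
  have inj: "inj pt"
  proof (rule linear_injective_0[OF linear_pt, THEN iffD2], intro allI impI)
    fix t assume "pt t = 0"
    moreover obtain s x y z w where t: "t = (s, x, y, z, w)" by (metis prod.collapse)
    ultimately have "pt (s, x, y, z, w) = 0" by simp
    then have "s = 0" "x = 0" "y = 0" "z = 0" "w = 0"
      using pt_lorentz[of s x y z w] by (simp_all del: pt.simps)
    then show "t = 0"
      by (simp add: t zero_prod_def)
  qed
  have "dim (range pt) = dim (UNIV :: (real \<times> real \<times> real \<times> real \<times> real) set)"
    by (rule dim_image_eq[OF linear_pt]) (use inj in \<open>auto simp: inj_on_def\<close>)
  also have "\<dots> = DIM(real \<times> (real^4))" by simp
  finally have "span (range pt) = UNIV"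
    by (simp only: dim_eq_full)
  moreover have "span (range pt) = range pt"
    using linear_subspace_image[OF linear_pt, of UNIV] by (simp add: span_eq_iff)
  ultimately have "v \<in> range pt" by simp
  then show ?thesis by (metis imageE prod.collapse)
qed

text \<open>Nondegeneracy of the form; it reduces an identity between vectors to products with the
  frame.\<close>

lemma orthogonal_frame_zero:
  assumes "lorentz v p = 0" "lorentz v q = 0" "lorentz v e1 = 0" "lorentz v e2 = 0" "lorentz v e3 = 0"
  shows "v = 0"
proof -
  obtain s x y z w where "v = pt (s, x, y, z, w)" using surj_pt by blast
  then show ?thesis
    using assms pt_lorentz[of s x y z w] by (simp del: pt.simps) simp
qed

lemma pt_future_iff:
  assumes "\<tau> u > 0"
  shows "fst (pt (1, u)) > 0"
proof -
  have "lorentz (pt (1, u)) p < 0"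
    using pt_lorentz(1)[of 1] by (cases u) (simp del: pt.simps)
  then show ?thesis
    using timelike_future_iff[of "pt (1, u)" p] assms pt_self_1[of u] gram future by simp
qed

lemma Basis_5: "(Basis :: (real \<times> real \<times> real \<times> real \<times> real) set) =
   {(1, 0, 0, 0, 0), (0, 1, 0, 0, 0), (0, 0, 1, 0, 0), (0, 0, 0, 1, 0), (0, 0, 0, 0, 1)}"
  by (auto simp: Basis_prod_def zero_prod_def)

text \<open>The null pair has Gram determinant -1/4, the rest 1, and the Jacobian is the square root
  of 1/4. Since the bijection \<beta> is not explicit, the determinant is taken from the squared
  Gram matrix, which is diagonal for every enumeration of the basis.\<close>

lemma emeasure_lborel_pt:
  assumes "A \<in> sets borel"
  shows "emeasure lborel A = ennreal (1 / 2) * emeasure lborel (pt -` A)"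
proof -
  obtain \<beta> :: "5 \<Rightarrow> real \<times> real \<times> real \<times> real \<times> real" where \<beta>: "bij_betw \<beta> UNIV Basis"
    using finite_same_card_bij[of "UNIV :: 5 set" "Basis :: (real \<times> real \<times> real \<times> real \<times> real) set"]
    by auto
  obtain \<gamma> :: "5 \<Rightarrow> real \<times> (real^4)" where \<gamma>: "bij_betw \<gamma> UNIV Basis"
    using finite_same_card_bij[of "UNIV :: 5 set" "Basis :: (real \<times> (real^4)) set"]
    by auto
  define M :: "real^5^5" where "M = (\<chi> i j. pt (\<beta> j) \<bullet> \<gamma> i)"
  define G :: "real^5^5" where "G = (\<chi> i j. lorentz (pt (\<beta> i)) (pt (\<beta> j)))"
  define k where "k b = (if b \<in> {(1, 0, 0, 0, 0), (0, 0, 0, 0, 1)} then 1 / 4 else 1 :: real)"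
    for b :: "real \<times> real \<times> real \<times> real \<times> real"
  have \<beta>B: "\<beta> i \<in> Basis" for i using \<beta> by (auto simp: bij_betw_def)
  \<comment> \<open>The Gram matrix swaps the first and the last coordinate, but its square is diagonal.\<close>
  have "G ** G = (\<chi> i j. if i = j then k (\<beta> i) else 0)"
  proof (simp only: vec_eq_iff, intro allI)
    fix i j
    have "(G ** G) $ i $ j = (\<Sum>l\<in>UNIV. lorentz (pt (\<beta> i)) (pt (\<beta> l)) * lorentz (pt (\<beta> l)) (pt (\<beta> j)))"
      by (simp add: matrix_matrix_mult_def G_def)
    also have "\<dots> = (\<Sum>b\<in>Basis. lorentz (pt (\<beta> i)) (pt b) * lorentz (pt b) (pt (\<beta> j)))"
      by (rule sum.reindex_bij_betw[OF \<beta>])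
    also have "\<dots> = (if \<beta> i = \<beta> j then k (\<beta> i) else 0)"
      using \<beta>B[of i] \<beta>B[of j] unfolding Basis_5 by (auto simp: gram gram' k_def)
    also have "\<beta> i = \<beta> j \<longleftrightarrow> i = j"
      using \<beta> by (auto simp: bij_betw_def inj_on_def)
    finally show "(G ** G) $ i $ j = (\<chi> i j. if i = j then k (\<beta> i) else 0) $ i $ j"
      by simp
  qed
  then have "det (G ** G) = (\<Prod>i\<in>UNIV. k (\<beta> i))"
    by (simp add: det_diagonal)
  also have "\<dots> = (\<Prod>b\<in>Basis. k b)"
    by (rule prod.reindex_bij_betw[OF \<beta>])
  also have "\<dots> = 1 / 16"
    unfolding Basis_5 by (simp add: k_def)
  finally have "(det G)\<^sup>2 = (1 / 4)\<^sup>2"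
    by (simp add: det_mul power2_eq_square)
  then have "\<bar>det G\<bar> = 1 / 4"
    by (simp only: power2_eq_iff) auto
  then have "(det M)\<^sup>2 = (1 / 2)\<^sup>2"
    using abs_det_Gram[OF \<gamma>, of "\<lambda>j. pt (\<beta> j)"] by (simp add: M_def G_def power2_eq_square)
  then have "\<bar>det M\<bar> = 1 / 2"
    by (simp only: power2_eq_iff) auto
  moreover from this have "det M \<noteq> 0" by force
  ultimately show ?thesis
    using emeasure_lborel_linear_vimage[OF linear_pt \<beta> \<gamma> M_def _ assms] by (simp only: not_False_eq_True simp_thms)
qed

lemma pt_measurable [measurable]: "pt \<in> borel_measurable borel"
  by (intro borel_measurable_continuous_onI linear_continuous_on linear_conv_bounded_linear[THEN iffD1] linear_pt)

lemma proj_measurable [measurable]: "proj \<in> borel_measurable borel"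
proof -
  have [measurable]: "fst \<in> borel_measurable borel" "snd \<in> borel_measurable borel"
    by (auto intro!: borel_measurable_continuous_onI continuous_on_fst continuous_on_snd continuous_on_id)
  show ?thesis unfolding proj_def by measurable
qed

text \<open>The factor 1/2 is 5 (cone formula) times 1/2 (Jacobian) times 1/5 (radial integral). The
  density is the half space element dx dy dz dt / t^4 in the variable w, as dw = 2 t dt and \<tau> =
  t^2.\<close>

lemma hyp_measure_frame:
  assumes S [measurable]: "S \<in> sets borel" and sub: "S \<subseteq> hyp_space"
  shows "emeasure hyp_measure S =
    (\<integral>\<^sup>+u. (if \<tau> u > 0 \<and> proj (pt (1, u)) \<in> S then ennreal ((1 / sqrt (\<tau> u)) ^ 5 / 2) else 0) \<partial>lborel)"
proof -
  define A where "A = {X. fst X > 0 \<and> proj X \<in> S \<and> - lorentz X X \<le> 1}"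
  define S' where "S' = {u. \<tau> u > 0 \<and> proj (pt (1, u)) \<in> S}"
  have [measurable]: "\<tau> \<in> borel_measurable borel"
    unfolding \<tau>_def split_beta' by (intro borel_measurable_continuous_onI continuous_intros)
  have [measurable]: "(\<lambda>u. pt (1, u)) \<in> borel_measurable borel"
    by (rule measurable_compose[OF _ pt_measurable]) (simp add: borel_prod[symmetric])
  have [measurable]: "(fst :: real \<times> (real^4) \<Rightarrow> real) \<in> borel_measurable borel"
    by (auto intro!: borel_measurable_continuous_onI continuous_on_fst continuous_on_id)
  have [measurable]: "(\<lambda>X :: real \<times> (real^4). lorentz X X) \<in> borel_measurable borel"
    by (intro borel_measurable_continuous_onI continuous_intros)
  have A: "A \<in> sets borel" unfolding A_def by measurable
  have S' [measurable]: "S' \<in> sets borel" unfolding S'_def by measurable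
  have vim: "pt -` A = {(s, u). s > 0 \<and> u /\<^sub>R s \<in> S' \<and> s\<^sup>2 * \<tau> (u /\<^sub>R s) \<le> 1}"
  proof -
    have "pt (s, u) \<in> A \<longleftrightarrow> s > 0 \<and> u /\<^sub>R s \<in> S' \<and> s\<^sup>2 * \<tau> (u /\<^sub>R s) \<le> 1" for s u
    proof (cases "s > 0")
      case True
      define u' where "u' = u /\<^sub>R s"
      have "(s, u) = s *\<^sub>R (1, u')"
        using True by (simp add: u'_def)
      then have pts: "pt (s, u) = s *\<^sub>R pt (1, u')"
        by (simp only: linear_cmul[OF linear_pt])
      have "0 < \<tau> u'" if "proj (pt (1, u')) \<in> S" "fst (pt (1, u')) > 0"
      proof -
        have "lorentz (lift (proj (pt (1, u')))) (lift (proj (pt (1, u')))) < 0"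
          using that sub lift_timelike_iff by blast
        then show ?thesis
          using that pt_self_1[of u'] by (simp add: lift_proj zero_less_mult_iff divide_less_0_iff)
      qed
      then have "pt (s, u) \<in> A \<longleftrightarrow> u' \<in> S' \<and> s\<^sup>2 * \<tau> u' \<le> 1"
        using True pt_future_iff[of u']
        by (auto simp: A_def S'_def pts proj_scaleR pt_self_1[symmetric] zero_less_mult_iff power2_eq_square mult.assoc)
      then show ?thesis using True by (simp add: u'_def)
    next
      case False
      \<comment> \<open>Points of hyperbolic space have negative product with the future vector
        \<open>p\<close>, and here that product is \<open>- s / 2\<close>.\<close>
      have "s > 0" if "pt (s, u) \<in> A"
      proof -
        have *: "fst (pt (s, u)) > 0" "proj (pt (s, u)) \<in> hyp_space"
          using that sub by (auto simp: A_def)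
        then have "lorentz (lift (proj (pt (s, u)))) p < 0"
          using gram future by (intro timelike_lift_neg) simp_all
        then have "lorentz (pt (s, u)) p < 0"
          using * by (simp add: lift_proj divide_less_0_iff)
        then show ?thesis
          using pt_lorentz(1)[of s] by (cases u) (simp del: pt.simps)
      qed
      then show ?thesis using False by blast
    qed
    then show ?thesis
      by (intro set_eqI) (simp only: vimage_eq mem_Collect_eq split: prod.split, blast)
  qed
  have "emeasure hyp_measure S = ennreal 5 * emeasure lborel A"
    using hyp_measure_cone[OF S sub] by (simp add: A_def)
  also have "\<dots> = ennreal 5 * (ennreal (1 / 2) * emeasure lborel (pt -` A))"
    by (simp only: emeasure_lborel_pt[OF A])
  also have "emeasure lborel (pt -` A) = (\<integral>\<^sup>+u\<in>S'. ennreal ((1 / sqrt (\<tau> u)) ^ 5 / 5) \<partial>lborel)"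
  proof -
    have dim: "DIM(real \<times> real \<times> real \<times> real) + 1 = 5" by simp
    have "\<tau> u > 0" if "u \<in> S'" for u using that by (simp add: S'_def)
    from emeasure_lborel_cone[of S' \<tau>, OF _ _ this, unfolded dim] show ?thesis
      unfolding vim by simp
  qed
  also have "ennreal 5 * (ennreal (1 / 2) * \<dots>) =
      ennreal (5 / 2) * (\<integral>\<^sup>+u\<in>S'. ennreal ((1 / sqrt (\<tau> u)) ^ 5 / 5) \<partial>lborel)"
  proof -
    have "ennreal 5 * ennreal (1 / 2) = ennreal (5 / 2)"
      by (subst ennreal_mult'[symmetric]) auto
    then show ?thesis by (simp only: mult.assoc[symmetric])
  qed
  also have "\<dots> = (\<integral>\<^sup>+u. ennreal (5 / 2) * (ennreal ((1 / sqrt (\<tau> u)) ^ 5 / 5) * indicator S' u) \<partial>lborel)"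
    by (rule nn_integral_cmult[symmetric]) measurable
  also have "\<dots> = (\<integral>\<^sup>+u. (if \<tau> u > 0 \<and> proj (pt (1, u)) \<in> S then ennreal ((1 / sqrt (\<tau> u)) ^ 5 / 2) else 0) \<partial>lborel)"
  proof (rule nn_integral_cong)
    fix u
    have "ennreal (5 / 2) * ennreal ((1 / sqrt (\<tau> u)) ^ 5 / 5) = ennreal ((1 / sqrt (\<tau> u)) ^ 5 / 2)"
    proof -
      have "ennreal (5 / 2) * ennreal (x / 5) = ennreal (x / 2)" for x
        by (subst ennreal_mult'[symmetric]) simp_all
      then show ?thesis .
    qed
    then show "ennreal (5 / 2) * (ennreal ((1 / sqrt (\<tau> u)) ^ 5 / 5) * indicator S' u) =
        (if \<tau> u > 0 \<and> proj (pt (1, u)) \<in> S then ennreal ((1 / sqrt (\<tau> u)) ^ 5 / 2) else 0)"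
      by (cases "u \<in> S'") (auto simp: S'_def)
  qed
  finally show ?thesis .
qed

end

section \<open>The integrals\<close>

text \<open>The open interval admits antiderivatives that have only one-sided limits at the ends,
  such as those in t / sqrt (1 - t^2) at 1.\<close>

lemma nn_integral_FTC_Ioo:
  fixes f F :: "real \<Rightarrow> real"
  assumes ab: "a < b" and f [measurable]: "f \<in> borel_measurable borel"
    and F: "\<And>x. a < x \<Longrightarrow> x < b \<Longrightarrow> DERIV F x :> f x"
    and cont: "\<And>x. a < x \<Longrightarrow> x < b \<Longrightarrow> isCont f x"
    and nonneg: "\<And>x. a < x \<Longrightarrow> x < b \<Longrightarrow> 0 \<le> f x"
    and A: "(F \<longlongrightarrow> A) (at_right a)" and B: "(F \<longlongrightarrow> B) (at_left b)"
  shows "(\<integral>\<^sup>+x. ennreal (f x) * indicator {a<..<b} x \<partial>lborel) = ennreal (B - A)"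
proof -
  have FA: "((F \<circ> real_of_ereal) \<longlongrightarrow> A) (at_right (ereal a))"
    and FB: "((F \<circ> real_of_ereal) \<longlongrightarrow> B) (at_left (ereal b))"
    using A B by (simp_all add: ereal_tendsto_simps1)
  have AE: "AE x in lborel. ereal a < ereal x \<longrightarrow> ereal x < ereal b \<longrightarrow> 0 \<le> f x"
    using nonneg by simp
  have int: "set_integrable lborel (einterval (ereal a) (ereal b)) f"
    "(LBINT x=ereal a..ereal b. f x) = B - A"
    using interval_integral_FTC_nonneg[of "ereal a" "ereal b" F f A B] ab F cont AE FA FB by simp_all
  have eq: "einterval (ereal a) (ereal b) = {a<..<b}"
    by (auto simp: einterval_def)
  have "(\<integral>\<^sup>+x. ennreal (f x) * indicator {a<..<b} x \<partial>lborel) =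
      (\<integral>\<^sup>+x. ennreal (indicator {a<..<b} x *\<^sub>R f x) \<partial>lborel)"
    by (intro nn_integral_cong) (auto simp: indicator_def)
  also have "\<dots> = ennreal (LINT x|lborel. indicator {a<..<b} x *\<^sub>R f x)"
    using int(1) nonneg by (intro nn_integral_eq_integral)
      (auto simp: set_integrable_def eq indicator_def)
  also have "(LINT x|lborel. indicator {a<..<b} x *\<^sub>R f x) = B - A"
    using int(2) ab by (simp add: interval_lebesgue_integral_def set_lebesgue_integral_def eq)
  finally show ?thesis .
qed

text \<open>With t = sqrt (w - c) this is the integral of dt / t^4 over the part of a vertical line
  above height sqrt (h - c).\<close>

lemma nn_integral_height:
  assumes "h > c"
  shows "(\<integral>\<^sup>+w. ennreal ((1 / sqrt (w - c)) ^ 5 / 2) * indicator {h..} w \<partial>lborel) =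
    ennreal ((1 / sqrt (h - c)) ^ 3 / 3)"
proof -
  define F where "F w = - ((1 / sqrt (w - c)) ^ 3 / 3)" for w
  have "(\<integral>\<^sup>+w. ennreal ((1 / sqrt (w - c)) ^ 5 / 2) * indicator {h..} w \<partial>lborel) = 0 - F h"
  proof (rule nn_integral_FTC_atLeast)
    fix x assume "h \<le> x"
    then have x: "x - c > 0" using assms by simp
    show "DERIV F x :> (1 / sqrt (x - c)) ^ 5 / 2"
    proof -
      define g where "g w = sqrt (w - c)" for w
      have g0: "g x > 0" using x by (simp add: g_def)
      have "(g has_real_derivative 1 / (2 * g x)) (at x)"
        unfolding g_def using x by (auto intro!: derivative_eq_intros simp: inverse_eq_divide)
      then have "((\<lambda>w. - ((1 / g w) ^ 3 / 3)) has_real_derivative (1 / g x) ^ 5 / 2) (at x)"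
        using g0 by (auto intro!: derivative_eq_intros simp: field_simps eval_nat_numeral)
      then show ?thesis by (simp add: F_def[abs_def] g_def)
    qed
    show "0 \<le> (1 / sqrt (x - c)) ^ 5 / 2" using x by simp
  next
    have "LIM w at_top. - c + w :> at_top"
      by (rule filterlim_tendsto_add_at_top[OF tendsto_const filterlim_ident])
    then have "LIM w at_top. sqrt (w - c) :> at_top"
      by (intro filterlim_compose[OF sqrt_at_top]) (simp add: algebra_simps)
    then have "((\<lambda>w. inverse (sqrt (w - c))) \<longlongrightarrow> 0) at_top"
      by (rule tendsto_inverse_0_at_top)
    then have "((\<lambda>w. - (inverse (sqrt (w - c)) ^ 3 / 3)) \<longlongrightarrow> - (0 ^ 3 / 3)) at_top"
      by (intro tendsto_intros) auto
    then show "(F \<longlongrightarrow> 0) at_top"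
      by (simp add: F_def[abs_def] inverse_eq_divide)
  qed simp
  then show ?thesis by (simp add: F_def)
qed

lemma nn_integral_lborel_4:
  fixes f :: "real \<times> real \<times> real \<times> real \<Rightarrow> ennreal"
  assumes [measurable]: "f \<in> borel_measurable borel"
  shows "(\<integral>\<^sup>+u. f u \<partial>lborel) =
    (\<integral>\<^sup>+x. \<integral>\<^sup>+y. \<integral>\<^sup>+z. \<integral>\<^sup>+w. f (x, y, z, w) \<partial>lborel \<partial>lborel \<partial>lborel \<partial>lborel)"
proof -
  have m: "f \<in> borel_measurable (borel \<Otimes>\<^sub>M (borel \<Otimes>\<^sub>M (borel \<Otimes>\<^sub>M borel)))"
    by (simp add: borel_prod)
  have "(\<integral>\<^sup>+u. f u \<partial>lborel) = (\<integral>\<^sup>+x. \<integral>\<^sup>+u. f (x, u) \<partial>lborel \<partial>lborel)"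
    by (subst lborel_prod[symmetric], subst lborel.nn_integral_fst[symmetric]) (simp_all add: lborel_prod)
  also have "\<dots> = (\<integral>\<^sup>+x. \<integral>\<^sup>+y. \<integral>\<^sup>+u. f (x, y, u) \<partial>lborel \<partial>lborel \<partial>lborel)"
  proof (intro nn_integral_cong)
    fix x
    have [measurable]: "(\<lambda>u. f (x, u)) \<in> borel_measurable borel"
      using m by (simp add: borel_prod[symmetric])
    show "(\<integral>\<^sup>+u. f (x, u) \<partial>lborel) = (\<integral>\<^sup>+y. \<integral>\<^sup>+u. f (x, y, u) \<partial>lborel \<partial>lborel)"
      by (subst lborel_prod[symmetric], subst lborel.nn_integral_fst[symmetric]) (simp_all add: lborel_prod)
  qed
  also have "\<dots> = (\<integral>\<^sup>+x. \<integral>\<^sup>+y. \<integral>\<^sup>+z. \<integral>\<^sup>+w. f (x, y, z, w) \<partial>lborel \<partial>lborel \<partial>lborel \<partial>lborel)"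
  proof (intro nn_integral_cong)
    fix x y
    have [measurable]: "(\<lambda>u. f (x, y, u)) \<in> borel_measurable borel"
      using m by (simp add: borel_prod[symmetric])
    show "(\<integral>\<^sup>+u. f (x, y, u) \<partial>lborel) = (\<integral>\<^sup>+z. \<integral>\<^sup>+w. f (x, y, z, w) \<partial>lborel \<partial>lborel)"
      by (subst lborel_prod[symmetric], subst lborel.nn_integral_fst[symmetric]) (simp_all add: lborel_prod)
  qed
  finally show ?thesis .
qed

lemma arctan_one_over_sqrt3: "arctan (1 / sqrt 3) = pi / 6"
  by (rule arctan_unique) (simp_all add: tan_30)

lemma nn_integral_Ahmed_inner:
  assumes u: "0 \<le> u"
  shows "(\<integral>\<^sup>+t. ennreal (sqrt ((1 - t\<^sup>2) / 2) / ((1 + u\<^sup>2 * ((1 - t\<^sup>2) / 2)) * (1 + t\<^sup>2))) * indicator {0<..<1} t \<partial>lborel)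
    = ennreal (pi / 2 * (1 / (1 + u\<^sup>2) - 1 / ((1 + u\<^sup>2) * sqrt (2 + u\<^sup>2))))"
proof -
  \<comment> \<open>Substituting h = t / sqrt (1 - t^2) gives 2 + u^2 (1 - t^2) = (c^2 + 2 h^2) / (1
    + h^2), so \<open>c\<close> is the scale in the second arctangent.\<close>
  define c where "c = sqrt (2 + u\<^sup>2)"
  have c2: "c\<^sup>2 = 2 + u\<^sup>2" by (simp add: c_def add_nonneg_nonneg)
  have c0: "c > 0" by (simp add: c_def add_pos_nonneg)
  define f where "f t = sqrt ((1 - t\<^sup>2) / 2) / ((1 + u\<^sup>2 * ((1 - t\<^sup>2) / 2)) * (1 + t\<^sup>2))" for t
  define h where "h t = t / sqrt (1 - t\<^sup>2)" for t :: real
  \<comment> \<open>from the substitution by \<open>h t\<close> and partial fractions\<close>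
  define G where "G t = 1 / (1 + u\<^sup>2) * (arctan (sqrt 2 * h t) - 1 / c * arctan (sqrt 2 / c * h t))" for t
  have sq: "1 - t\<^sup>2 > 0" if "0 < t" "t < 1" for t :: real
    using that by (simp add: abs_square_less_1)
  have Dh: "(h has_real_derivative 1 / (sqrt (1 - t\<^sup>2) * (1 - t\<^sup>2))) (at t)" if "0 < t" "t < 1" for t
  proof -
    have "sqrt (1 - t\<^sup>2) * sqrt (1 - t\<^sup>2) = 1 - t\<^sup>2" "sqrt (1 - t\<^sup>2) > 0"
      using sq[OF that] by simp_all
    then show ?thesis
      unfolding h_def using sq[OF that]
      by (auto intro!: derivative_eq_intros simp: divide_simps power2_eq_square) 
  qed
  have Dk: "((\<lambda>t. arctan (k * h t)) has_real_derivative k / (sqrt (1 - t\<^sup>2) * (1 - t\<^sup>2 + k\<^sup>2 * t\<^sup>2))) (at t)"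
    if t: "0 < t" "t < 1" for t k
  proof -
    have hh: "(h t)\<^sup>2 = t\<^sup>2 / (1 - t\<^sup>2)"
      using sq[OF t] by (simp add: h_def power_divide)
    have pos: "1 - t\<^sup>2 + k\<^sup>2 * t\<^sup>2 > 0"
      using sq[OF t] by (simp add: add_pos_nonneg)
    have "1 + (k * h t)\<^sup>2 = (1 - t\<^sup>2 + k\<^sup>2 * t\<^sup>2) / (1 - t\<^sup>2)"
      using sq[OF t] by (simp add: power_mult_distrib hh field_simps)
    then have eq: "inverse (1 + (k * h t)\<^sup>2) * (k * (1 / (sqrt (1 - t\<^sup>2) * (1 - t\<^sup>2)))) =
        k / (sqrt (1 - t\<^sup>2) * (1 - t\<^sup>2 + k\<^sup>2 * t\<^sup>2))"
      using sq[OF t] pos by simp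
    show ?thesis
      unfolding eq[symmetric] by (rule DERIV_chain2[OF DERIV_arctan DERIV_cmult[OF Dh[OF t]]])
  qed
  have DG: "DERIV G t :> f t" if t: "0 < t" "t < 1" for t
  proof -
    have "DERIV G t :> 1 / (1 + u\<^sup>2) * (sqrt 2 / (sqrt (1 - t\<^sup>2) * (1 - t\<^sup>2 + (sqrt 2)\<^sup>2 * t\<^sup>2)) -
        1 / c * ((sqrt 2 / c) / (sqrt (1 - t\<^sup>2) * (1 - t\<^sup>2 + (sqrt 2 / c)\<^sup>2 * t\<^sup>2))))"
      unfolding G_def by (intro DERIV_cmult DERIV_diff Dk t)
    also have "1 / c * ((sqrt 2 / c) / (sqrt (1 - t\<^sup>2) * (1 - t\<^sup>2 + (sqrt 2 / c)\<^sup>2 * t\<^sup>2))) =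
        sqrt 2 / (sqrt (1 - t\<^sup>2) * (c\<^sup>2 * (1 - t\<^sup>2) + 2 * t\<^sup>2))"
    proof -
      have D: "c\<^sup>2 * (1 - t\<^sup>2 + (sqrt 2 / c)\<^sup>2 * t\<^sup>2) = c\<^sup>2 * (1 - t\<^sup>2) + 2 * t\<^sup>2"
        using c0 by (simp add: power_divide field_simps)
      show ?thesis
        unfolding D[symmetric] by (simp add: power2_eq_square mult_ac)
    qed
    also have "c\<^sup>2 * (1 - t\<^sup>2) + 2 * t\<^sup>2 = 2 + u\<^sup>2 * (1 - t\<^sup>2)"
      by (simp add: c2 algebra_simps)
    also have "1 - t\<^sup>2 + (sqrt 2)\<^sup>2 * t\<^sup>2 = 1 + t\<^sup>2" by simp
    also have "1 / (1 + u\<^sup>2) * (sqrt 2 / (sqrt (1 - t\<^sup>2) * (1 + t\<^sup>2)) - sqrt 2 / (sqrt (1 - t\<^sup>2) * (2 + u\<^sup>2 * (1 - t\<^sup>2)))) = f t"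
    proof -
      define r where "r = sqrt (1 - t\<^sup>2)"
      have r: "r > 0" "1 - t\<^sup>2 = r\<^sup>2" using sq[OF t] by (simp_all add: r_def)
      have s2: "sqrt 2 > 0" "sqrt 2 * sqrt 2 = 2" by simp_all
      have pos: "1 + u\<^sup>2 > 0" "1 + t\<^sup>2 > 0" "2 + u\<^sup>2 * r\<^sup>2 > 0" by (simp_all add: add_pos_nonneg)
      have "f t = sqrt 2 * r / ((2 + u\<^sup>2 * r\<^sup>2) * (1 + t\<^sup>2))"
      proof -
        have "f t = (r / sqrt 2) / ((1 + u\<^sup>2 * (r\<^sup>2 / 2)) * (1 + t\<^sup>2))"
          using r(1) by (simp add: f_def real_sqrt_divide r(2))
        also have "r / sqrt 2 = sqrt 2 * r / 2"
          using s2 by (simp add: field_simps)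
        also have "1 + u\<^sup>2 * (r\<^sup>2 / 2) = (2 + u\<^sup>2 * r\<^sup>2) / 2" by simp
        finally show ?thesis using pos by simp
      qed
      moreover have "1 / (1 + u\<^sup>2) * (sqrt 2 / (r * (1 + t\<^sup>2)) - sqrt 2 / (r * (2 + u\<^sup>2 * r\<^sup>2))) =
          sqrt 2 * r / ((2 + u\<^sup>2 * r\<^sup>2) * (1 + t\<^sup>2))"
      proof -
        \<comment> \<open>Partial fractions: the two denominators differ by
          \<open>(1 + u\<^sup>2) * r\<^sup>2\<close>.\<close>
        have frac: "1 / K * (s / (r * X) - s / (r * Y)) = s * r / (Y * X)"
          if "Y - X = K * r\<^sup>2" "K \<noteq> 0" "X \<noteq> 0" "Y \<noteq> 0" for K X Y s
        proof -
          have "1 / K * (s / (r * X) - s / (r * Y)) = s * (Y - X) / (K * r * X * Y)"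
            using that(2-4) r(1) by (simp add: field_simps)
          then show ?thesis
            unfolding that(1) using that(2-4) r(1) by (simp add: power2_eq_square)
        qed
        have "(2 + u\<^sup>2 * r\<^sup>2) - (1 + t\<^sup>2) = (1 + u\<^sup>2) * r\<^sup>2"
          using r(2) by (simp add: algebra_simps)
        then show ?thesis
          using pos by (intro frac) simp_all
      qed
      ultimately show ?thesis using r(1) by (simp add: r(2) r_def[symmetric])
    qed
    finally show ?thesis .
  qed
  have h0: "(h \<longlongrightarrow> 0) (at_right 0)"
  proof -
    have "(h \<longlongrightarrow> 0 / sqrt (1 - 0\<^sup>2)) (at_right 0)"
      unfolding h_def by (intro tendsto_intros) auto
    then show ?thesis by simp
  qed
  have h1: "filterlim h at_top (at_left 1)"
    unfolding h_def
  proof (rule LIM_at_top_divide)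
    show "((\<lambda>t. sqrt (1 - t\<^sup>2)) \<longlongrightarrow> 0) (at_left (1::real))"
    proof -
      have "((\<lambda>t. sqrt (1 - t\<^sup>2)) \<longlongrightarrow> sqrt (1 - 1\<^sup>2)) (at_left (1::real))"
        by (intro tendsto_intros)
      then show ?thesis by simp
    qed
    show "\<forall>\<^sub>F t in at_left 1. 0 < sqrt (1 - t\<^sup>2)"
      using sq by (auto simp: eventually_at_left_field intro!: exI[of _ 0])
  qed (auto intro: tendsto_ident_at)
  have A: "(G \<longlongrightarrow> 0) (at_right 0)"
  proof -
    have "(G \<longlongrightarrow> 1 / (1 + u\<^sup>2) * (arctan (sqrt 2 * 0) - 1 / c * arctan (sqrt 2 / c * 0))) (at_right 0)"
      unfolding G_def by (intro tendsto_intros h0)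
    then show ?thesis by simp
  qed
  have lim: "((\<lambda>t. arctan (k * h t)) \<longlongrightarrow> pi / 2) (at_left 1)" if "k > 0" for k
    by (rule filterlim_compose[OF tendsto_arctan_at_top])
      (rule filterlim_tendsto_pos_mult_at_top[OF tendsto_const that h1])
  have B: "(G \<longlongrightarrow> 1 / (1 + u\<^sup>2) * (pi / 2 - 1 / c * (pi / 2))) (at_left 1)"
    unfolding G_def using c0 by (intro tendsto_intros lim) auto
  have "(\<integral>\<^sup>+t. ennreal (f t) * indicator {0<..<1} t \<partial>lborel) =
      ennreal (1 / (1 + u\<^sup>2) * (pi / 2 - 1 / c * (pi / 2)) - 0)"
  proof (rule nn_integral_FTC_Ioo[OF _ _ DG _ _ A B])
    show "f \<in> borel_measurable borel" unfolding f_def by measurable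
    fix t :: real assume t: "0 < t" "t < 1"
    have pos: "1 + u\<^sup>2 * ((1 - t\<^sup>2) / 2) > 0" "1 + t\<^sup>2 > 0"
      using sq[OF t] by (auto intro!: add_pos_nonneg)
    show "isCont f t"
      unfolding f_def using pos by (intro continuous_intros) simp_all
    show "0 \<le> f t"
      unfolding f_def using pos sq[OF t] by simp
  qed auto
  also have "1 / (1 + u\<^sup>2) * (pi / 2 - 1 / c * (pi / 2)) - 0 =
      pi / 2 * (1 / (1 + u\<^sup>2) - 1 / ((1 + u\<^sup>2) * c))"
    by (simp add: algebra_simps)
  finally show ?thesis unfolding f_def c_def .
qed

text \<open>Write the arctangent as an integral over \<open>u\<close> and exchange the integrations.\<close>

lemma nn_integral_Ahmed:
  "(\<integral>\<^sup>+t. ennreal (arctan (sqrt ((1 - t\<^sup>2) / 2)) / (1 + t\<^sup>2)) * indicator {0<..<1} t \<partial>lborel)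
    = ennreal (pi\<^sup>2 / 24)"
proof -
  define s where "s t = sqrt ((1 - t\<^sup>2) / 2)" for t :: real
  define k where "k t u = ennreal (s t / ((1 + u\<^sup>2 * ((1 - t\<^sup>2) / 2)) * (1 + t\<^sup>2))) *
      indicator {0<..<1} t * indicator {0..1} u" for t u :: real
  have k [measurable]: "case_prod k \<in> borel_measurable (borel \<Otimes>\<^sub>M borel)"
    unfolding k_def s_def split_beta' by measurable
  have s2: "(s t)\<^sup>2 = (1 - t\<^sup>2) / 2" and s0: "s t > 0" if "0 < t" "t < 1" for t
  proof -
    have "1 - t\<^sup>2 > 0" using that by (simp add: abs_square_less_1)
    then show "(s t)\<^sup>2 = (1 - t\<^sup>2) / 2" "s t > 0" by (simp_all add: s_def)
  qed
  have inner: "(\<integral>\<^sup>+u. k t u \<partial>lborel) = ennreal (arctan (s t) / (1 + t\<^sup>2)) * indicator {0<..<1} t" for t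
  proof (cases "0 < t \<and> t < 1")
    case True
    then have t: "0 < t" "t < 1" by auto
    have pos: "1 + t\<^sup>2 > 0" "1 + u\<^sup>2 * (s t)\<^sup>2 > 0" for u by (simp_all add: add_pos_nonneg)
    have "(\<integral>\<^sup>+u. k t u \<partial>lborel) =
        (\<integral>\<^sup>+u. ennreal (s t / ((1 + u\<^sup>2 * (s t)\<^sup>2) * (1 + t\<^sup>2))) * indicator {0..1} u \<partial>lborel)"
      using t by (simp add: k_def s2)
    also have "\<dots> = arctan (1 * s t) / (1 + t\<^sup>2) - arctan (0 * s t) / (1 + t\<^sup>2)"
    proof (rule nn_integral_FTC_Icc[where F = "\<lambda>u. arctan (u * s t) / (1 + t\<^sup>2)"])
      fix u :: real
      have "((\<lambda>u. arctan (u * s t)) has_real_derivative inverse (1 + (u * s t)\<^sup>2) * (1 * s t)) (at u)"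
        by (rule DERIV_chain2[OF DERIV_arctan]) (auto intro!: derivative_eq_intros)
      from DERIV_cdivide[OF this, of "1 + t\<^sup>2"]
      show "((\<lambda>u. arctan (u * s t) / (1 + t\<^sup>2)) has_real_derivative
          s t / ((1 + u\<^sup>2 * (s t)\<^sup>2) * (1 + t\<^sup>2))) (at u)"
        by (simp add: power_mult_distrib divide_inverse mult_ac)
      show "0 \<le> s t / ((1 + u\<^sup>2 * (s t)\<^sup>2) * (1 + t\<^sup>2))"
        using pos s0[OF t] by (simp add: less_imp_le)
    qed auto
    finally show ?thesis using t by simp
  qed (auto simp: k_def)
  have swapped: "(\<integral>\<^sup>+t. k t u \<partial>lborel) =
      ennreal (pi / 2 * (1 / (1 + u\<^sup>2) - 1 / ((1 + u\<^sup>2) * sqrt (2 + u\<^sup>2)))) * indicator {0..1} u" for u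
  proof (cases "u \<in> {0..1}")
    case True
    then have "(\<integral>\<^sup>+t. k t u \<partial>lborel) = (\<integral>\<^sup>+t. ennreal (sqrt ((1 - t\<^sup>2) / 2) /
        ((1 + u\<^sup>2 * ((1 - t\<^sup>2) / 2)) * (1 + t\<^sup>2))) * indicator {0<..<1} t \<partial>lborel)"
      by (simp add: k_def s_def)
    then show ?thesis
      using True nn_integral_Ahmed_inner[of u] by simp
  qed (simp add: k_def)
  have "(\<integral>\<^sup>+t. ennreal (arctan (s t) / (1 + t\<^sup>2)) * indicator {0<..<1} t \<partial>lborel) =
      (\<integral>\<^sup>+t. \<integral>\<^sup>+u. k t u \<partial>lborel \<partial>lborel)"
    by (simp add: inner)
  also have "\<dots> = (\<integral>\<^sup>+u. \<integral>\<^sup>+t. k t u \<partial>lborel \<partial>lborel)"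
    by (rule lborel_pair.Fubini'[symmetric]) (use k in measurable)
  also have "\<dots> = (\<integral>\<^sup>+u. ennreal (pi / 2 * (1 / (1 + u\<^sup>2) - 1 / ((1 + u\<^sup>2) * sqrt (2 + u\<^sup>2)))) *
      indicator {0..1} u \<partial>lborel)"
    by (simp only: swapped)
  \<comment> \<open>The derivative of arctan (u / sqrt (2 + u^2)) is 1 / ((1 + u^2) sqrt (2 + u^2));
    the limits give (pi/2)(pi/4 - pi/6) = pi^2/24.\<close>
  also have "\<dots> = pi / 2 * (arctan 1 - arctan (1 / sqrt (2 + 1\<^sup>2))) - pi / 2 * (arctan 0 - arctan (0 / sqrt (2 + 0\<^sup>2)))"
  proof (rule nn_integral_FTC_Icc[where F = "\<lambda>u. pi / 2 * (arctan u - arctan (u / sqrt (2 + u\<^sup>2)))"])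
    fix u :: real
    define c where "c = sqrt (2 + u\<^sup>2)"
    have c0: "c > 0" by (simp add: c_def add_pos_nonneg)
    have c2: "c\<^sup>2 = 2 + u\<^sup>2" by (simp add: c_def add_nonneg_nonneg)
    have c1: "c \<ge> 1" unfolding c_def by (simp add: real_le_rsqrt)
    have "((\<lambda>u. sqrt (2 + u\<^sup>2)) has_real_derivative u / c) (at u)"
      unfolding c_def using add_pos_nonneg[of 2 "u\<^sup>2"]
      by (auto intro!: derivative_eq_intros simp: inverse_eq_divide)
    then have D: "((\<lambda>u. u / sqrt (2 + u\<^sup>2)) has_real_derivative (1 * c - u * (u / c)) / (c * c)) (at u)"
      using c0 DERIV_divide[OF DERIV_ident, of "\<lambda>u. sqrt (2 + u\<^sup>2)" "u / c" u UNIV]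
      by (simp add: c_def[symmetric])
    have E: "inverse (1 + (u / c)\<^sup>2) * ((1 * c - u * (u / c)) / (c * c)) = 1 / ((1 + u\<^sup>2) * c)"
    proof -
      have p: "1 + u\<^sup>2 > 0" by (simp add: add_pos_nonneg)
      have "1 + (u / c)\<^sup>2 = (c\<^sup>2 + u\<^sup>2) / c\<^sup>2"
        using c0 by (simp add: field_simps)
      also have "\<dots> = 2 * (1 + u\<^sup>2) / c\<^sup>2" by (simp add: c2)
      finally have 1: "inverse (1 + (u / c)\<^sup>2) = c\<^sup>2 / (2 * (1 + u\<^sup>2))" by simp
      have "1 * c - u * (u / c) = (c\<^sup>2 - u\<^sup>2) / c"
        using c0 by (simp add: field_simps power2_eq_square)
      also have "\<dots> = 2 / c" by (simp add: c2)
      finally have 2: "1 * c - u * (u / c) = 2 / c" .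
      have "c\<^sup>2 / (2 * Q) * ((2 / c) / (c * c)) = 1 / (Q * c)" if "Q > 0" for Q
        using c0 that by (simp add: power2_eq_square)
      then show ?thesis
        unfolding 1 2 using p .
    qed
    have "((\<lambda>u. arctan (u / sqrt (2 + u\<^sup>2))) has_real_derivative 1 / ((1 + u\<^sup>2) * c)) (at u)"
      using DERIV_chain2[OF DERIV_arctan D] by (simp only: c_def[symmetric] E)
    then have "((\<lambda>u. pi / 2 * (arctan u - arctan (u / sqrt (2 + u\<^sup>2)))) has_real_derivative
        pi / 2 * (inverse (1 + u\<^sup>2) - 1 / ((1 + u\<^sup>2) * c))) (at u)"
      by (intro DERIV_cmult DERIV_diff DERIV_arctan)
    then show "((\<lambda>u. pi / 2 * (arctan u - arctan (u / sqrt (2 + u\<^sup>2)))) has_real_derivative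
        pi / 2 * (1 / (1 + u\<^sup>2) - 1 / ((1 + u\<^sup>2) * sqrt (2 + u\<^sup>2)))) (at u)"
      by (simp add: c_def inverse_eq_divide)
    have "1 / ((1 + u\<^sup>2) * c) \<le> 1 / (1 + u\<^sup>2)"
      using c1 c0 add_pos_nonneg[of 1 "u\<^sup>2"]
      by (intro divide_left_mono) (auto simp: mult_le_cancel_left1)
    then show "0 \<le> pi / 2 * (1 / (1 + u\<^sup>2) - 1 / ((1 + u\<^sup>2) * sqrt (2 + u\<^sup>2)))"
      by (simp add: c_def)
  qed auto
  also have "\<dots> = ennreal (pi\<^sup>2 / 24)"
    by (rule arg_cong[of _ _ ennreal])
      (simp add: arctan_one arctan_one_over_sqrt3 power2_eq_square field_simps)
  finally show ?thesis by (simp add: s_def)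
qed

text \<open>Put y = x t, so that \<open>x\<close> and the slope \<open>t\<close> run over a
  rectangle, and integrate over \<open>x\<close> first. The result (pi/4 - arctan (s t)) / (1 + t^2)
  integrates to pi^2/16 minus the Ahmed integral pi^2/24.\<close>

lemma nn_integral_right_triangle:
  "(\<integral>\<^sup>+x. \<integral>\<^sup>+y. (if 0 < x \<and> x < 1 / 2 \<and> 0 \<le> y \<and> y \<le> x then
      ennreal (1 / ((1 - x\<^sup>2 - y\<^sup>2) * sqrt (1 - 2 * x\<^sup>2 - 2 * y\<^sup>2))) else 0) \<partial>lborel \<partial>lborel)
    = ennreal (pi\<^sup>2 / 48)"
proof -
  define g where "g x y = (if 0 < x \<and> x < 1 / 2 \<and> 0 \<le> y \<and> y \<le> x then
      ennreal (1 / ((1 - x\<^sup>2 - y\<^sup>2) * sqrt (1 - 2 * x\<^sup>2 - 2 * y\<^sup>2))) else 0)" for x y :: real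
  define f where "f x t = x / ((1 - (1 + t\<^sup>2) * x\<^sup>2) * sqrt (1 - 2 * (1 + t\<^sup>2) * x\<^sup>2))" for x t :: real
  define k where "k x t = ennreal (f x t) * indicator {0<..<1/2} x * indicator {0..1} t" for x t
  define s where "s t = sqrt ((1 - t\<^sup>2) / 2)" for t :: real
  have [measurable]: "case_prod g \<in> borel_measurable (borel \<Otimes>\<^sub>M borel)"
    unfolding g_def split_beta' by measurable
  have k [measurable]: "case_prod k \<in> borel_measurable (borel \<Otimes>\<^sub>M borel)"
    unfolding k_def f_def split_beta' by measurable
  have polar: "(\<integral>\<^sup>+y. g x y \<partial>lborel) = (\<integral>\<^sup>+t. k x t \<partial>lborel)" for x
  proof (cases "0 < x \<and> x < 1 / 2")
    case True
    then have x: "0 < x" "x < 1 / 2" by auto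
    have [measurable]: "g x \<in> borel_measurable borel" by measurable
    have "(\<integral>\<^sup>+y. g x y \<partial>lborel) = ennreal \<bar>x\<bar> * (\<integral>\<^sup>+t. g x (0 + x * t) \<partial>lborel)"
      using x by (intro nn_integral_real_affine) auto
    also have "\<dots> = (\<integral>\<^sup>+t. ennreal \<bar>x\<bar> * g x (0 + x * t) \<partial>lborel)"
      by (intro nn_integral_cmult[symmetric]) measurable
    also have "\<dots> = (\<integral>\<^sup>+t. k x t \<partial>lborel)"
    proof (rule nn_integral_cong)
      fix t
      show "ennreal \<bar>x\<bar> * g x (0 + x * t) = k x t"
      proof (cases "0 \<le> t \<and> t \<le> 1")
        case True
        have e: "1 - x\<^sup>2 - (x * t)\<^sup>2 = 1 - (1 + t\<^sup>2) * x\<^sup>2" "1 - 2 * x\<^sup>2 - 2 * (x * t)\<^sup>2 = 1 - 2 * (1 + t\<^sup>2) * x\<^sup>2"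
          by (simp_all add: algebra_simps power_mult_distrib)
        have "g x (0 + x * t) = ennreal (1 / ((1 - (1 + t\<^sup>2) * x\<^sup>2) * sqrt (1 - 2 * (1 + t\<^sup>2) * x\<^sup>2)))"
          using True x by (simp add: g_def e)
        then show ?thesis
          using True x by (simp add: k_def f_def ennreal_mult'[symmetric])
      next
        case False
        then show ?thesis
          using x by (auto simp: g_def k_def zero_le_mult_iff)
      qed
    qed
    finally show ?thesis .
  qed (auto simp: g_def k_def)
  have radial: "(\<integral>\<^sup>+x. k x t \<partial>lborel) = ennreal ((pi / 4 - arctan (s t)) / (1 + t\<^sup>2))" if t: "0 < t" "t < 1" for t
  proof -
    define m where "m = 1 + t\<^sup>2"
    \<comment> \<open>\<open>m < 2\<close> because \<open>t < 1\<close>; for \<open>t = 1\<close>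
      the root below would vanish at the corner \<open>x = 1 / 2\<close>.\<close>
    have m: "1 < m" "m < 2" using t by (simp_all add: m_def abs_square_less_1)
    have pos: "1 - 2 * m * x\<^sup>2 > 0" "1 - m * x\<^sup>2 > 0" if "0 \<le> x" "x \<le> 1 / 2" for x
    proof -
      have "x\<^sup>2 \<le> (1 / 2)\<^sup>2" using that by (intro power_mono) auto
      then have "m * x\<^sup>2 \<le> m * (1 / 4)" using m by (intro mult_left_mono) (auto simp: power2_eq_square)
      then show *: "1 - 2 * m * x\<^sup>2 > 0" using m by linarith
      have "0 \<le> m * x\<^sup>2" using m by simp
      then show "1 - m * x\<^sup>2 > 0" using * by simp
    qed
    have "(\<integral>\<^sup>+x. k x t \<partial>lborel) =
        (\<integral>\<^sup>+x. ennreal (x / ((1 - m * x\<^sup>2) * sqrt (1 - 2 * m * x\<^sup>2))) * indicator {0<..<1/2} x \<partial>lborel)"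
      using t by (simp add: k_def f_def m_def)
    also have "\<dots> = ennreal (- (1 / m) * arctan (sqrt (1 - 2 * m * (1 / 2)\<^sup>2)) - (- (1 / m) * arctan (sqrt (1 - 2 * m * 0\<^sup>2))))"
    proof (rule nn_integral_FTC_Ioo[where F = "\<lambda>x. - (1 / m) * arctan (sqrt (1 - 2 * m * x\<^sup>2))"])
      fix x :: real assume "0 < x" "x < 1 / 2"
      then have x: "0 < x" "x \<le> 1 / 2" by auto
      define r where "r = sqrt (1 - 2 * m * x\<^sup>2)"
      have r0: "r > 0" and r2: "r\<^sup>2 = 1 - 2 * m * x\<^sup>2"
        using pos[of x] x by (simp_all add: r_def)
      have "((\<lambda>x. sqrt (1 - 2 * m * x\<^sup>2)) has_real_derivative - (2 * m * x) / r) (at x)"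
        unfolding r_def using pos(1)[of x] x
        by (auto intro!: derivative_eq_intros simp: inverse_eq_divide)
      from DERIV_cmult[OF DERIV_chain2[OF DERIV_arctan this], of "- (1 / m)"]
      have "((\<lambda>x. - (1 / m) * arctan (sqrt (1 - 2 * m * x\<^sup>2))) has_real_derivative
          - (1 / m) * (inverse (1 + r\<^sup>2) * (- (2 * m * x) / r))) (at x)"
        by (simp add: r_def)
      also have "- (1 / m) * (inverse (1 + r\<^sup>2) * (- (2 * m * x) / r)) = x / ((1 - m * x\<^sup>2) * r)"
      proof -
        have e: "1 + r\<^sup>2 = 2 * (1 - m * x\<^sup>2)" by (simp add: r2)
        have K: "- (1 / m) * (inverse (2 * K) * (- (2 * m * x) / r)) = x / (K * r)" if "K > 0" for K
          using that m r0 by (simp add: field_simps)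
        show ?thesis
          unfolding e using pos(2)[of x] x by (intro K) simp
      qed
      finally show "((\<lambda>x. - (1 / m) * arctan (sqrt (1 - 2 * m * x\<^sup>2))) has_real_derivative
          x / ((1 - m * x\<^sup>2) * sqrt (1 - 2 * m * x\<^sup>2))) (at x)"
        by (simp add: r_def)
      show "isCont (\<lambda>x. x / ((1 - m * x\<^sup>2) * sqrt (1 - 2 * m * x\<^sup>2))) x"
        using pos[of x] x by (intro continuous_intros) simp_all
      show "0 \<le> x / ((1 - m * x\<^sup>2) * sqrt (1 - 2 * m * x\<^sup>2))"
        using pos[of x] x by simp
    next
      show "((\<lambda>x. - (1 / m) * arctan (sqrt (1 - 2 * m * x\<^sup>2))) \<longlongrightarrow>
          - (1 / m) * arctan (sqrt (1 - 2 * m * 0\<^sup>2))) (at_right 0)"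
        by (intro tendsto_intros)
      show "((\<lambda>x. - (1 / m) * arctan (sqrt (1 - 2 * m * x\<^sup>2))) \<longlongrightarrow>
          - (1 / m) * arctan (sqrt (1 - 2 * m * (1 / 2)\<^sup>2))) (at_left (1 / 2))"
        by (intro tendsto_intros)
    qed auto
    also have "- (1 / m) * arctan (sqrt (1 - 2 * m * (1 / 2)\<^sup>2)) - (- (1 / m) * arctan (sqrt (1 - 2 * m * 0\<^sup>2))) =
        (pi / 4 - arctan (s t)) / (1 + t\<^sup>2)"
    proof -
      have "1 - 2 * m * (1 / 2)\<^sup>2 = (1 - t\<^sup>2) / 2"
        by (simp add: m_def power2_eq_square field_simps)
      then show ?thesis
        by (simp add: s_def m_def arctan_one diff_divide_distrib)
    qed
    finally show ?thesis .
  qed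
  have s1: "arctan (s t) \<le> pi / 4" "0 \<le> arctan (s t)" if "0 < t" "t < 1" for t
  proof -
    have "0 < 1 - t\<^sup>2" using that by (simp add: abs_square_less_1)
    then have "0 \<le> s t" by (simp add: s_def)
    moreover have "sqrt ((1 - a) / 2) \<le> 1" if "0 \<le> a" for a :: real
      using that by simp
    from this[OF zero_le_power2] have "s t \<le> 1"
      unfolding s_def .
    ultimately have "s t \<le> 1" "0 \<le> s t" by auto
    then show "arctan (s t) \<le> pi / 4" "0 \<le> arctan (s t)"
      using arctan_le_iff[of "s t" 1] by (simp_all add: arctan_one)
  qed
  let ?I = "\<integral>\<^sup>+x. \<integral>\<^sup>+y. g x y \<partial>lborel \<partial>lborel"
  have "?I = (\<integral>\<^sup>+x. \<integral>\<^sup>+t. k x t \<partial>lborel \<partial>lborel)"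
    by (simp only: polar)
  also have "\<dots> = (\<integral>\<^sup>+t. \<integral>\<^sup>+x. k x t \<partial>lborel \<partial>lborel)"
    by (rule lborel_pair.Fubini'[symmetric]) (use k in measurable)
  also have "\<dots> = (\<integral>\<^sup>+t. ennreal ((pi / 4 - arctan (s t)) / (1 + t\<^sup>2)) * indicator {0<..<1} t \<partial>lborel)"
  proof (rule nn_integral_cong_AE)
    \<comment> \<open>The slopes 0 and 1 form a null set: \<open>radial\<close> holds strictly
      between them, while \<open>k\<close> includes them.\<close>
    have "AE t in lborel. t \<noteq> 0 \<and> t \<noteq> (1 :: real)"
      using AE_lborel_singleton[of 0] AE_lborel_singleton[of 1] by eventually_elim auto
    then show "AE t in lborel. (\<integral>\<^sup>+x. k x t \<partial>lborel) =
        ennreal ((pi / 4 - arctan (s t)) / (1 + t\<^sup>2)) * indicator {0<..<1} t"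
    proof eventually_elim
      case (elim t)
      show ?case
      proof (cases "0 < t \<and> t < 1")
        case False
        then have "t \<notin> {0..1}" using elim by auto
        then show ?thesis using False by (auto simp: k_def)
      qed (use radial in simp)
    qed
  qed
  finally have I: "?I = (\<integral>\<^sup>+t. ennreal ((pi / 4 - arctan (s t)) / (1 + t\<^sup>2)) * indicator {0<..<1} t \<partial>lborel)" .
  \<comment> \<open>Adding the Ahmed integral to both sides avoids a difference of integrals in
    \<open>ennreal\<close>; the integrands add up to a multiple of 1 / (1 + t^2).\<close>
  have "?I + ennreal (pi\<^sup>2 / 24) =
      (\<integral>\<^sup>+t. ennreal ((pi / 4 - arctan (s t)) / (1 + t\<^sup>2)) * indicator {0<..<1} t +
        ennreal (arctan (s t) / (1 + t\<^sup>2)) * indicator {0<..<1} t \<partial>lborel)"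
    unfolding I nn_integral_Ahmed[symmetric] s_def by (rule nn_integral_add[symmetric]) measurable
  also have "\<dots> = (\<integral>\<^sup>+t. ennreal (pi / 4 * (1 / (1 + t\<^sup>2))) * indicator {0<..<1} t \<partial>lborel)"
  proof (rule nn_integral_cong)
    fix t
    have "ennreal ((pi / 4 - arctan (s t)) / (1 + t\<^sup>2)) + ennreal (arctan (s t) / (1 + t\<^sup>2)) =
        ennreal (pi / 4 * (1 / (1 + t\<^sup>2)))" if "0 < t" "t < 1"
    proof -
      have "ennreal ((pi / 4 - arctan (s t)) / (1 + t\<^sup>2)) + ennreal (arctan (s t) / (1 + t\<^sup>2)) =
          ennreal ((pi / 4 - arctan (s t)) / (1 + t\<^sup>2) + arctan (s t) / (1 + t\<^sup>2))"
        using s1[OF that] by (intro ennreal_plus[symmetric]) simp_all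
      then show ?thesis by (simp add: add_divide_distrib[symmetric])
    qed
    then show "ennreal ((pi / 4 - arctan (s t)) / (1 + t\<^sup>2)) * indicator {0<..<1} t +
        ennreal (arctan (s t) / (1 + t\<^sup>2)) * indicator {0<..<1} t =
        ennreal (pi / 4 * (1 / (1 + t\<^sup>2))) * indicator {0<..<1} t"
      by (cases "t \<in> {0<..<1}") simp_all
  qed
  also have "\<dots> = ennreal (pi / 4 * arctan 1 - pi / 4 * arctan 0)"
  proof (rule nn_integral_FTC_Ioo[where F = "\<lambda>t. pi / 4 * arctan t"])
    fix t :: real
    have p: "1 + t\<^sup>2 > 0" by (simp add: add_pos_nonneg)
    show "((\<lambda>t. pi / 4 * arctan t) has_real_derivative pi / 4 * (1 / (1 + t\<^sup>2))) (at t)"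
      using DERIV_cmult[OF DERIV_arctan, of "pi / 4" t] by (simp add: inverse_eq_divide)
    show "isCont (\<lambda>t. pi / 4 * (1 / (1 + t\<^sup>2))) t"
      using p by (intro continuous_intros) simp_all
    show "0 \<le> pi / 4 * (1 / (1 + t\<^sup>2))" using p by simp
  next
    show "((\<lambda>t. pi / 4 * arctan t) \<longlongrightarrow> pi / 4 * arctan 0) (at_right 0)"
      and "((\<lambda>t. pi / 4 * arctan t) \<longlongrightarrow> pi / 4 * arctan 1) (at_left 1)"
      by (intro tendsto_intros)+
  qed auto
  also have "\<dots> = ennreal (pi\<^sup>2 / 48) + ennreal (pi\<^sup>2 / 24)"
    by (simp add: arctan_one ennreal_plus[symmetric] power2_eq_square del: ennreal_plus)
  finally have "?I = ennreal (pi\<^sup>2 / 48)"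
    using ennreal_add_left_cancel[of "ennreal (pi\<^sup>2 / 24)" ?I "ennreal (pi\<^sup>2 / 48)"]
    by (simp add: add.commute)
  then show ?thesis by (simp add: g_def)
qed

section \<open>Volumes over a cusp in half space coordinates\<close>

context null_frame
begin

text \<open>Above height 1 each vertical line has measure 1/3, the integral of dt / t^4, so the
  volume is a third of the Euclidean volume of the cross-section \<open>D\<close>.\<close>

lemma emeasure_cusp:
  assumes S: "S \<in> sets borel" "S \<subseteq> hyp_space" and D [measurable]: "D \<in> sets borel"
    and mem: "\<And>x y z w. \<tau> (x, y, z, w) > 0 \<Longrightarrow>
      proj (pt (1, x, y, z, w)) \<in> S \<longleftrightarrow> (x, y, z) \<in> D \<and> 1 \<le> \<tau> (x, y, z, w)"
  shows "emeasure hyp_measure S = ennreal (1 / 3) *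
    (\<integral>\<^sup>+x. \<integral>\<^sup>+y. \<integral>\<^sup>+z. indicator D (x, y, z) \<partial>lborel \<partial>lborel \<partial>lborel)"
proof -
  define g where "g u = indicator D (fst u, fst (snd u), fst (snd (snd u))) *
    (ennreal ((1 / sqrt (\<tau> u)) ^ 5 / 2) * indicator {1..} (\<tau> u))" for u
  have [measurable]: "\<tau> \<in> borel_measurable (borel \<Otimes>\<^sub>M (borel \<Otimes>\<^sub>M (borel \<Otimes>\<^sub>M borel)))"
    unfolding \<tau>_def split_beta' by measurable
  have [measurable]: "D \<in> sets (borel \<Otimes>\<^sub>M (borel \<Otimes>\<^sub>M borel))"
    unfolding borel_prod by (rule D)
  have g: "g \<in> borel_measurable (borel \<Otimes>\<^sub>M (borel \<Otimes>\<^sub>M (borel \<Otimes>\<^sub>M borel)))"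
    unfolding g_def by measurable
  have "emeasure hyp_measure S = (\<integral>\<^sup>+u. g u \<partial>lborel)"
    unfolding hyp_measure_frame[OF S]
  proof (rule nn_integral_cong)
    fix u :: "real \<times> real \<times> real \<times> real"
    obtain x y z w where u: "u = (x, y, z, w)" by (metis prod.collapse)
    show "(if \<tau> u > 0 \<and> proj (pt (1, u)) \<in> S then ennreal ((1 / sqrt (\<tau> u)) ^ 5 / 2) else 0) = g u"
      unfolding u g_def using mem[of x y z w] by (auto simp: indicator_def)
  qed
  also have "\<dots> = (\<integral>\<^sup>+x. \<integral>\<^sup>+y. \<integral>\<^sup>+z. \<integral>\<^sup>+w. g (x, y, z, w) \<partial>lborel \<partial>lborel \<partial>lborel \<partial>lborel)"
    using g by (intro nn_integral_lborel_4) (simp add: borel_prod)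
  also have "\<dots> = (\<integral>\<^sup>+x. \<integral>\<^sup>+y. \<integral>\<^sup>+z. ennreal (1 / 3) * indicator D (x, y, z) \<partial>lborel \<partial>lborel \<partial>lborel)"
  proof (intro nn_integral_cong)
    fix x y z :: real
    define c where "c = x\<^sup>2 + y\<^sup>2 + z\<^sup>2"
    have \<tau>: "\<tau> (x, y, z, w) = w - c" for w by (simp add: \<tau>_def c_def)
    have "(\<integral>\<^sup>+w. g (x, y, z, w) \<partial>lborel) = indicator D (x, y, z) *
        (\<integral>\<^sup>+w. ennreal ((1 / sqrt (w - c)) ^ 5 / 2) * indicator {c + 1..} w \<partial>lborel)"
      unfolding g_def \<tau> by (subst nn_integral_cmult[symmetric])
        (auto intro!: nn_integral_cong simp: indicator_def algebra_simps)
    then show "(\<integral>\<^sup>+w. g (x, y, z, w) \<partial>lborel) = ennreal (1 / 3) * indicator D (x, y, z)"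
      using nn_integral_height[of c "c + 1"] by (simp add: mult.commute)
  qed
  also have "\<dots> = ennreal (1 / 3) * (\<integral>\<^sup>+x. \<integral>\<^sup>+y. \<integral>\<^sup>+z. indicator D (x, y, z) \<partial>lborel \<partial>lborel \<partial>lborel)"
    by (subst nn_integral_cmult, measurable)+
  finally show ?thesis .
qed

text \<open>\<open>1 \<le> w\<close> is the outside of the unit hemisphere. With A = 1 - x^2 - y^2
  the height integral gives (A - z^2)^(-3/2) / 3, and integrating over \<open>z\<close> gives a
  third of the integrand over the triangle.\<close>

lemma emeasure_prism_polytope:
  assumes S: "S \<in> sets borel" "S \<subseteq> hyp_space"
    and mem: "\<And>x y z w. \<tau> (x, y, z, w) > 0 \<Longrightarrow> proj (pt (1, x, y, z, w)) \<in> S \<longleftrightarrow>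
      0 \<le> y \<and> y \<le> x \<and> x \<le> 1 / 2 \<and> 0 \<le> z \<and> z \<le> 1 / sqrt 2 \<and> 1 \<le> w"
  shows "emeasure hyp_measure S = ennreal (pi\<^sup>2 / 144)"
proof -
  define Q where "Q u \<longleftrightarrow> 0 \<le> fst (snd u) \<and> fst (snd u) \<le> fst u \<and> fst u \<le> 1 / 2 \<and>
    0 \<le> fst (snd (snd u)) \<and> fst (snd (snd u)) \<le> 1 / sqrt 2 \<and> 1 \<le> snd (snd (snd u))"
    for u :: "real \<times> real \<times> real \<times> real"
  define g where "g u = (if \<tau> u > 0 \<and> Q u then ennreal ((1 / sqrt (\<tau> u)) ^ 5 / 2) else 0)" for u
  have [measurable]: "\<tau> \<in> borel_measurable (borel \<Otimes>\<^sub>M (borel \<Otimes>\<^sub>M (borel \<Otimes>\<^sub>M borel)))"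
    unfolding \<tau>_def split_beta' by measurable
  have g: "g \<in> borel_measurable (borel \<Otimes>\<^sub>M (borel \<Otimes>\<^sub>M (borel \<Otimes>\<^sub>M borel)))"
    unfolding g_def Q_def by measurable
  have "emeasure hyp_measure S = (\<integral>\<^sup>+u. g u \<partial>lborel)"
    unfolding hyp_measure_frame[OF S]
  proof (rule nn_integral_cong)
    fix u :: "real \<times> real \<times> real \<times> real"
    obtain x y z w where u: "u = (x, y, z, w)" by (metis prod.collapse)
    show "(if \<tau> u > 0 \<and> proj (pt (1, u)) \<in> S then ennreal ((1 / sqrt (\<tau> u)) ^ 5 / 2) else 0) = g u"
      unfolding u g_def Q_def using mem[of x y z w] by (auto simp del: pt.simps)
  qed
  also have "\<dots> = (\<integral>\<^sup>+x. \<integral>\<^sup>+y. \<integral>\<^sup>+z. \<integral>\<^sup>+w. g (x, y, z, w) \<partial>lborel \<partial>lborel \<partial>lborel \<partial>lborel)"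
    using g by (intro nn_integral_lborel_4) (simp add: borel_prod)
  also have "\<dots> = (\<integral>\<^sup>+x. ennreal (1 / 3) * (\<integral>\<^sup>+y. (if 0 < x \<and> x < 1 / 2 \<and> 0 \<le> y \<and> y \<le> x then
      ennreal (1 / ((1 - x\<^sup>2 - y\<^sup>2) * sqrt (1 - 2 * x\<^sup>2 - 2 * y\<^sup>2))) else 0) \<partial>lborel) \<partial>lborel)"
  proof (rule nn_integral_cong_AE)
    \<comment> \<open>The bound \<open>A > 1 / 2\<close> below fails at x = y = 1/2, where the
      hemisphere comes down to height 0 at z = 1 / sqrt 2; the triangle integral leaves out
      \<open>x = 0\<close>.\<close>
    have "AE x in lborel. x \<noteq> 0 \<and> x \<noteq> (1 / 2 :: real)"
      using AE_lborel_singleton[of 0] AE_lborel_singleton[of "1 / 2"] by eventually_elim auto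
    then show "AE x in lborel. (\<integral>\<^sup>+y. \<integral>\<^sup>+z. \<integral>\<^sup>+w. g (x, y, z, w) \<partial>lborel \<partial>lborel \<partial>lborel) =
      ennreal (1 / 3) * (\<integral>\<^sup>+y. (if 0 < x \<and> x < 1 / 2 \<and> 0 \<le> y \<and> y \<le> x then
        ennreal (1 / ((1 - x\<^sup>2 - y\<^sup>2) * sqrt (1 - 2 * x\<^sup>2 - 2 * y\<^sup>2))) else 0) \<partial>lborel)"
    proof eventually_elim
      case (elim x)
      have "(\<integral>\<^sup>+z. \<integral>\<^sup>+w. g (x, y, z, w) \<partial>lborel \<partial>lborel) =
        ennreal (1 / 3) * (if 0 < x \<and> x < 1 / 2 \<and> 0 \<le> y \<and> y \<le> x then
          ennreal (1 / ((1 - x\<^sup>2 - y\<^sup>2) * sqrt (1 - 2 * x\<^sup>2 - 2 * y\<^sup>2))) else 0)" for y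
      proof (cases "0 < x \<and> x < 1 / 2 \<and> 0 \<le> y \<and> y \<le> x")
        case True
        define A where "A = 1 - x\<^sup>2 - y\<^sup>2"
        have "x\<^sup>2 < (1 / 2)\<^sup>2" using True by (intro power_strict_mono) auto
        moreover have "y\<^sup>2 \<le> x\<^sup>2" using True by (intro power_mono) auto
        ultimately have A: "A > 1 / 2" by (simp add: A_def power2_eq_square)
        have z2: "z\<^sup>2 \<le> 1 / 2" if "0 \<le> z" "z \<le> 1 / sqrt 2" for z :: real
          using power_mono[OF that(2,1), of 2] by (simp add: power_divide)
        have "(\<integral>\<^sup>+w. g (x, y, z, w) \<partial>lborel) =
            ennreal ((1 / sqrt (A - z\<^sup>2)) ^ 3 / 3) * indicator {0..1 / sqrt 2} z" for z
        proof (cases "0 \<le> z \<and> z \<le> 1 / sqrt 2")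
          case z: True
          define c where "c = x\<^sup>2 + y\<^sup>2 + z\<^sup>2"
          have c: "c < 1" using A z2[of z] z by (simp add: c_def A_def)
          have \<tau>: "\<tau> (x, y, z, w) = w - c" for w by (simp add: \<tau>_def c_def)
          have "(\<integral>\<^sup>+w. g (x, y, z, w) \<partial>lborel) =
              (\<integral>\<^sup>+w. ennreal ((1 / sqrt (w - c)) ^ 5 / 2) * indicator {1..} w \<partial>lborel)"
            unfolding g_def \<tau> Q_def using True z c by (intro nn_integral_cong) auto
          also have "\<dots> = ennreal ((1 / sqrt (1 - c)) ^ 3 / 3)"
            by (rule nn_integral_height[OF c])
          also have "1 - c = A - z\<^sup>2" by (simp add: A_def c_def)
          finally show ?thesis using z by simp
        qed (auto simp: g_def Q_def)
        then have "(\<integral>\<^sup>+z. \<integral>\<^sup>+w. g (x, y, z, w) \<partial>lborel \<partial>lborel) =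
            (\<integral>\<^sup>+z. ennreal ((1 / sqrt (A - z\<^sup>2)) ^ 3 / 3) * indicator {0..1 / sqrt 2} z \<partial>lborel)"
          by simp
        also have "\<dots> = 1 / 3 * ((1 / sqrt 2) / (A * sqrt (A - (1 / sqrt 2)\<^sup>2))) - 1 / 3 * (0 / (A * sqrt (A - 0\<^sup>2)))"
        proof (rule nn_integral_FTC_Icc[where F = "\<lambda>z. 1 / 3 * (z / (A * sqrt (A - z\<^sup>2)))"])
          fix z assume "z \<in> {0..1 / sqrt 2}"
          then have Az: "A - z\<^sup>2 > 0" using z2[of z] A by auto
          define r where "r = sqrt (A - z\<^sup>2)"
          have r0: "r > 0" and r2: "A = r\<^sup>2 + z\<^sup>2" using Az by (simp_all add: r_def)
          have "((\<lambda>z. sqrt (A - z\<^sup>2)) has_real_derivative - z / r) (at z)"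
            unfolding r_def using Az by (auto intro!: derivative_eq_intros simp: inverse_eq_divide)
          then have "((\<lambda>z. z / (A * sqrt (A - z\<^sup>2))) has_real_derivative
              (1 * (A * r) - z * (A * (- z / r))) / (A * r * (A * r))) (at z)"
            using r0 A DERIV_divide[OF DERIV_ident DERIV_cmult, of "\<lambda>z. sqrt (A - z\<^sup>2)" "- z / r" z UNIV A]
            by (simp add: r_def[symmetric])
          moreover have "(1 * (A * r) - z * (A * (- z / r))) / (A * r * (A * r)) = (1 / r) ^ 3"
          proof -
            have "1 * (A * r) - z * (A * (- z / r)) = A * (r\<^sup>2 + z\<^sup>2) / r"
              using r0 by (simp add: field_simps power2_eq_square)
            also have "\<dots> = A * A / r" by (simp only: r2[symmetric])
            finally show ?thesis
              using r0 A by (simp add: power3_eq_cube)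
          qed
          ultimately have "((\<lambda>z. z / (A * sqrt (A - z\<^sup>2))) has_real_derivative (1 / r) ^ 3) (at z)"
            by simp
          from DERIV_cmult[OF this, of "1 / 3"]
          show "((\<lambda>z. 1 / 3 * (z / (A * sqrt (A - z\<^sup>2)))) has_real_derivative
              (1 / sqrt (A - z\<^sup>2)) ^ 3 / 3) (at z)"
            by (simp add: r_def)
          show "0 \<le> (1 / sqrt (A - z\<^sup>2)) ^ 3 / 3" using Az by simp
        qed auto
        also have "\<dots> = ennreal (1 / 3 * (1 / (A * sqrt (2 * A - 1))))"
        proof (rule arg_cong[of _ _ ennreal])
          have "sqrt 2 * sqrt (A - 1 / 2) = sqrt (2 * A - 1)"
            by (simp add: real_sqrt_mult[symmetric] algebra_simps)
          then have "(1 / sqrt 2) / (A * sqrt (A - (1 / sqrt 2)\<^sup>2)) = 1 / (A * sqrt (2 * A - 1))"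
            by (simp add: power_divide mult.left_commute)
          then show "1 / 3 * ((1 / sqrt 2) / (A * sqrt (A - (1 / sqrt 2)\<^sup>2))) - 1 / 3 * (0 / (A * sqrt (A - 0\<^sup>2))) =
              1 / 3 * (1 / (A * sqrt (2 * A - 1)))"
            by simp
        qed
        also have "2 * A - 1 = 1 - 2 * x\<^sup>2 - 2 * y\<^sup>2" by (simp add: A_def)
        also have "ennreal (1 / 3 * (1 / (A * sqrt (1 - 2 * x\<^sup>2 - 2 * y\<^sup>2)))) =
            ennreal (1 / 3) * ennreal (1 / (A * sqrt (1 - 2 * x\<^sup>2 - 2 * y\<^sup>2)))"
          by (rule ennreal_mult') simp
        finally show ?thesis
          using True by (simp add: A_def)
      next
        case False
        then have "\<not> Q (x, y, z, w)" for z w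
          using elim by (auto simp: Q_def)
        then show ?thesis using False by (auto simp: g_def)
      qed
      then show ?case
        by (simp add: nn_integral_cmult)
    qed
  qed
  also have "\<dots> = ennreal (1 / 3) * ennreal (pi\<^sup>2 / 48)"
    unfolding nn_integral_right_triangle[symmetric] by (rule nn_integral_cmult) measurable
  also have "\<dots> = ennreal (pi\<^sup>2 / 144)"
    by (subst ennreal_mult'[symmetric]) auto
  finally show ?thesis .
qed

end

lemma nn_integral_prism:
  fixes c :: real
  assumes "c \<ge> 0"
  shows "(\<integral>\<^sup>+x. \<integral>\<^sup>+y. \<integral>\<^sup>+z. indicator {(x :: real, y :: real, z :: real). 0 \<le> y \<and> y \<le> x \<and> x \<le> 1 / 2 \<and> 0 \<le> z \<and> z \<le> c} (x, y, z)
    \<partial>lborel \<partial>lborel \<partial>lborel) = ennreal (c / 8)"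
proof -
  have "(\<integral>\<^sup>+z. indicator {(x :: real, y :: real, z :: real). 0 \<le> y \<and> y \<le> x \<and> x \<le> 1 / 2 \<and> 0 \<le> z \<and> z \<le> c} (x, y, z) \<partial>lborel) =
      indicator {0..x} y * indicator {0..1 / 2} x * ennreal c" for x y :: real
  proof -
    have "(\<integral>\<^sup>+z. indicator {(x :: real, y :: real, z :: real). 0 \<le> y \<and> y \<le> x \<and> x \<le> 1 / 2 \<and> 0 \<le> z \<and> z \<le> c} (x, y, z) \<partial>lborel) =
        (\<integral>\<^sup>+z. (indicator {0..x} y * indicator {0..1 / 2} x) * indicator {0..c} z \<partial>lborel)"
      by (intro nn_integral_cong) (auto simp: indicator_def)
    also have "\<dots> = (indicator {0..x} y * indicator {0..1 / 2} x) * ennreal c"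
      using assms by (subst nn_integral_cmult) auto
    finally show ?thesis .
  qed
  moreover have "(\<integral>\<^sup>+y. indicator {0..x} y * indicator {0..1 / 2} x * ennreal c \<partial>lborel) =
      ennreal (x * c) * indicator {0..1 / 2} x" for x :: real
  proof -
    have "(\<integral>\<^sup>+y. indicator {0..x} y * indicator {0..1 / 2} x * ennreal c \<partial>lborel) =
        (\<integral>\<^sup>+y. (indicator {0..1 / 2} x * ennreal c) * indicator {0..x} y \<partial>lborel)"
      by (intro nn_integral_cong) (simp add: mult_ac)
    also have "\<dots> = (indicator {0..1 / 2} x * ennreal c) * emeasure lborel {0..x}"
      by (subst nn_integral_cmult) auto
    also have "\<dots> = ennreal (x * c) * indicator {0..1 / 2} x"
      using assms by (cases "x \<in> {0..1 / 2}") (auto simp: ennreal_mult' mult.commute)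
    finally show ?thesis .
  qed
  moreover have "(\<integral>\<^sup>+x. ennreal (x * c) * indicator {0..1 / 2} x \<partial>lborel) = (1 / 2)\<^sup>2 / 2 * c - 0\<^sup>2 / 2 * c"
    using assms by (intro nn_integral_FTC_Icc) (auto intro!: derivative_eq_intros)
  ultimately show ?thesis
    by (simp add: power2_eq_square)
qed

lemma nn_integral_orthoscheme:
  fixes c :: real
  assumes "c \<ge> 0"
  shows "(\<integral>\<^sup>+x. \<integral>\<^sup>+y. \<integral>\<^sup>+z. indicator {(x, y, z). 0 \<le> z \<and> z \<le> y \<and> y \<le> x \<and> x \<le> c} (x, y, z)
    \<partial>lborel \<partial>lborel \<partial>lborel) = ennreal (c ^ 3 / 6)"
proof -
  have "(\<integral>\<^sup>+z. indicator {(x, y, z). 0 \<le> z \<and> z \<le> y \<and> y \<le> x \<and> x \<le> c} (x, y, z) \<partial>lborel) =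
      indicator {0..c} x * (ennreal y * indicator {0..x} y)" for x y :: real
  proof -
    have "(\<integral>\<^sup>+z. indicator {(x, y, z). 0 \<le> z \<and> z \<le> y \<and> y \<le> x \<and> x \<le> c} (x, y, z) \<partial>lborel) =
        (\<integral>\<^sup>+z. (indicator {0..c} x * indicator {0..x} y) * indicator {0..y} z \<partial>lborel)"
      by (intro nn_integral_cong) (auto simp: indicator_def)
    also have "\<dots> = (indicator {0..c} x * indicator {0..x} y) * emeasure lborel {0..y}"
      by (subst nn_integral_cmult) auto
    also have "\<dots> = indicator {0..c} x * (ennreal y * indicator {0..x} y)"
      by (auto simp: indicator_def)
    finally show ?thesis .
  qed
  moreover have "(\<integral>\<^sup>+y. indicator {0..c} x * (ennreal y * indicator {0..x} y) \<partial>lborel) =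
      ennreal (x\<^sup>2 / 2) * indicator {0..c} x" for x :: real
  proof (cases "x \<in> {0..c}")
    case True
    then have "(\<integral>\<^sup>+y. ennreal y * indicator {0..x} y \<partial>lborel) = x\<^sup>2 / 2 - 0\<^sup>2 / 2"
      by (intro nn_integral_FTC_Icc) (auto intro!: derivative_eq_intros)
    then show ?thesis using True by simp
  qed simp
  moreover have "(\<integral>\<^sup>+x. ennreal (x\<^sup>2 / 2) * indicator {0..c} x \<partial>lborel) = c ^ 3 / 6 - 0 ^ 3 / 6"
    using assms by (intro nn_integral_FTC_Icc) (auto intro!: derivative_eq_intros simp: power2_eq_square)
  ultimately show ?thesis
    by simp
qed

section \<open>The truncated orthoscheme\<close>

lemma proj_mem_halfspace: "fst X > 0 \<Longrightarrow> proj X \<in> halfspace c \<longleftrightarrow> lorentz X c \<le> 0"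
  by (simp add: halfspace_def lift_proj divide_le_0_iff)

lemma proj_mem_hyp_space: "fst X > 0 \<Longrightarrow> proj X \<in> hyp_space \<longleftrightarrow> lorentz X X < 0"
  by (simp add: lift_timelike_iff[symmetric] lift_proj divide_less_0_iff zero_less_mult_iff)

lemma proj_mem_horo:
  assumes "fst X > 0"
  shows "proj X \<in> horo v \<longleftrightarrow> lorentz X X < 0 \<and> - lorentz X v \<le> sqrt (- lorentz X X)"
proof -
  have "- lorentz (lift (proj X)) (lift (proj X)) = (- lorentz X X) / (fst X)\<^sup>2"
    using assms by (simp add: lift_proj power2_eq_square)
  then have "sqrt (- lorentz (lift (proj X)) (lift (proj X))) = sqrt (- lorentz X X) / fst X"
    using assms by (simp only: real_sqrt_divide real_sqrt_abs abs_of_pos)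
  moreover have "- lorentz (lift (proj X)) v = (- lorentz X v) / fst X"
    using assms by (simp add: lift_proj)
  moreover have "(- lorentz X v) / fst X \<le> sqrt (- lorentz X X) / fst X \<longleftrightarrow> - lorentz X v \<le> sqrt (- lorentz X X)"
    unfolding divide_le_cancel using assms by simp
  ultimately show ?thesis
    using assms by (simp only: horo_def mem_Collect_eq proj_mem_hyp_space)
qed

text \<open>Doubling \<open>p\<close> turns the constant product -1/2 of \<open>pt (1, u)\<close>
  with \<open>p\<close> into -1, so that the horosphere is the horizontal plane at height 1.\<close>

lemma (in null_frame) proj_pt_mem:
  assumes "\<tau> u > 0"
  shows "proj (pt (1, u)) \<in> halfspace c \<longleftrightarrow> lorentz (pt (1, u)) c \<le> 0"
    "proj (pt (1, u)) \<in> hyp_space"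
    "proj (pt (1, u)) \<in> horo (2 *\<^sub>R p) \<longleftrightarrow> 1 \<le> \<tau> u"
proof -
  have f: "fst (pt (1, u)) > 0" by (rule pt_future_iff[OF assms])
  have "lorentz (pt (1, u)) p = - 1 / 2"
    using pt_lorentz(1)[of 1] by (cases u) (simp del: pt.simps)
  then show "proj (pt (1, u)) \<in> horo (2 *\<^sub>R p) \<longleftrightarrow> 1 \<le> \<tau> u"
    using assms pt_self_1[of u] by (simp add: proj_mem_horo[OF f])
  show "proj (pt (1, u)) \<in> halfspace c \<longleftrightarrow> lorentz (pt (1, u)) c \<le> 0"
    by (rule proj_mem_halfspace[OF f])
  show "proj (pt (1, u)) \<in> hyp_space"
    using assms pt_self_1[of u] by (simp add: proj_mem_hyp_space[OF f])
qed

lemma closed_halfspace: "closed (halfspace c)"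
  unfolding halfspace_def lorentz_def lift_def
  by (intro closed_Collect_le continuous_intros)

lemma hyp_space_borel: "(hyp_space :: (real^'n) set) \<in> sets borel"
  unfolding hyp_space_def by (intro borel_open open_Collect_less continuous_intros)

lemma horo_borel: "horo v \<in> sets borel"
proof -
  have "horo v = hyp_space \<inter> {x. - lorentz (lift x) v \<le> sqrt (- lorentz (lift x) (lift x))}"
    by (auto simp: horo_def)
  also have "closed {x. - lorentz (lift x) v \<le> sqrt (- lorentz (lift x) (lift x))}"
    unfolding lift_def lorentz_def by (intro closed_Collect_le continuous_intros)
  then have "hyp_space \<inter> {x. - lorentz (lift x) v \<le> sqrt (- lorentz (lift x) (lift x))} \<in> sets borel"
    using hyp_space_borel by (intro sets.Int) (auto intro: borel_closed)
  finally show ?thesis .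
qed

lemma hyp_measure_Int_hyp_space:
  fixes S :: "(real^'n) set"
  assumes S: "S \<in> sets borel"
  shows "emeasure hyp_measure S = emeasure hyp_measure (S \<inter> hyp_space)"
proof -
  let ?f = "\<lambda>x. if x \<in> hyp_space then ennreal (1 / sqrt (1 - (norm x)\<^sup>2) ^ (CARD('n) + 1)) else 0"
  note [measurable] = hyp_space_borel S
  show ?thesis
    unfolding hyp_measure_def
    by (subst (1 2) emeasure_density) (measurable, auto intro!: nn_integral_cong simp: indicator_def)
qed

locale coxeter_44340 =
  fixes b :: "nat \<Rightarrow> real \<times> (real^4)"
  assumes normals: "orthoscheme_normals [4, 4, 3, 4] b"
begin

lemma b_self: "i \<le> 5 \<Longrightarrow> lorentz (b i) (b i) = 1"
  using normals by (simp add: orthoscheme_normals_def)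

lemma b_gram:
  "lorentz (b 0) (b 0) = 1" "lorentz (b 1) (b 1) = 1" "lorentz (b 2) (b 2) = 1"
  "lorentz (b 3) (b 3) = 1" "lorentz (b 4) (b 4) = 1" "lorentz (b 5) (b 5) = 1"
  "lorentz (b 0) (b 1) = - sqrt 2 / 2" "lorentz (b 1) (b 2) = - sqrt 2 / 2"
  "lorentz (b 2) (b 3) = - 1 / 2" "lorentz (b 3) (b 4) = - sqrt 2 / 2" "lorentz (b 4) (b 5) = - 1"
  "lorentz (b 0) (b 2) = 0" "lorentz (b 0) (b 3) = 0" "lorentz (b 0) (b 4) = 0" "lorentz (b 0) (b 5) = 0"
  "lorentz (b 1) (b 3) = 0" "lorentz (b 1) (b 4) = 0" "lorentz (b 1) (b 5) = 0"
  "lorentz (b 2) (b 4) = 0" "lorentz (b 2) (b 5) = 0" "lorentz (b 3) (b 5) = 0"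
proof -
  have far: "lorentz (b i) (b j) = 0" if "i + 2 \<le> j" "j \<le> 5" for i j
    using normals that by (simp add: orthoscheme_normals_def)
  have near: "lorentz (b (i - 1)) (b i) = - cos (pi / real ([4, 4, 3, 4] ! (i - 1)))" if "1 \<le> i" "i \<le> 4" for i
    using normals that by (simp add: orthoscheme_normals_def)
  show "lorentz (b 0) (b 0) = 1" "lorentz (b 1) (b 1) = 1" "lorentz (b 2) (b 2) = 1"
    "lorentz (b 3) (b 3) = 1" "lorentz (b 4) (b 4) = 1" "lorentz (b 5) (b 5) = 1"
    by (simp_all add: b_self)
  show "lorentz (b 0) (b 1) = - sqrt 2 / 2" "lorentz (b 1) (b 2) = - sqrt 2 / 2"
    "lorentz (b 2) (b 3) = - 1 / 2" "lorentz (b 3) (b 4) = - sqrt 2 / 2"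
    using near[of 1] near[of 2] near[of 3] near[of 4]
    by (simp_all add: cos_45 cos_60 numeral_eq_Suc)
  show "lorentz (b 4) (b 5) = - 1"
    using normals by (simp add: orthoscheme_normals_def)
qed (use normals in \<open>simp_all add: orthoscheme_normals_def\<close>)

lemma b_gram_sym:
  "lorentz (b 1) (b 0) = - sqrt 2 / 2" "lorentz (b 2) (b 0) = 0" "lorentz (b 3) (b 0) = 0"
  "lorentz (b 4) (b 0) = 0" "lorentz (b 5) (b 0) = 0" "lorentz (b 2) (b 1) = - sqrt 2 / 2"
  "lorentz (b 3) (b 1) = 0" "lorentz (b 4) (b 1) = 0" "lorentz (b 5) (b 1) = 0"
  "lorentz (b 3) (b 2) = - 1 / 2" "lorentz (b 4) (b 2) = 0" "lorentz (b 5) (b 2) = 0"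
  "lorentz (b 4) (b 3) = - sqrt 2 / 2" "lorentz (b 5) (b 3) = 0" "lorentz (b 5) (b 4) = - 1"
  using b_gram by (simp_all add: lorentz_commute)

lemmas b_gram' = b_gram[unfolded One_nat_def] b_gram_sym[unfolded One_nat_def]

text \<open>
  The vector \<open>p\<close> lies over the ideal vertex $A_3$. In the half space model with \<open>p\<close> at infinity, $H^3$
  is the unit hemisphere around the origin and the other $H^i$ are vertical, with
  \<open>0 \<le> y \<le> x \<le> 1/2\<close> for $H^0, H^1, H^2$ and \<open>0 \<le> z \<le> 1 / sqrt 2\<close> for $H^5, H^4$.
\<close>

definition p where "p = b 0 + sqrt 2 *\<^sub>R b 1 + b 2"
definition q where "q = b 3 + p"
definition e1 where "e1 = - b 0 - sqrt 2 *\<^sub>R b 1"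
definition e2 where "e2 = - b 0"
definition e3 where "e3 = b 4 - sqrt 2 *\<^sub>R p"

text \<open>
  The vector \<open>a\<close> lies over $A_0$. With \<open>a\<close> at infinity, $H^0$ is the unit hemisphere around the origin,
  and $H^1, \dots, H^4$ bound the Euclidean orthoscheme \<open>0 \<le> z \<le> y \<le> x \<le> 1 / sqrt 2\<close>.
\<close>

definition a where "a = (sqrt 2 / 2) *\<^sub>R b 1 + b 2 + b 3 + (sqrt 2 / 2) *\<^sub>R b 4"
definition f3 where "f3 = - b 4"
definition f2 where "f2 = f3 - sqrt 2 *\<^sub>R b 3"
definition f1 where "f1 = f2 - sqrt 2 *\<^sub>R b 2"

text \<open>All four are nonnegative combinations of normals and so have negative product with the
  interior point supplied by the last clause of \<open>orthoscheme_normals\<close>; this decides in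
  which cone they lie.\<close>

lemma p_future: "lorentz p p = 0" "fst p > 0"
  and q_future: "lorentz q q = 0" "fst q > 0"
  and a_future: "lorentz a a = 0" "fst a > 0"
  and b0_a_future: "lorentz (b 0 + a) (b 0 + a) = 0" "fst (b 0 + a) > 0"
proof -
  show pp: "lorentz p p = 0" and qq: "lorentz q q = 0" and aa: "lorentz a a = 0"
    and ba: "lorentz (b 0 + a) (b 0 + a) = 0"
    by (simp_all add: p_def q_def a_def b_gram' algebra_simps)
  obtain x where x: "x \<in> hyp_space" and neg: "\<And>i. i \<le> 5 \<Longrightarrow> lorentz (lift x) (b i) < 0"
    using normals by (auto simp: orthoscheme_normals_def)
  have fut: "fst v > 0" if "lorentz v v = 0" "lorentz (lift x) v < 0" for v
    using causal_future_transfer[of "lift x" v] x that lift_timelike_iff[of x] by simp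
  have n: "lorentz (lift x) (b 0) < 0" "sqrt 2 * lorentz (lift x) (b 1) < 0" "lorentz (lift x) (b 2) < 0"
    "lorentz (lift x) (b 3) < 0" "sqrt 2 * lorentz (lift x) (b 4) < 0"
    using neg[of 0] neg[of 1] neg[of 2] neg[of 3] neg[of 4] by (simp_all add: mult_pos_neg)
  show "fst p > 0" "fst q > 0" "fst a > 0" "fst (b 0 + a) > 0"
    using n by (intro fut pp qq aa ba; simp add: p_def q_def a_def)+
qed

text \<open>The second null vector of this frame and of the next is the mirror image of the first in
  the wall that becomes the unit hemisphere: \<open>reflection (b 3) p = q\<close> and
  \<open>reflection (b 0) a = b 0 + a\<close>.\<close>

sublocale F: null_frame p q e1 e2 e3
  using p_future q_future
  by unfold_locales
    (simp_all add: p_def q_def e1_def e2_def e3_def b_gram' algebra_simps)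

sublocale G: null_frame a "b 0 + a" f1 f2 f3
  using a_future b0_a_future
  by unfold_locales
    (simp_all add: a_def f1_def f2_def f3_def b_gram' algebra_simps)

end

section \<open>The polytope and its ideal vertices in half space coordinates\<close>

context coxeter_44340
begin

lemma b_frame:
  "b 0 = - e2" "b 1 = (sqrt 2 / 2) *\<^sub>R (e2 - e1)" "b 2 = e1 + p" "b 3 = q - p"
  "b 4 = e3 + sqrt 2 *\<^sub>R p" "b 5 = - e3"
proof -
  show "b 0 = - e2" "b 2 = e1 + p" "b 3 = q - p" "b 4 = e3 + sqrt 2 *\<^sub>R p"
    by (simp_all add: e1_def e2_def e3_def p_def q_def)
  show "b 1 = (sqrt 2 / 2) *\<^sub>R (e2 - e1)"
    by (simp add: e1_def e2_def)
  \<comment> \<open>Six normals live in dimension five: \<open>b 5\<close> is determined by its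
    products with the other five.\<close>
  have "b 5 + e3 = 0"
    by (rule F.orthogonal_frame_zero)
      (simp_all add: p_def q_def e1_def e2_def e3_def b_gram' algebra_simps)
  then show "b 5 = - e3" by (simp add: eq_neg_iff_add_eq_0)
qed

lemma lorentz_F_pt:
  "lorentz (F.pt (s, x, y, z, w)) (b 0) = - y"
  "lorentz (F.pt (s, x, y, z, w)) (b 1) = sqrt 2 / 2 * (y - x)"
  "lorentz (F.pt (s, x, y, z, w)) (b 2) = x - s / 2"
  "lorentz (F.pt (s, x, y, z, w)) (b 3) = (s - w) / 2"
  "lorentz (F.pt (s, x, y, z, w)) (b 4) = z - sqrt 2 * s / 2"
  "lorentz (F.pt (s, x, y, z, w)) (b 5) = - z"
  unfolding b_frame lorentz_bilinear F.pt_lorentz by (simp_all add: diff_divide_distrib)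

lemma b_cusp_frame:
  "b 1 = f1 + sqrt 2 *\<^sub>R a" "b 2 = (sqrt 2 / 2) *\<^sub>R (f2 - f1)"
  "b 3 = (sqrt 2 / 2) *\<^sub>R (f3 - f2)" "b 4 = - f3"
  by (simp_all add: f1_def f2_def f3_def a_def algebra_simps)

lemma lorentz_G_pt:
  "lorentz (G.pt (s, x, y, z, w)) (b 1) = x - sqrt 2 * s / 2"
  "lorentz (G.pt (s, x, y, z, w)) (b 2) = sqrt 2 / 2 * (y - x)"
  "lorentz (G.pt (s, x, y, z, w)) (b 3) = sqrt 2 / 2 * (z - y)"
  "lorentz (G.pt (s, x, y, z, w)) (b 4) = - z"
  unfolding b_cusp_frame lorentz_bilinear G.pt_lorentz by simp_all

text \<open>The coordinates are the solution with \<open>s = 1\<close> of the equations of H^1, ...,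
  H^4: y = x, x = s/2, w = s, z = sqrt 2 s/2.\<close>

lemma a_eq_pt: "a = F.pt (1, 1 / 2, 1 / 2, sqrt 2 / 2, 1)"
proof -
  have "a - F.pt (1, 1 / 2, 1 / 2, sqrt 2 / 2, 1) = 0"
    by (rule F.orthogonal_frame_zero; unfold lorentz_bilinear F.pt_lorentz)
      (simp_all add: a_def p_def q_def e1_def e2_def e3_def b_gram' algebra_simps)
  then show ?thesis by simp
qed

lemma p_eq_pt: "p = F.pt (0, 0, 0, 0, 1)"
  by simp

lemma pt_scaleR: "c *\<^sub>R F.pt (s, x, y, z, w) = F.pt (c * s, c * x, c * y, c * z, c * w)"
  by (simp add: algebra_simps)

lemma atMost_5: "{..5::nat} = {0, 1, 2, 3, 4, 5}"
  by (auto simp: atMost_Suc numeral_eq_Suc)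

lemma fund_domain_iff:
  "x \<in> fund_domain b \<longleftrightarrow> (\<forall>i\<in>{0, 1, 2, 3, 4, 5}. x \<in> halfspace (b i))"
  by (simp add: fund_domain_def atMost_5)

lemma mult_sqrt2_le_0_iff: "sqrt 2 / 2 * t \<le> 0 \<longleftrightarrow> t \<le> 0"
  by (simp add: mult_le_0_iff)

lemma fund_domain_coords:
  assumes "lift v = F.pt (s, x, y, z, w)"
  shows "v \<in> fund_domain b \<longleftrightarrow>
    0 \<le> y \<and> y \<le> x \<and> x \<le> s / 2 \<and> 0 \<le> z \<and> z \<le> sqrt 2 * s / 2 \<and> s \<le> w"
  unfolding fund_domain_iff halfspace_def mem_Collect_eq assms ball_simps lorentz_F_pt mult_sqrt2_le_0_iff
  by auto

text \<open>The walls give x^2 + y^2 + z^2 <= s^2/4 + s^2/4 + s^2/2 = s^2 <= s w, that is, norm at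
  most 1. Equality makes every bound sharp, which leaves the ray of \<open>p\<close> (s = 0) and
  that of \<open>a\<close>.\<close>

lemma fund_domain_norm:
  assumes v: "v \<in> fund_domain b"
  shows "norm v \<le> 1" "norm v = 1 \<Longrightarrow> v = proj p \<or> v = proj a"
proof -
  obtain s x y z w where lv: "lift v = F.pt (s, x, y, z, w)"
    using F.surj_pt by blast
  note c = v[unfolded fund_domain_coords[OF lv]]
  have s0: "s \<ge> 0" using c by auto
  have x2: "x\<^sup>2 \<le> (s / 2)\<^sup>2" using c by (intro power_mono) auto
  have y2: "y\<^sup>2 \<le> (s / 2)\<^sup>2" using c by (intro power_mono) auto
  have z2: "z\<^sup>2 \<le> (sqrt 2 * s / 2)\<^sup>2" using c by (intro power_mono) auto
  have sum: "(s / 2)\<^sup>2 + (s / 2)\<^sup>2 + (sqrt 2 * s / 2)\<^sup>2 = s * s"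
    by (simp add: power_divide power_mult_distrib) (simp add: power2_eq_square)
  have sw: "s * s \<le> s * w" using c s0 by (intro mult_left_mono) auto
  have n: "(norm v)\<^sup>2 - 1 = x\<^sup>2 + y\<^sup>2 + z\<^sup>2 - s * w"
    unfolding lorentz_lift_self[symmetric] lv by (rule F.pt_self)
  then have "(norm v)\<^sup>2 \<le> 1" using x2 y2 z2 sum sw by linarith
  then show "norm v \<le> 1" by (simp add: abs_square_le_1)
  assume "norm v = 1"
  then have n': "x\<^sup>2 + y\<^sup>2 + z\<^sup>2 = s * w"
    using n by simp
  have eq: "x\<^sup>2 = (s / 2)\<^sup>2" "y\<^sup>2 = (s / 2)\<^sup>2" "z\<^sup>2 = (sqrt 2 * s / 2)\<^sup>2" "s * w = s * s"
    using n' x2 y2 z2 sum sw by linarith+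
  have xyz: "x = s / 2" "y = s / 2" "z = sqrt 2 * s / 2"
    using eq c s0 by (simp_all only: power2_eq_iff_nonneg divide_nonneg_nonneg mult_nonneg_nonneg real_sqrt_ge_zero zero_le_numeral order_trans)
      auto
  show "v = proj p \<or> v = proj a"
  proof (cases "s = 0")
    case True
    then have l: "lift v = w *\<^sub>R p" using lv xyz by simp
    then have "w \<noteq> 0" by (auto simp: lift_def zero_prod_def)
    then have "v = proj p" using l proj_lift[of v] by (simp add: proj_scaleR)
    then show ?thesis ..
  next
    case False
    then have "w = s" using eq by simp
    then have "lift v = s *\<^sub>R a"
      unfolding lv a_eq_pt pt_scaleR by (simp only: xyz) simp
    then have "v = proj a" using False proj_lift[of v] by (simp add: proj_scaleR)
    then show ?thesis ..
  qed
qed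

lemma norm_proj_null: "lorentz v v = 0 \<Longrightarrow> fst v > 0 \<Longrightarrow> norm (proj v) = 1"
  using lorentz_lift_self[of "proj v"] by (simp add: lift_proj abs_square_eq_1)

lemma p_mem: "proj p \<in> fund_domain b" and a_mem: "proj a \<in> fund_domain b"
proof -
  have "lift (proj p) = F.pt (0, 0, 0, 0, 1 / fst p)"
    using p_future by (simp add: lift_proj)
  from fund_domain_coords[OF this] show "proj p \<in> fund_domain b"
    using p_future by simp
  define k where "k = 1 / fst a"
  have k: "k > 0" using a_future by (simp add: k_def)
  have "lift (proj a) = k *\<^sub>R a"
    using a_future by (simp add: lift_proj k_def)
  then have "lift (proj a) = F.pt (k * 1, k * (1 / 2), k * (1 / 2), k * (sqrt 2 / 2), k * 1)"
    by (simp only: a_eq_pt pt_scaleR)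
  from fund_domain_coords[OF this] show "proj a \<in> fund_domain b"
    using k by simp
qed

lemma ideal_vertices_eq: "ideal_vertices b = {proj p, proj a}"
proof -
  have "fund_domain b \<subseteq> cball 0 1"
    using fund_domain_norm(1) by auto
  then have "v extreme_point_of fund_domain b" if "v \<in> fund_domain b" "norm v = 1" for v
    using extreme_point_of_subset_cball that by blast
  moreover have "norm (proj p) = 1" "norm (proj a) = 1"
    using norm_proj_null p_future a_future by blast+
  moreover have "v \<in> fund_domain b" if "v extreme_point_of fund_domain b" for v
    using that by (simp add: extreme_point_of_def)
  ultimately show ?thesis
    using fund_domain_norm(2) p_mem a_mem unfolding ideal_vertices_def by blast
qed

lemma hyperplane_coords:
  assumes "lift v = F.pt (s, x, y, z, w)"
  shows "v \<in> hyperplane (b 0) \<longleftrightarrow> y = 0" "v \<in> hyperplane (b 1) \<longleftrightarrow> y = x"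
    "v \<in> hyperplane (b 2) \<longleftrightarrow> x = s / 2" "v \<in> hyperplane (b 3) \<longleftrightarrow> w = s"
    "v \<in> hyperplane (b 4) \<longleftrightarrow> z = sqrt 2 * s / 2"
  unfolding hyperplane_def mem_Collect_eq assms lorentz_F_pt by auto

lemma atMost_4_minus: "{..4::nat} - {3} = {0, 1, 2, 4}" "{..4::nat} - {0} = {1, 2, 3, 4}"
  by (auto simp: atMost_Suc numeral_eq_Suc)

lemma pt_zero_iff: "F.pt (s, x, y, z, w) = 0 \<longleftrightarrow> s = 0 \<and> x = 0 \<and> y = 0 \<and> z = 0 \<and> w = 0"
proof
  assume "F.pt (s, x, y, z, w) = 0"
  then show "s = 0 \<and> x = 0 \<and> y = 0 \<and> z = 0 \<and> w = 0"
    using F.pt_lorentz[of s x y z w] by (simp del: F.pt.simps)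
qed simp

lemma lift_proj_scaled: "fst v > 0 \<Longrightarrow> \<exists>k>0. lift (proj v) = k *\<^sub>R v"
  by (rule exI[of _ "1 / fst v"]) (simp add: lift_proj)

text \<open>Four linear equations leave a line in the five coordinates, and the chart condition in
  \<open>lift\<close> picks one point of it, as \<open>THE\<close> requires.\<close>

lemma vertex_3: "vertex b 3 = proj p"
proof -
  have "(\<forall>j\<in>{..4} - {3}. v \<in> hyperplane (b j)) \<longleftrightarrow> v = proj p" for v
  proof -
    obtain s x y z w where lv: "lift v = F.pt (s, x, y, z, w)"
      using F.surj_pt by blast
    have "(\<forall>j\<in>{..4} - {3}. v \<in> hyperplane (b j)) \<longleftrightarrow> s = 0 \<and> x = 0 \<and> y = 0 \<and> z = 0"
      unfolding atMost_4_minus ball_simps hyperplane_coords[OF lv] by auto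
    also have "\<dots> \<longleftrightarrow> v = proj p"
    proof
      assume "s = 0 \<and> x = 0 \<and> y = 0 \<and> z = 0"
      then have l: "lift v = w *\<^sub>R p" using lv by simp
      then have "w \<noteq> 0" by (auto simp: lift_def zero_prod_def)
      then show "v = proj p" using l proj_lift[of v] by (simp add: proj_scaleR)
    next
      assume v: "v = proj p"
      obtain k where "lift v = k *\<^sub>R p"
        using lift_proj_scaled p_future v by blast
      then have "F.pt (s, x, y, z, w - k) = 0"
        using lv by (simp add: algebra_simps)
      then show "s = 0 \<and> x = 0 \<and> y = 0 \<and> z = 0"
        by (simp only: pt_zero_iff)
    qed
    finally show ?thesis .
  qed
  then show ?thesis by (simp add: vertex_def)
qed

lemma vertex_0: "vertex b 0 = proj a"
proof -
  have "(\<forall>j\<in>{..4} - {0}. v \<in> hyperplane (b j)) \<longleftrightarrow> v = proj a" for v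
  proof -
    obtain s x y z w where lv: "lift v = F.pt (s, x, y, z, w)"
      using F.surj_pt by blast
    have "(\<forall>j\<in>{..4} - {0}. v \<in> hyperplane (b j)) \<longleftrightarrow>
        x = s / 2 \<and> y = s / 2 \<and> z = sqrt 2 * s / 2 \<and> w = s"
      unfolding atMost_4_minus ball_simps hyperplane_coords[OF lv] by auto
    also have "\<dots> \<longleftrightarrow> v = proj a"
    proof
      assume "x = s / 2 \<and> y = s / 2 \<and> z = sqrt 2 * s / 2 \<and> w = s"
      then have *: "x = s * (1 / 2)" "y = s * (1 / 2)" "z = s * (sqrt 2 / 2)" "w = s * 1"
        by auto
      have l: "lift v = s *\<^sub>R a"
        unfolding lv a_eq_pt pt_scaleR * by simp
      then have "s \<noteq> 0" by (auto simp: lift_def zero_prod_def)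
      then show "v = proj a" using l proj_lift[of v] by (simp add: proj_scaleR)
    next
      assume v: "v = proj a"
      obtain k where "lift v = k *\<^sub>R a"
        using lift_proj_scaled a_future v by blast
      then have "lift v - k *\<^sub>R a = 0" by simp
      also have "lift v - k *\<^sub>R a = F.pt (s - k, x - k / 2, y - k / 2, z - k * (sqrt 2 / 2), w - k)"
        unfolding lv a_eq_pt by (simp add: algebra_simps)
      finally show "x = s / 2 \<and> y = s / 2 \<and> z = sqrt 2 * s / 2 \<and> w = s"
        unfolding pt_zero_iff by auto
    qed
    finally show ?thesis .
  qed
  then show ?thesis by (simp add: vertex_def)
qed

section \<open>Volumes of the polytope and of the horoball pieces\<close>

lemma fund_domain_borel: "fund_domain b \<in> sets borel"
  unfolding fund_domain_def by (intro borel_closed closed_INT ballI closed_halfspace)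

lemma one_div_sqrt2: "1 / sqrt 2 = sqrt 2 / 2"
  by (simp add: field_simps)

lemma emeasure_fund_domain: "emeasure hyp_measure (fund_domain b) = ennreal (pi\<^sup>2 / 144)"
proof -
  have "emeasure hyp_measure (fund_domain b \<inter> hyp_space) = ennreal (pi\<^sup>2 / 144)"
  proof (rule F.emeasure_prism_polytope)
    fix x y z w assume \<tau>: "F.\<tau> (x, y, z, w) > 0"
    show "proj (F.pt (1, x, y, z, w)) \<in> fund_domain b \<inter> hyp_space \<longleftrightarrow>
        0 \<le> y \<and> y \<le> x \<and> x \<le> 1 / 2 \<and> 0 \<le> z \<and> z \<le> 1 / sqrt 2 \<and> 1 \<le> w"
      unfolding Int_iff fund_domain_iff ball_simps F.proj_pt_mem(1)[OF \<tau>] lorentz_F_pt mult_sqrt2_le_0_iff one_div_sqrt2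
      using F.proj_pt_mem(2)[OF \<tau>] by (auto simp del: F.pt.simps)
  qed (use fund_domain_borel hyp_space_borel in auto)
  then show ?thesis
    by (simp only: hyp_measure_Int_hyp_space[OF fund_domain_borel])
qed

text \<open>These are the walls off the respective centre. Inside the horoballs only the vertical
  walls then cut out the region, so \<open>emeasure_cusp\<close> applies.\<close>

lemma horo_p_sub: "horo (2 *\<^sub>R p) \<subseteq> halfspace (b 3)"
  and horo_a_sub: "horo (2 *\<^sub>R a) \<subseteq> halfspace (b 0)" "horo (2 *\<^sub>R a) \<subseteq> halfspace (b 5)"
  using p_future a_future b_self[of 0] b_self[of 3] b_self[of 5] lorentz_F_pt(4)[of 0 0 0 0 1]
    lorentz_F_pt(1,6)[of 1 "1 / 2" "1 / 2" "sqrt 2 / 2" 1]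
  by (intro horo_subset_halfspace; simp add: p_eq_pt[symmetric] a_eq_pt[symmetric] del: F.pt.simps)+

text \<open>A third of the prism over a triangle of area 1/8 with height 1 / sqrt 2.\<close>

lemma emeasure_horo_p: "emeasure hyp_measure (horo (2 *\<^sub>R p) \<inter> fund_domain b) = ennreal (sqrt 2 / 48)"
proof -
  let ?D = "{(x :: real, y :: real, z :: real). 0 \<le> y \<and> y \<le> x \<and> x \<le> 1 / 2 \<and> 0 \<le> z \<and> z \<le> 1 / sqrt 2}"
  have "?D \<in> sets borel"
    unfolding split_beta' by (intro borel_closed closed_Collect_conj closed_Collect_le continuous_intros)
  then have "emeasure hyp_measure (horo (2 *\<^sub>R p) \<inter> fund_domain b) = ennreal (1 / 3) *
      (\<integral>\<^sup>+x. \<integral>\<^sup>+y. \<integral>\<^sup>+z. indicator ?D (x, y, z) \<partial>lborel \<partial>lborel \<partial>lborel)"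
  proof (intro F.emeasure_cusp)
    fix x y z w assume \<tau>: "F.\<tau> (x, y, z, w) > 0"
    have "proj (F.pt (1, x, y, z, w)) \<in> horo (2 *\<^sub>R p) \<inter> fund_domain b \<longleftrightarrow>
        1 \<le> F.\<tau> (x, y, z, w) \<and> (\<forall>i\<in>{0, 1, 2, 4, 5}. proj (F.pt (1, x, y, z, w)) \<in> halfspace (b i))"
      unfolding Int_iff fund_domain_iff F.proj_pt_mem(3)[OF \<tau>, symmetric] using horo_p_sub by blast
    also have "\<dots> \<longleftrightarrow> (x, y, z) \<in> ?D \<and> 1 \<le> F.\<tau> (x, y, z, w)"
      unfolding ball_simps F.proj_pt_mem(1)[OF \<tau>] lorentz_F_pt mult_sqrt2_le_0_iff one_div_sqrt2 by auto
    finally show "proj (F.pt (1, x, y, z, w)) \<in> horo (2 *\<^sub>R p) \<inter> fund_domain b \<longleftrightarrow>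
        (x, y, z) \<in> ?D \<and> 1 \<le> F.\<tau> (x, y, z, w)" .
  qed (use horo_borel[of "2 *\<^sub>R p"] fund_domain_borel horo_subset_hyp_space[of "2 *\<^sub>R p"] in auto)
  also have "\<dots> = ennreal (1 / 3) * ennreal (1 / sqrt 2 / 8)"
    by (subst nn_integral_prism) simp_all
  also have "\<dots> = ennreal (1 / 3 * (1 / sqrt 2 / 8))"
    by (rule ennreal_mult'[symmetric]) simp
  finally show ?thesis by (simp add: one_div_sqrt2)
qed

text \<open>A third of the Euclidean orthoscheme with three successive orthogonal edges of length 1
  / sqrt 2.\<close>

lemma emeasure_horo_a: "emeasure hyp_measure (horo (2 *\<^sub>R a) \<inter> fund_domain b) = ennreal (sqrt 2 / 72)"
proof -
  let ?D = "{(x :: real, y :: real, z :: real). 0 \<le> z \<and> z \<le> y \<and> y \<le> x \<and> x \<le> 1 / sqrt 2}"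
  have "?D \<in> sets borel"
    unfolding split_beta' by (intro borel_closed closed_Collect_conj closed_Collect_le continuous_intros)
  then have "emeasure hyp_measure (horo (2 *\<^sub>R a) \<inter> fund_domain b) = ennreal (1 / 3) *
      (\<integral>\<^sup>+x. \<integral>\<^sup>+y. \<integral>\<^sup>+z. indicator ?D (x, y, z) \<partial>lborel \<partial>lborel \<partial>lborel)"
  proof (intro G.emeasure_cusp)
    fix x y z w assume \<tau>: "G.\<tau> (x, y, z, w) > 0"
    have "proj (G.pt (1, x, y, z, w)) \<in> horo (2 *\<^sub>R a) \<inter> fund_domain b \<longleftrightarrow>
        1 \<le> G.\<tau> (x, y, z, w) \<and> (\<forall>i\<in>{1, 2, 3, 4}. proj (G.pt (1, x, y, z, w)) \<in> halfspace (b i))"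
      unfolding Int_iff fund_domain_iff G.proj_pt_mem(3)[OF \<tau>, symmetric] using horo_a_sub by blast
    also have "\<dots> \<longleftrightarrow> (x, y, z) \<in> ?D \<and> 1 \<le> G.\<tau> (x, y, z, w)"
      unfolding ball_simps G.proj_pt_mem(1)[OF \<tau>] lorentz_G_pt mult_sqrt2_le_0_iff one_div_sqrt2 by auto
    finally show "proj (G.pt (1, x, y, z, w)) \<in> horo (2 *\<^sub>R a) \<inter> fund_domain b \<longleftrightarrow>
        (x, y, z) \<in> ?D \<and> 1 \<le> G.\<tau> (x, y, z, w)" .
  qed (use horo_borel[of "2 *\<^sub>R a"] fund_domain_borel horo_subset_hyp_space[of "2 *\<^sub>R a"] in auto)
  also have "\<dots> = ennreal (1 / 3) * ennreal ((1 / sqrt 2) ^ 3 / 6)"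
    by (subst nn_integral_orthoscheme) simp_all
  also have "\<dots> = ennreal (1 / 3 * ((1 / sqrt 2) ^ 3 / 6))"
    by (rule ennreal_mult'[symmetric]) simp
  also have "1 / 3 * ((1 / sqrt 2) ^ 3 / 6) = sqrt 2 / 72"
    unfolding one_div_sqrt2 by (simp add: power3_eq_cube)
  finally show ?thesis .
qed

end

section \<open>The optimal packing\<close>

context coxeter_44340
begin

text \<open>The additional condition \<open>x - y \<in> \<int>\<close> makes $2 \langle u, v \rangle$ integral.\<close>

definition lattice :: "(real \<times> (real^4)) set" where
  "lattice = {F.pt (s, x, y, z, w) | s x y z w.
     s \<in> \<int> \<and> w \<in> \<int> \<and> 2 * x \<in> \<int> \<and> x - y \<in> \<int> \<and> sqrt 2 * z \<in> \<int>}"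

text \<open>Quantifying over real \<open>c\<close> makes the property invariant under linear maps
  that preserve the lattice together with their inverses, and forces two primitive vectors on one
  ray to be equal.\<close>

definition primitive :: "real \<times> (real^4) \<Rightarrow> bool" where
  "primitive v \<longleftrightarrow> v \<in> lattice \<and> lorentz v v = 0 \<and> fst v > 0 \<and> (\<forall>c. c *\<^sub>R v \<in> lattice \<longrightarrow> c \<in> \<int>)"

lemma pt_diff: "F.pt (s, x, y, z, w) - F.pt (s', x', y', z', w') =
    F.pt (s - s', x - x', y - y', z - z', w - w')"
  by (simp add: algebra_simps)

lemma pt_eq_iff: "F.pt (s, x, y, z, w) = F.pt (s', x', y', z', w') \<longleftrightarrow>
    s = s' \<and> x = x' \<and> y = y' \<and> z = z' \<and> w = w'"
  using pt_zero_iff[of "s - s'" "x - x'" "y - y'" "z - z'" "w - w'", folded pt_diff]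
  by (simp only: right_minus_eq)

lemma b_eq_pt:
  "b 0 = F.pt (0, 0, - 1, 0, 0)" "b 1 = F.pt (0, - (sqrt 2 / 2), sqrt 2 / 2, 0, 0)"
  "b 2 = F.pt (0, 1, 0, 0, 1)" "b 3 = F.pt (1, 0, 0, 0, - 1)"
  "b 4 = F.pt (0, 0, 0, 1, sqrt 2)" "b 5 = F.pt (0, 0, 0, - 1, 0)"
  unfolding b_frame by (simp_all add: algebra_simps)

lemma pt_lattice_iff: "F.pt (s, x, y, z, w) \<in> lattice \<longleftrightarrow>
    s \<in> \<int> \<and> w \<in> \<int> \<and> 2 * x \<in> \<int> \<and> x - y \<in> \<int> \<and> sqrt 2 * z \<in> \<int>"
  unfolding lattice_def mem_Collect_eq pt_eq_iff by blast

text \<open>The walls through the cusp act as Euclidean motions of (x, y, z) at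
  \<open>s = 1\<close>, with \<open>w\<close> adjusted to keep the Lorentz square;
  \<open>b 3\<close> is inversion in the unit sphere and exchanges \<open>s\<close> and
  \<open>w\<close>.\<close>

lemma reflection_pt:
  "reflection (b 0) (F.pt (s, x, y, z, w)) = F.pt (s, x, - y, z, w)"
  "reflection (b 1) (F.pt (s, x, y, z, w)) = F.pt (s, y, x, z, w)"
  "reflection (b 2) (F.pt (s, x, y, z, w)) = F.pt (s, s - x, y, z, w - 2 * x + s)"
  "reflection (b 3) (F.pt (s, x, y, z, w)) = F.pt (w, x, y, z, s)"
  "reflection (b 4) (F.pt (s, x, y, z, w)) = F.pt (s, x, y, sqrt 2 * s - z, w - 2 * (sqrt 2 * z) + 2 * s)"
  "reflection (b 5) (F.pt (s, x, y, z, w)) = F.pt (s, x, y, - z, w)"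
  unfolding reflection_def lorentz_F_pt unfolding b_eq_pt pt_scaleR pt_diff pt_eq_iff
  by (simp_all add: field_simps)

text \<open>The condition on \<open>x - y\<close> survives \<open>b 2\<close> because
  \<open>(s - x) - y = s - 2 * x + (x - y)\<close>, and the one on \<open>z\<close> survives
  \<open>b 4\<close> because \<open>sqrt 2 * (sqrt 2 * s - z) = 2 * s - sqrt 2 * z\<close>.\<close>

lemma reflection_lattice:
  assumes i: "i \<le> 5" and v: "v \<in> lattice"
  shows "reflection (b i) v \<in> lattice"
proof -
  obtain s x y z w where pt: "v = F.pt (s, x, y, z, w)"
    and "s \<in> \<int>" "w \<in> \<int>" "2 * x \<in> \<int>" "x - y \<in> \<int>" and z: "sqrt 2 * z \<in> \<int>"
    using v by (auto simp only: lattice_def mem_Collect_eq)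
  then obtain n m k l where s: "s = of_int n" and w: "w = of_int m"
    and x: "2 * x = of_int k" and y: "x - y = of_int l"
    by (auto elim!: Ints_cases)
  have y': "y = x - of_int l" using y by simp
  have mem: "2 * y \<in> \<int>" "x + y \<in> \<int>" "y - x \<in> \<int>" "2 * (s - x) \<in> \<int>" "s - x - y \<in> \<int>"
    "w - 2 * x + s \<in> \<int>" "x - y \<in> \<int>"
  proof -
    have "2 * y = of_int (k - 2 * l)" "x + y = of_int (k - l)" "y - x = of_int (- l)"
      "2 * (s - x) = of_int (2 * n - k)" "s - x - y = of_int (n - k + l)"
      "w - 2 * x + s = of_int (m - k + n)" "x - y = of_int l"
      using x by (simp_all add: y' s w)
    then show "2 * y \<in> \<int>" "x + y \<in> \<int>" "y - x \<in> \<int>" "2 * (s - x) \<in> \<int>" "s - x - y \<in> \<int>"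
      "w - 2 * x + s \<in> \<int>" "x - y \<in> \<int>"
      by (simp_all only: Ints_of_int)
  qed
  have int: "s \<in> \<int>" "w \<in> \<int>" "2 * x \<in> \<int>" by (simp_all add: s w x)
  have z1: "sqrt 2 * (sqrt 2 * s - z) \<in> \<int>"
  proof -
    have "sqrt 2 * (sqrt 2 * s - z) = 2 * s - sqrt 2 * z" by (simp add: right_diff_distrib)
    then show ?thesis using int z by simp
  qed
  have z2: "w - 2 * (sqrt 2 * z) + 2 * s \<in> \<int>" "sqrt 2 * - z \<in> \<int>"
    using int z by simp_all
  have "i \<in> {0, 1, 2, 3, 4, 5}" using i atMost_5 by auto
  then show ?thesis
    unfolding pt using mem int z z1 z2
    by (elim insertE emptyE; simp only: reflection_pt pt_lattice_iff diff_minus_eq_add simp_thms)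
qed

lemma primitive_reflection:
  assumes i: "i \<le> 5" and v: "primitive v"
  shows "primitive (reflection (b i) v)"
proof -
  note iso = future_isometry_reflection[OF b_self[OF i]]
  have "c \<in> \<int>" if "c *\<^sub>R reflection (b i) v \<in> lattice" for c
  proof -
    have "reflection (b i) (c *\<^sub>R reflection (b i) v) \<in> lattice"
      by (rule reflection_lattice[OF i that])
    then have "c *\<^sub>R v \<in> lattice"
      by (simp add: linear_cmul[OF linear_reflection] reflection_reflection[OF b_self[OF i]])
    then show ?thesis using v by (simp add: primitive_def)
  qed
  then show ?thesis
    using v future_isometryD[OF iso] reflection_lattice[OF i] by (simp add: primitive_def)
qed

text \<open>Each has a coordinate 1 among the integral ones \<open>s\<close> and \<open>w\<close>,
  so the factor of a multiple in the lattice shows up as a coordinate.\<close>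

lemma primitive_p: "primitive p" and primitive_a: "primitive a"
proof -
  show "primitive p"
    unfolding primitive_def
    by (subst (1 5) p_eq_pt) (simp only: pt_scaleR pt_lattice_iff p_future, simp)
  show "primitive a"
    unfolding primitive_def
    by (subst (1 5) a_eq_pt) (simp only: pt_scaleR pt_lattice_iff a_future, simp)
qed

text \<open>With x = k/2 and y = k/2 - l, the terms 2 x x' and 2 y y' each contain k k'/2; together
  these make the integer k k'.\<close>

lemma lattice_product:
  assumes "u \<in> lattice" "v \<in> lattice"
  shows "2 * lorentz u v \<in> \<int>"
proof -
  obtain s x y z w where u: "u = F.pt (s, x, y, z, w)"
    and "s \<in> \<int>" "w \<in> \<int>" "2 * x \<in> \<int>" "x - y \<in> \<int>" and "sqrt 2 * z \<in> \<int>"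
    using assms(1) by (auto simp only: lattice_def mem_Collect_eq)
  then obtain n m k l j where i: "s = of_int n" "w = of_int m"
    "2 * x = of_int k" "x - y = of_int l" "sqrt 2 * z = of_int j"
    by (auto elim!: Ints_cases)
  obtain s' x' y' z' w' where v: "v = F.pt (s', x', y', z', w')"
    and "s' \<in> \<int>" "w' \<in> \<int>" "2 * x' \<in> \<int>" "x' - y' \<in> \<int>" and "sqrt 2 * z' \<in> \<int>"
    using assms(2) by (auto simp only: lattice_def mem_Collect_eq)
  then obtain n' m' k' l' j' where i': "s' = of_int n'" "w' = of_int m'"
    "2 * x' = of_int k'" "x' - y' = of_int l'" "sqrt 2 * z' = of_int j'"
    by (auto elim!: Ints_cases)
  have y: "x = of_int k / 2" "x' = of_int k' / 2" "y = of_int k / 2 - of_int l" "y' = of_int k' / 2 - of_int l'"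
    using i i' by simp_all
  have "2 * (z * z') = (sqrt 2 * z) * (sqrt 2 * z')" by simp
  then have z: "2 * (z * z') = of_int (j * j')" by (simp add: i i')
  have "2 * lorentz u v = - (s * w' + w * s') + 2 * (x * x') + 2 * (y * y') + 2 * (z * z')"
    unfolding u v by (simp add: F.gram F.gram' algebra_simps)
  also have "\<dots> = of_int (- (n * m' + m * n') + k * k' - k * l' - l * k' + 2 * l * l' + j * j')"
    unfolding z y by (simp add: i(1,2) i'(1,2) field_simps)
  finally show ?thesis by (simp only: Ints_of_int)
qed

text \<open>If the product vanishes, the vectors are on one ray and \<open>c\<close> and
  \<open>1 / c\<close> are both positive integers. Otherwise \<open>2 * lorentz u v\<close> is a
  negative integer, and doubling both vectors multiplies their product by 4.\<close>

lemma primitive_separated: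
  assumes u: "primitive u" and v: "primitive v"
  shows "u = v \<or> lorentz (2 *\<^sub>R u) (2 *\<^sub>R v) \<le> - 2"
proof (cases "lorentz u v = 0")
  case True
  define c where "c = fst v / fst u"
  have c: "c > 0" using u v by (simp add: c_def primitive_def)
  have vu: "v = c *\<^sub>R u"
    using null_orthogonal_proportional[of u v] u v True by (simp add: c_def primitive_def)
  then have uv: "u = (1 / c) *\<^sub>R v" using c by simp
  have "c \<in> \<int>" "1 / c \<in> \<int>"
    using u v vu uv unfolding primitive_def by metis+
  moreover have "1 \<le> t" if "t \<in> \<int>" "0 < t" for t :: real
    using that by (auto elim!: Ints_cases)
  ultimately have "c \<ge> 1" "1 / c \<ge> 1" using c by simp_all
  then have "c = 1" using c by (simp add: le_divide_eq_1)
  then show ?thesis using vu by simp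
next
  case False
  have "lorentz u v \<le> 0"
    using null_future_product_nonpos[of u v] u v by (simp add: primitive_def)
  moreover obtain n where n: "2 * lorentz u v = of_int n"
    using lattice_product[of u v] u v by (auto simp: primitive_def elim: Ints_cases)
  ultimately have "of_int n < (0 :: real)" using False by simp
  then have "n \<le> - 1" by simp
  then have "2 * lorentz u v \<le> - 1" unfolding n by simp
  then show ?thesis by simp
qed

text \<open>\<open>refl_group\<close> composes with generators on the left; the inverse that
  \<open>act_horo\<close> asks for is built along by composing on the right.\<close>

lemma refl_group_future_isometry:
  assumes "g \<in> refl_group b"
  shows "\<exists>h. future_isometry g \<and> future_isometry h \<and> g \<circ> h = id \<and> h \<circ> g = id"
  using assms
proof induction
  case one
  show ?case by (intro exI[of _ id] conjI future_isometry_id) simp_all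
next
  case (refl g i)
  then obtain h where h: "future_isometry g" "future_isometry h" "g \<circ> h = id" "h \<circ> g = id"
    by blast
  let ?r = "reflection (b i)"
  have i: "i \<le> 5" using refl by simp
  have rr: "?r \<circ> ?r = id"
    using reflection_reflection[OF b_self[OF i]] by (simp add: fun_eq_iff)
  have "(?r \<circ> g) \<circ> (h \<circ> ?r) = ?r \<circ> (g \<circ> h) \<circ> ?r" by (simp only: comp_assoc)
  then have 1: "(?r \<circ> g) \<circ> (h \<circ> ?r) = id" by (simp only: h rr comp_id)
  have "(h \<circ> ?r) \<circ> (?r \<circ> g) = h \<circ> (?r \<circ> ?r) \<circ> g" by (simp only: comp_assoc)
  then have 2: "(h \<circ> ?r) \<circ> (?r \<circ> g) = id" by (simp only: h rr comp_id)
  note iso = future_isometry_reflection[OF b_self[OF i]]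
  show ?case
    using future_isometry_comp[OF iso h(1)] future_isometry_comp[OF h(2) iso] 1 2 by blast
qed

lemma refl_group_primitive:
  assumes "g \<in> refl_group b" "primitive v"
  shows "primitive (g v)"
  using assms by induction (simp_all add: primitive_reflection)

lemma refl_group_act_horo:
  assumes "g \<in> refl_group b"
  shows "act g ` horo (2 *\<^sub>R v) = horo (2 *\<^sub>R g v)"
proof -
  obtain h where "future_isometry g" "future_isometry h" "g \<circ> h = id" "h \<circ> g = id"
    using refl_group_future_isometry[OF assms] by blast
  then show ?thesis
    using act_horo[of g h "2 *\<^sub>R v"] linear_cmul[OF future_isometryD(1), of g 2 v] by simp
qed

section \<open>The maximal horoballs and the bound on the density\<close>

lemma lorentz_p_b: "lorentz p (b 3) = - 1 / 2" "i \<le> 5 \<Longrightarrow> i \<noteq> 3 \<Longrightarrow> lorentz p (b i) = 0"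
  and lorentz_a_b: "lorentz a (b 0) = - 1 / 2" "lorentz a (b 5) = - sqrt 2 / 2"
    "i \<le> 5 \<Longrightarrow> i \<noteq> 0 \<Longrightarrow> i \<noteq> 5 \<Longrightarrow> lorentz a (b i) = 0"
proof -
  note P = lorentz_F_pt[of 0 0 0 0 1, folded p_eq_pt]
  note A = lorentz_F_pt[of 1 "1 / 2" "1 / 2" "sqrt 2 / 2" 1, folded a_eq_pt]
  show "lorentz p (b 3) = - 1 / 2" using P(4) by simp
  show "lorentz a (b 0) = - 1 / 2" "lorentz a (b 5) = - sqrt 2 / 2" using A(1,6) by simp_all
  have I: "i \<in> {0, 1, 2, 3, 4, 5}" if "i \<le> 5" for i :: nat using that atMost_5 by auto
  show "lorentz p (b i) = 0" if "i \<le> 5" "i \<noteq> 3"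
    using I[OF that(1)] that(2) P by auto
  show "lorentz a (b i) = 0" if "i \<le> 5" "i \<noteq> 0" "i \<noteq> 5"
    using I[OF that(1)] that(2,3) A by auto
qed

lemma touching_p: "touching b (2 *\<^sub>R p)"
proof -
  have "lorentz (2 *\<^sub>R p) (b i) = 0 \<or> lorentz (2 *\<^sub>R p) (b i) \<le> - 1" if "i \<le> 5" for i
    using lorentz_p_b(1) lorentz_p_b(2)[OF that] by (cases "i = 3") simp_all
  then show ?thesis
    using p_future b_self lorentz_p_b(1) by (auto simp: touching_def intro!: exI[of _ 3])
qed

lemma touching_a: "touching b (2 *\<^sub>R a)"
proof -
  have "lorentz (2 *\<^sub>R a) (b i) = 0 \<or> lorentz (2 *\<^sub>R a) (b i) \<le> - 1" if "i \<le> 5" for i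
    using lorentz_a_b(1,2) lorentz_a_b(3)[OF that] by (cases "i = 0"; cases "i = 5") simp_all
  then show ?thesis
    using a_future b_self lorentz_a_b(1) by (auto simp: touching_def intro!: exI[of _ 0])
qed

lemma proj_double: "proj (2 *\<^sub>R v) = proj v"
  by (simp add: proj_scaleR)

lemma max_horoball_p: "max_horoball b (proj p) = horo (2 *\<^sub>R p)"
  using max_horoball_eq[OF touching_p] by (simp only: proj_double)

lemma max_horoball_a: "max_horoball b (proj a) = horo (2 *\<^sub>R a)"
  using max_horoball_eq[OF touching_a] by (simp only: proj_double)

lemma proj_p_neq_proj_a: "proj p \<noteq> proj a"
proof
  assume "proj p = proj a"
  then have "lift (proj p) = lift (proj a)" by simp
  then have "lorentz ((1 / fst p) *\<^sub>R p) (b 0) = lorentz ((1 / fst a) *\<^sub>R a) (b 0)"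
    using p_future a_future by (simp add: lift_proj)
  then show False
    using lorentz_p_b(2)[of 0] lorentz_a_b(1) a_future by simp
qed

lemma hyp_vol_values:
  "hyp_vol (fund_domain b) = pi\<^sup>2 / 144"
  "hyp_vol (horo (2 *\<^sub>R p) \<inter> fund_domain b) = sqrt 2 / 48"
  "hyp_vol (horo (2 *\<^sub>R a) \<inter> fund_domain b) = sqrt 2 / 72"
  unfolding hyp_vol_def
  by (rule measure_eq_emeasure_eq_ennreal[OF _ emeasure_fund_domain], simp)
    (rule measure_eq_emeasure_eq_ennreal[OF _ emeasure_horo_p], simp,
     rule measure_eq_emeasure_eq_ennreal[OF _ emeasure_horo_a], simp)

text \<open>\<open>measure\<close> is 0 by default on sets of infinite measure, so monotonicity
  rests on the finite volume of the polytope.\<close>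

lemma hyp_vol_mono_fund_domain:
  assumes "horoball x r \<subseteq> horo v"
  shows "hyp_vol (horoball x r \<inter> fund_domain b) \<le> hyp_vol (horo v \<inter> fund_domain b)"
proof -
  have sets: "sets (hyp_measure :: (real^4) measure) = sets borel"
    by (simp add: hyp_measure_def)
  have fm: "fund_domain b \<in> fmeasurable hyp_measure"
    using fund_domain_borel emeasure_fund_domain by (intro fmeasurableI) (simp_all add: sets)
  have "closed {x'. - lorentz (lift x') (lift x) \<le> r * sqrt (- lorentz (lift x') (lift x'))}"
    unfolding lift_def lorentz_def by (intro closed_Collect_le continuous_intros)
  then have "hyp_space \<inter> {x'. - lorentz (lift x') (lift x) \<le> r * sqrt (- lorentz (lift x') (lift x'))} \<in> sets borel"
    using hyp_space_borel by (intro sets.Int) (auto intro: borel_closed)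
  also have "hyp_space \<inter> {x'. - lorentz (lift x') (lift x) \<le> r * sqrt (- lorentz (lift x') (lift x'))} = horoball x r"
    by (auto simp: horoball_def)
  finally have "horoball x r \<in> sets borel" .
  moreover have "horo v \<inter> fund_domain b \<in> fmeasurable hyp_measure"
    using fmeasurable_Int_fmeasurable[OF fm, of "horo v"] horo_borel[of v]
    by (simp add: sets Int_commute)
  ultimately show ?thesis
    unfolding hyp_vol_def using assms fund_domain_borel
    by (intro measure_mono_fmeasurable) (auto simp: sets)
qed

text \<open>\<open>1 / fst v\<close> is the size at which \<open>horoball (proj v)\<close> equals
  \<open>horo v\<close>. The second branch serves \<open>proj a\<close> and is a default
  elsewhere.\<close>

definition s_max :: "real^4 \<Rightarrow> real" where
  "s_max x = (if x = proj p then 1 / fst (2 *\<^sub>R p) else 1 / fst (2 *\<^sub>R a))"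

lemma horoball_s_max:
  "horoball (proj p) (s_max (proj p)) = horo (2 *\<^sub>R p)"
  "horoball (proj a) (s_max (proj a)) = horo (2 *\<^sub>R a)"
  using horo_eq_horoball[of "2 *\<^sub>R p"] horo_eq_horoball[of "2 *\<^sub>R a"] p_future a_future proj_p_neq_proj_a
  by (simp_all add: s_max_def proj_double)

text \<open>Every ball of the family is \<open>horo\<close> of twice a primitive vector, because the
  group keeps \<open>p\<close> and \<open>a\<close> primitive; pairs of balls are then settled by
  \<open>primitive_separated\<close>.\<close>

lemma horoball_packing_max: "horoball_packing b {proj p, proj a} s_max"
proof -
  have conf: "confined b (proj p) (horo (2 *\<^sub>R p))" "confined b (proj a) (horo (2 *\<^sub>R a))"
    using confined_horo_iff[OF touching_p, of 1] confined_horo_iff[OF touching_a, of 1]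
    by (simp_all add: proj_double)
  have im: "\<exists>u. primitive u \<and> B = horo (2 *\<^sub>R u)"
    if B_mem: "B \<in> {act g ` horoball x (s_max x) | g x. g \<in> refl_group b \<and> x \<in> {proj p, proj a}}" for B
  proof -
    obtain g x where g: "g \<in> refl_group b" "x \<in> {proj p, proj a}" and B: "B = act g ` horoball x (s_max x)"
      using B_mem by blast
    then consider "B = act g ` horo (2 *\<^sub>R p)" | "B = act g ` horo (2 *\<^sub>R a)"
      using horoball_s_max by auto
    then show ?thesis
      using refl_group_act_horo[OF g(1)] refl_group_primitive[OF g(1)] primitive_p primitive_a
      by cases blast+
  qed
  have disjoint: "interior B \<inter> interior B' = {}"
    if B: "B = horo (2 *\<^sub>R u)" "B' = horo (2 *\<^sub>R v)" "B \<noteq> B'" and uv: "primitive u" "primitive v" for B B' u v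
  proof -
    \<comment> \<open>Different balls have different vectors; a ball reached by several group
      elements occurs only once in the family.\<close>
    have "lorentz (2 *\<^sub>R u) (2 *\<^sub>R v) \<le> - 2"
      using primitive_separated[OF uv] B by auto
    then show ?thesis
      unfolding B using uv by (intro horo_interior_disjoint) (simp_all add: primitive_def)
  qed
  have "pairwise (\<lambda>B B'. interior B \<inter> interior B' = {})
      {act g ` horoball x (s_max x) | g x. g \<in> refl_group b \<and> x \<in> {proj p, proj a}}"
    (is "pairwise _ ?S")
  proof (rule pairwiseI)
    fix B B' assume B: "B \<in> ?S" "B' \<in> ?S" "B \<noteq> B'"
    obtain u where u: "primitive u" "B = horo (2 *\<^sub>R u)" using im[OF B(1)] by blast
    obtain v where v: "primitive v" "B' = horo (2 *\<^sub>R v)" using im[OF B(2)] by blast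
    show "interior B \<inter> interior B' = {}"
      by (rule disjoint[OF u(2) v(2) B(3) u(1) v(1)])
  qed
  moreover have "s_max x > 0" for x
    using p_future a_future by (simp add: s_max_def)
  moreover have "confined b x (horoball x (s_max x))" if "x \<in> {proj p, proj a}" for x
    using that conf by (elim insertE emptyE) (simp_all only: horoball_s_max)
  ultimately show ?thesis
    unfolding horoball_packing_def ideal_vertices_eq by (intro conjI ballI) simp_all
qed

lemma packing_density_max:
  "packing_density b {proj p, proj a} s_max = (sqrt 2 / 48 + sqrt 2 / 72) / (pi\<^sup>2 / 144)"
  using proj_p_neq_proj_a by (simp add: packing_density_def horoball_s_max hyp_vol_values)

text \<open>Confinement puts every ball inside the maximal one at its centre, and an ideal vertex
  left out of \<open>V\<close> only lowers the sum.\<close>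

lemma packing_density_le:
  assumes "horoball_packing b V s"
  shows "packing_density b V s \<le> (sqrt 2 / 48 + sqrt 2 / 72) / (pi\<^sup>2 / 144)"
proof -
  let ?vol = "\<lambda>x. hyp_vol (horoball x (s x) \<inter> fund_domain b)"
  let ?max = "\<lambda>x. hyp_vol (horoball x (s_max x) \<inter> fund_domain b)"
  have V: "V \<subseteq> {proj p, proj a}"
    and conf: "\<And>x. x \<in> V \<Longrightarrow> s x > 0 \<and> confined b x (horoball x (s x))"
    using assms unfolding horoball_packing_def ideal_vertices_eq by auto
  have "?vol x \<le> ?max x" if "x \<in> V" for x
  proof -
    consider "x = proj p" | "x = proj a" using V \<open>x \<in> V\<close> by blast
    then show ?thesis
    proof cases
      case 1
      then have "horoball x (s x) \<subseteq> horo (2 *\<^sub>R p)"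
        using confined_horoball_subset[OF touching_p, of "s x"]
          conf[OF that] by (simp only: proj_double)
      then show ?thesis
        using hyp_vol_mono_fund_domain horoball_s_max(1) 1 by metis
    next
      case 2
      then have "horoball x (s x) \<subseteq> horo (2 *\<^sub>R a)"
        using confined_horoball_subset[OF touching_a, of "s x"]
          conf[OF that] by (simp only: proj_double)
      then show ?thesis
        using hyp_vol_mono_fund_domain horoball_s_max(2) 2 by metis
    qed
  qed
  then have "(\<Sum>x\<in>V. ?vol x) \<le> (\<Sum>x\<in>V. ?max x)" by (rule sum_mono)
  also have "\<dots> \<le> (\<Sum>x\<in>{proj p, proj a}. ?max x)"
    using V by (intro sum_mono2) (auto simp: hyp_vol_def)
  also have "\<dots> = sqrt 2 / 48 + sqrt 2 / 72"
    using proj_p_neq_proj_a by (simp add: horoball_s_max hyp_vol_values)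
  finally show ?thesis
    by (simp add: packing_density_def hyp_vol_values divide_right_mono)
qed

lemma opt_density_eq: "opt_density b = (sqrt 2 / 48 + sqrt 2 / 72) / (pi\<^sup>2 / 144)"
  unfolding opt_density_def
proof (rule cSup_eq_maximum)
  show "(sqrt 2 / 48 + sqrt 2 / 72) / (pi\<^sup>2 / 144) \<in> {packing_density b V s | V s. horoball_packing b V s}"
    using horoball_packing_max packing_density_max by force
qed (use packing_density_le in auto)

end

lemma density_approx: "\<bar>(sqrt 2 / 48 + sqrt 2 / 72) / (pi\<^sup>2 / 144) - 0.71645\<bar> \<le> 1 / 10 ^ 5"
proof -
  \<comment> \<open>144/48 + 144/72 = 3 + 2.\<close>
  have eq: "(sqrt 2 / 48 + sqrt 2 / 72) / (pi\<^sup>2 / 144) = 5 * sqrt 2 / pi\<^sup>2"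
    by simp
  have "1.414213 \<le> sqrt 2"
    by (rule real_le_rsqrt) (simp add: power2_eq_square)
  moreover have "sqrt 2 \<le> 1.414214"
    by (rule real_le_lsqrt) (simp_all add: power2_eq_square)
  moreover have "3.14159\<^sup>2 \<le> pi\<^sup>2" "pi\<^sup>2 \<le> 3.141593\<^sup>2"
    using pi_approx by (intro power_mono; simp)+
  moreover have "pi\<^sup>2 > 0" by simp
  ultimately have "5 * sqrt 2 \<le> (0.71645 + 1 / 10 ^ 5) * pi\<^sup>2" "(0.71645 - 1 / 10 ^ 5) * pi\<^sup>2 \<le> 5 * sqrt 2"
    by (simp_all add: power2_eq_square)
  then have "5 * sqrt 2 / pi\<^sup>2 \<le> 0.71645 + 1 / 10 ^ 5" "0.71645 - 1 / 10 ^ 5 \<le> 5 * sqrt 2 / pi\<^sup>2"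
    by (simp_all add: pos_divide_le_eq pos_le_divide_eq)
  moreover have "\<bar>d - 0.71645\<bar> \<le> 1 / 10 ^ 5"
    if "d \<le> 0.71645 + 1 / 10 ^ 5" "0.71645 - 1 / 10 ^ 5 \<le> d" for d :: real
    using that unfolding abs_le_iff by simp
  ultimately show ?thesis
    unfolding eq by blast
qed

theorem theorem4p3:
  fixes b :: "nat \<Rightarrow> real \<times> (real^4)"
  assumes "orthoscheme_normals [4, 4, 3, 4] b"
  shows "ideal_vertices b = {vertex b 0, vertex b 3} \<and>
    hyp_vol (fund_domain b) = pi\<^sup>2 / 144 \<and>
    opt_density b =
      (hyp_vol (max_horoball b (vertex b 0) \<inter> fund_domain b) +
       hyp_vol (max_horoball b (vertex b 3) \<inter> fund_domain b)) / (pi\<^sup>2 / 144) \<and>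
    \<bar>opt_density b - 0.71645\<bar> \<le> 1 / 10 ^ 5"
proof -
  interpret coxeter_44340 b
    using assms by unfold_locales
  show ?thesis
    using density_approx
    by (simp add: ideal_vertices_eq vertex_0 vertex_3 hyp_vol_values opt_density_eq
        max_horoball_p max_horoball_a insert_commute add.commute)
qed

end
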